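(* Let $Q$ be a quadric surface in the Euclidean space $\mathbb{E}^{3}$, with Gauss map $\boldsymbol{G}$. Then there exists a real matrix $M\in\mathbb{R}^{3\times 3}$ (constant on $Q$) such that $$\Delta^{I}\boldsymbol{G}=M\boldsymbol{G}\quad\text{on } Q$$ if and only if $Q$ is (an open part of) a plane, a circular cylinder, or a sphere.
   Context: $\mathbb{E}^{3}$ is $\mathbb{R}^{3}$ with the standard inner product. A quadric surface is a smooth, connected, regular, oriented surface $Q\subset\mathbb{E}^{3}$ contained as an open part in the zero set of a real polynomial of degree two in three variables (degenerate cases such as parts of planes are included). The Gauss map $\boldsymbol{G}:Q\to\mathbb{E}^{3}$ is the unit normal vector field; for a regular parametrization $\boldsymbol{r}(u,v)$ it is $\boldsymbol{G}=\pm(\boldsymbol{r}_u\times\boldsymbol{r}_v)/\|\boldsymbol{r}_u\times\boldsymbol{r}_v\|$, regarded as an $\mathbb{R}^3$-valued function (column vector). $I$ denotes the first fundamental form of $Q$ (the metric induced from $\mathbb{E}^{3}$), with components $g_{ij}$ in local coordinates $(u^1,u^2)$. $\Delta^{I}$ is the Laplace-Beltrami operator (second Beltrami operator) with respect to $I$, with the sign convention $$\Delta^{I}h=-\frac{1}{\sqrt{g}}\sum_{i,j=1}^{2}\frac{\partial}{\partial u^{i}}\Big(\sqrt{g}\,g^{ij}\frac{\partial h}{\partial u^{j}}\Big),\qquad g=\det(g_{ij}),\quad (g^{ij})=(g_{ij})^{-1},$$ for smooth functions $h$ on $Q$; it is applied to $\boldsymbol{G}$ componentwise. *)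

theory Defs
  imports "HOL-Analysis.Analysis"
begin

definition partial_deriv :: "'n::finite \<Rightarrow> (real^'n \<Rightarrow> 'b::real_normed_vector) \<Rightarrow> real^'n \<Rightarrow> 'b"
  where "partial_deriv i f u = vector_derivative (\<lambda>t. f (u + t *\<^sub>R axis i 1)) (at 0)"

(* Intended for open U: k times continuously differentiable on U. *)
primrec Ck_on :: "nat \<Rightarrow> (real^'n::finite) set \<Rightarrow> (real^'n \<Rightarrow> 'b::real_normed_vector) \<Rightarrow> bool"
  where
    "Ck_on 0 U f \<longleftrightarrow> continuous_on U f"
  | "Ck_on (Suc k) U f \<longleftrightarrow>
       (\<forall>u\<in>U. f differentiable (at u)) \<and> (\<forall>i. Ck_on k U (partial_deriv i f))"

definition smooth_on :: "(real^'n::finite) set \<Rightarrow> (real^'n \<Rightarrow> 'b::real_normed_vector) \<Rightarrow> bool"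
  where "smooth_on U f \<longleftrightarrow> (\<forall>k. Ck_on k U f)"

definition chart_normal :: "(real^2 \<Rightarrow> real^3) \<Rightarrow> real^2 \<Rightarrow> real^3"
  where "chart_normal r u = cross3 (partial_deriv 1 r u) (partial_deriv 2 r u)"

definition local_param :: "(real^3) set \<Rightarrow> (real^2) set \<Rightarrow> (real^2 \<Rightarrow> real^3) \<Rightarrow> bool"
  where "local_param Q U r \<longleftrightarrow>
     open U \<and> smooth_on U r \<and> (\<forall>u\<in>U. chart_normal r u \<noteq> 0) \<and>
     openin (top_of_set Q) (r ` U) \<and> (\<exists>s. homeomorphism U (r ` U) r s)"

definition regular_surface :: "(real^3) set \<Rightarrow> bool"
  where "regular_surface Q \<longleftrightarrow> (\<forall>p\<in>Q. \<exists>U r. local_param Q U r \<and> p \<in> r ` U)"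

(* Every homogeneous quadratic form over the reals has exactly one symmetric matrix A,
   so A \<noteq> 0 says that the degree is exactly two. *)
definition degree_two_polynomial :: "(real^3 \<Rightarrow> real) \<Rightarrow> bool"
  where "degree_two_polynomial p \<longleftrightarrow>
     (\<exists>(A::real^3^3) (b::real^3) (c::real). transpose A = A \<and> A \<noteq> 0 \<and>
        p = (\<lambda>x. (\<Sum>i\<in>UNIV. \<Sum>j\<in>UNIV. A $ i $ j * x $ i * x $ j) + (\<Sum>i\<in>UNIV. b $ i * x $ i) + c))"

definition open_part_of :: "(real^3) set \<Rightarrow> (real^3) set \<Rightarrow> bool"
  where "open_part_of Q S \<longleftrightarrow> openin (top_of_set S) Q"

definition quadric_surface :: "(real^3) set \<Rightarrow> bool"
  where "quadric_surface Q \<longleftrightarrow>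
     Q \<noteq> {} \<and> connected Q \<and> regular_surface Q \<and>
     (\<exists>p. degree_two_polynomial p \<and> open_part_of Q {x. p x = 0})"

(* The orientation of Q is the choice of G: the sign may vary between parametrizations,
   but continuity makes it locally constant within each one. *)
definition gauss_map :: "(real^3) set \<Rightarrow> (real^3 \<Rightarrow> real^3) \<Rightarrow> bool"
  where "gauss_map Q G \<longleftrightarrow> continuous_on Q G \<and>
     (\<forall>U r. local_param Q U r \<longrightarrow> (\<forall>u\<in>U.
        G (r u) = chart_normal r u /\<^sub>R norm (chart_normal r u) \<or>
        G (r u) = - (chart_normal r u /\<^sub>R norm (chart_normal r u))))"

definition first_form :: "(real^2 \<Rightarrow> real^3) \<Rightarrow> real^2 \<Rightarrow> real^2^2"
  where "first_form r u = (\<chi> i j. partial_deriv i r u \<bullet> partial_deriv j r u)"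

(* The argument h is the coordinate expression (a function of u in the domain of r) of
   a function on the surface. *)
definition laplace_beltrami :: "(real^2 \<Rightarrow> real^3) \<Rightarrow> (real^2 \<Rightarrow> real) \<Rightarrow> real^2 \<Rightarrow> real"
  where "laplace_beltrami r h u =
     - (1 / sqrt (det (first_form r u))) *
       (\<Sum>i\<in>UNIV. \<Sum>j\<in>UNIV.
          partial_deriv i
            (\<lambda>v. sqrt (det (first_form r v)) * matrix_inv (first_form r v) $ i $ j * partial_deriv j h v)
            u)"

(* laplacian_on Q F L: on Q, the componentwise Laplace-Beltrami operator maps F to L.
   The operator is computed in every local parametrization, so no chart is singled out. *)
definition laplacian_on :: "(real^3) set \<Rightarrow> (real^3 \<Rightarrow> real^3) \<Rightarrow> (real^3 \<Rightarrow> real^3) \<Rightarrow> bool"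
  where "laplacian_on Q F L \<longleftrightarrow>
     (\<forall>U r. local_param Q U r \<longrightarrow>
        (\<forall>u\<in>U. (\<chi> k. laplace_beltrami r (\<lambda>v. F (r v) $ k) u) = L (r u)))"

definition is_plane :: "(real^3) set \<Rightarrow> bool"
  where "is_plane S \<longleftrightarrow> (\<exists>n d. n \<noteq> 0 \<and> S = {x. n \<bullet> x = d})"

definition is_circular_cylinder :: "(real^3) set \<Rightarrow> bool"
  where "is_circular_cylinder S \<longleftrightarrow>
     (\<exists>a w R. w \<noteq> 0 \<and> R > 0 \<and> S = {x. infdist x (range (\<lambda>t. a + t *\<^sub>R w)) = R})"

definition is_sphere :: "(real^3) set \<Rightarrow> bool"
  where "is_sphere S \<longleftrightarrow> (\<exists>c R. R > 0 \<and> S = sphere c R)"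

end

theory Submission
  imports Defs
begin

text \<open>Let \<open>Q\<close> be open in \<open>p = 0\<close> with \<open>p x = x \<bullet> A x + b \<bullet> x + c\<close>, \<open>A\<close> symmetric and nonzero, and
  let \<open>g = 2 A x + b\<close> be the gradient of \<open>p\<close>.

  If \<open>\<Delta> G = M G\<close>, only the normal component of this equation is needed. Applying \<open>\<Delta>\<close> to
  \<open>G \<bullet> G = 1\<close> gives \<open>G \<bullet> \<Delta> G = |dG|\<^sup>2\<close> (lemma \<open>inner_laplace_unit_field\<close>), and \<open>G = \<plusminus> g / |g|\<close> where
  \<open>g \<noteq> 0\<close>. Together these give a polynomial equation for \<open>g\<close> on \<open>Q\<close> (lemma \<open>quadric_normal_component\<close>):
  \<open>(g \<bullet> M g) W\<^sup>2 = 4 (tr (A\<^sup>2) W\<^sup>2 - 2 W |A g|\<^sup>2 + (g \<bullet> A g)\<^sup>2)\<close> with \<open>W = g \<bullet> g\<close>. Use orthonormal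
  eigenvectors of \<open>A\<close>, with eigenvalues \<open>l\<^sub>k\<close>, as coordinate axes. Unless the quadric is a cone or a
  pair of planes, its gradients satisfy an equation \<open>\<kappa>(g) = 1\<close> with a diagonal quadratic form \<open>\<kappa>\<close>: its
  coefficients are \<open>1 / (4 l\<^sub>k C)\<close> for a central quadric or a cylinder over a central conic, where
  \<open>\<Sum>\<^sub>k g\<^sub>k\<^sup>2 / (4 l\<^sub>k) = C\<close>, while for a paraboloid or a parabolic cylinder one component of \<open>g\<close> is a
  nonzero constant. Multiplying the right-hand side by \<open>\<kappa>\<close> makes the equation
  homogeneous of degree six, and it becomes an identity of polynomials (lemma
  \<open>homogenized_equation\<close>). Restricted to a coordinate plane and evaluated at an isotropic (complex)
  vector, where \<open>W = 0\<close>, it gives \<open>(\<kappa>\<^sub>i - \<kappa>\<^sub>j) (l\<^sub>i - l\<^sub>j)\<^sup>2 = 0\<close>; lemma \<open>two_variable_identity\<close> does this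
  over the reals. For central quadrics and cylinders over central
  conics the nonzero eigenvalues must therefore agree, and paraboloids and parabolic cylinders are
  impossible. On a quadratic cone over a nondegenerate conic the two sides of the equation scale with
  different degrees, so that its right-hand side, a multiple of the squared norm of the second
  fundamental form, vanishes; this too is impossible. What is left are spheres, circular cylinders
  and pairs of planes (lemma \<open>diagonal_quadric_classification\<close>). A connected regular surface that is
  open in a pair of planes avoids the line where they cross, and so lies in one of them (lemma
  \<open>surface_in_two_planes\<close>). If \<open>g = 0\<close> on all of \<open>Q\<close>, then \<open>p = 0\<close> is a double plane (lemma
  \<open>plane_of_singular_surface\<close>).

  Conversely, \<open>G\<close> is constant in every chart of a plane up to a locally constant sign. For a sphere or
  a circular cylinder \<open>G\<close> is locally \<open>\<plusminus> L (x - a) / R\<close> with an orthogonal projection \<open>L\<close> that fixes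
  the normal vectors; the Laplacian of the position vector is normal (lemma
  \<open>laplace_position_normal\<close>), so \<open>\<Delta> G = \<lambda> G\<close>, and \<open>\<lambda> = |dG|\<^sup>2 = (tr L - 1) / R\<^sup>2\<close> is a constant
  (lemma \<open>laplace_gauss_projection\<close>).\<close>

section \<open>Partial derivatives\<close>

lemma has_vector_derivative_along_line:
  fixes f :: "real^'n::finite \<Rightarrow> 'b::real_normed_vector"
  assumes "(f has_derivative f') (at (a + t *\<^sub>R d))"
  shows "((\<lambda>t. f (a + t *\<^sub>R d)) has_vector_derivative f' d) (at t)"
proof -
  have "((\<lambda>t. a + t *\<^sub>R d) has_derivative (\<lambda>t. t *\<^sub>R d)) (at t)"
    by (auto intro!: derivative_eq_intros)
  from has_derivative_compose[OF this assms]
  have "((\<lambda>t. f (a + t *\<^sub>R d)) has_derivative (\<lambda>t. f' (t *\<^sub>R d))) (at t)" .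
  then show ?thesis
    unfolding has_vector_derivative_def
    using linear_cmul[OF has_derivative_linear[OF assms]] by simp
qed

lemma partial_deriv_eq:
  fixes f :: "real^'n::finite \<Rightarrow> 'b::real_normed_vector"
  assumes "(f has_derivative f') (at u)"
  shows "partial_deriv i f u = f' (axis i 1)"
  unfolding partial_deriv_def
  using has_vector_derivative_along_line[of f f' u 0 "axis i 1"] assms
  by (simp add: vector_derivative_at)

lemma tendsto_line_at_0: "((\<lambda>t::real. u + t *\<^sub>R d) \<longlongrightarrow> u) (nhds 0)"
  for u d :: "'a::real_normed_vector"
proof -
  have "isCont (\<lambda>t::real. u + t *\<^sub>R d) 0" by (intro continuous_intros)
  then show ?thesis
    using tendsto_at_iff_tendsto_nhds[of "\<lambda>t::real. u + t *\<^sub>R d" 0] by (simp add: isCont_def)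
qed

lemma partial_deriv_cong:
  assumes "eventually (\<lambda>v. f v = g v) (nhds u)"
  shows "partial_deriv i f u = partial_deriv i g u"
proof -
  have "\<forall>\<^sub>F t in nhds (0::real). f (u + t *\<^sub>R axis i 1) = g (u + t *\<^sub>R axis i 1)"
    using assms tendsto_line_at_0[of u "axis i 1"] by (auto simp: filterlim_iff)
  then show ?thesis unfolding partial_deriv_def
    by (intro vector_derivative_cong_eq) auto
qed

lemma partial_deriv_cong_ev:
  assumes "eventually (\<lambda>v. f v = g v) (nhds u)"
  shows "eventually (\<lambda>v. partial_deriv i f v = partial_deriv i g v) (nhds u)"
  using eventually_eventually[THEN iffD2, OF assms] by eventually_elim (rule partial_deriv_cong)

lemma differentiable_cong_ev:
  assumes "eventually (\<lambda>v. f v = g v) (nhds u)" "g differentiable (at u)"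
  shows "f differentiable (at u)"
proof -
  obtain g' where "(g has_derivative g') (at u)" using assms(2) unfolding differentiable_def by auto
  then have "(f has_derivative g') (at u)"
    by (rule has_derivative_transform_eventually)
       (use assms(1) in \<open>auto simp: eventually_at_filter eq_commute elim: eventually_mono dest: eventually_nhds_x_imp_x\<close>)
  then show ?thesis unfolding differentiable_def by auto
qed

lemma partial_deriv_bounded_linear:
  fixes f :: "real^'n::finite \<Rightarrow> 'b::real_normed_vector"
  assumes "bounded_linear T" "f differentiable (at u)"
  shows "partial_deriv i (\<lambda>v. T (f v)) u = T (partial_deriv i f u)"
proof -
  obtain f' where f': "(f has_derivative f') (at u)" using assms unfolding differentiable_def by auto
  from bounded_linear.has_derivative[OF assms(1) this]
  show ?thesis by (simp add: partial_deriv_eq[OF f'] partial_deriv_eq)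
qed

lemma partial_deriv_bilinear:
  fixes f :: "real^'n::finite \<Rightarrow> 'b::real_normed_vector"
  assumes "bounded_bilinear prd" "f differentiable (at u)" "g differentiable (at u)"
  shows "partial_deriv i (\<lambda>v. prd (f v) (g v)) u
           = prd (partial_deriv i f u) (g u) + prd (f u) (partial_deriv i g u)"
proof -
  obtain f' where f': "(f has_derivative f') (at u)" using assms unfolding differentiable_def by auto
  obtain g' where g': "(g has_derivative g') (at u)" using assms unfolding differentiable_def by auto
  from bounded_bilinear.FDERIV[OF assms(1) f' g']
  show ?thesis by (simp add: partial_deriv_eq[OF f'] partial_deriv_eq[OF g'] partial_deriv_eq)
qed

lemma bounded_bilinear_cross3: "bounded_bilinear cross3"
  using bilinear_conv_bounded_bilinear bilinear_cross by blast

lemmas partial_deriv_inner = partial_deriv_bilinear[OF bounded_bilinear_inner]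
lemmas partial_deriv_cross = partial_deriv_bilinear[OF bounded_bilinear_cross3]
lemmas partial_deriv_scaleR = partial_deriv_bilinear[OF bounded_bilinear_scaleR]

lemma partial_deriv_const: "partial_deriv i (\<lambda>v. c) u = 0"
  by (rule partial_deriv_eq[of "\<lambda>v. c" "\<lambda>h. 0", simplified])

lemma partial_deriv_add:
  fixes f :: "real^'n::finite \<Rightarrow> 'b::real_normed_vector"
  assumes "f differentiable (at u)" "g differentiable (at u)"
  shows "partial_deriv i (\<lambda>v. f v + g v) u = partial_deriv i f u + partial_deriv i g u"
proof -
  obtain f' where f': "(f has_derivative f') (at u)" using assms unfolding differentiable_def by auto
  obtain g' where g': "(g has_derivative g') (at u)" using assms unfolding differentiable_def by auto
  from has_derivative_add[OF f' g']
  show ?thesis by (simp add: partial_deriv_eq[OF f'] partial_deriv_eq[OF g'] partial_deriv_eq)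
qed

lemma differentiable_bilinear:
  fixes f :: "'a::real_normed_vector \<Rightarrow> 'b::real_normed_vector"
  assumes "bounded_bilinear prd" "f differentiable (at u)" "g differentiable (at u)"
  shows "(\<lambda>v. prd (f v) (g v)) differentiable (at u)"
  using assms bounded_bilinear.FDERIV[OF assms(1)] unfolding differentiable_def by blast

lemma differentiable_bounded_linear:
  fixes f :: "'a::real_normed_vector \<Rightarrow> 'b::real_normed_vector"
  assumes "bounded_linear T" "f differentiable (at u)"
  shows "(\<lambda>v. T (f v)) differentiable (at u)"
  using assms bounded_linear.has_derivative[OF assms(1)] unfolding differentiable_def by blast

lemma smooth_on_differentiable: "smooth_on U f \<Longrightarrow> u \<in> U \<Longrightarrow> f differentiable (at u)"
  unfolding smooth_on_def by (metis Ck_on.simps(2))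

lemma smooth_on_partial_deriv: "smooth_on U f \<Longrightarrow> smooth_on U (partial_deriv i f)"
  unfolding smooth_on_def by (metis Ck_on.simps(2))

lemma smooth_on_continuous: "smooth_on U f \<Longrightarrow> continuous_on U f"
  unfolding smooth_on_def by (metis Ck_on.simps(1))

text \<open>Symmetry of the mixed second partial derivatives, by applying the mean value theorem twice
  to the second difference \<open>f (u + s e + s d) - f (u + s e) - f (u + s d) + f u\<close>, in both orders.\<close>

lemma second_difference_mvt:
  fixes f :: "real^'n::finite \<Rightarrow> 'b::real_inner"
  assumes s: "s > 0"
    and box: "\<And>t t'. 0 \<le> t \<Longrightarrow> t \<le> s \<Longrightarrow> 0 \<le> t' \<Longrightarrow> t' \<le> s
                \<Longrightarrow> u + t *\<^sub>R axis i 1 + t' *\<^sub>R axis j 1 \<in> U"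
    and U: "smooth_on U f"
  shows "\<exists>t t'. 0 \<le> t \<and> t \<le> s \<and> 0 \<le> t' \<and> t' \<le> s \<and>
     w \<bullet> (f (u + s *\<^sub>R axis i 1 + s *\<^sub>R axis j 1) - f (u + s *\<^sub>R axis i 1) - f (u + s *\<^sub>R axis j 1) + f u)
       = s * s * (w \<bullet> partial_deriv j (partial_deriv i f) (u + t *\<^sub>R axis i 1 + t' *\<^sub>R axis j 1))"
proof -
  note bl = bounded_linear.has_vector_derivative[OF bounded_linear_inner_right[of w]]
  define \<phi> where "\<phi> t = w \<bullet> (f ((u + s *\<^sub>R axis j 1) + t *\<^sub>R axis i 1) - f (u + t *\<^sub>R axis i 1))" for t
  define \<phi>' where "\<phi>' t = w \<bullet> (partial_deriv i f ((u + s *\<^sub>R axis j 1) + t *\<^sub>R axis i 1) - partial_deriv i f (u + t *\<^sub>R axis i 1))" for t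
  have d\<phi>: "(\<phi> has_vector_derivative \<phi>' t) (at t)" if "0 \<le> t" "t \<le> s" for t
  proof -
    have "(u + s *\<^sub>R axis j 1) + t *\<^sub>R axis i 1 \<in> U" using box[of t s] that s by (simp add: add_ac)
    moreover have "u + t *\<^sub>R axis i 1 \<in> U" using box[of t 0] that s by simp
    ultimately obtain D1 D2 where D: "(f has_derivative D1) (at ((u + s *\<^sub>R axis j 1) + t *\<^sub>R axis i 1))"
         "(f has_derivative D2) (at (u + t *\<^sub>R axis i 1))"
      using smooth_on_differentiable[OF U] unfolding differentiable_def by blast
    show ?thesis unfolding \<phi>_def \<phi>'_def
      using bl[OF has_vector_derivative_diff[OF has_vector_derivative_along_line[OF D(1)] has_vector_derivative_along_line[OF D(2)]]]
      by (simp add: partial_deriv_eq[OF D(1)] partial_deriv_eq[OF D(2)])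
  qed
  have "\<exists>t\<in>{0<..<s}. \<phi> s - \<phi> 0 = (s - 0) *\<^sub>R \<phi>' t"
    using mvt_simple[of 0 s \<phi> "\<lambda>t h. h *\<^sub>R \<phi>' t"] s d\<phi>
    unfolding has_vector_derivative_def by (auto intro: has_derivative_at_withinI)
  then obtain t where t: "0 < t" "t < s" "\<phi> s - \<phi> 0 = s * \<phi>' t"
    by auto
  define \<psi> where "\<psi> t' = w \<bullet> partial_deriv i f ((u + t *\<^sub>R axis i 1) + t' *\<^sub>R axis j 1)" for t'
  define \<psi>' where "\<psi>' t' = w \<bullet> partial_deriv j (partial_deriv i f) (u + t *\<^sub>R axis i 1 + t' *\<^sub>R axis j 1)" for t'
  have d\<psi>: "(\<psi> has_vector_derivative \<psi>' t') (at t')" if "0 \<le> t'" "t' \<le> s" for t'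
  proof -
    have "u + t *\<^sub>R axis i 1 + t' *\<^sub>R axis j 1 \<in> U" using box[of t t'] that t by simp
    then obtain D1 where D: "(partial_deriv i f has_derivative D1) (at (u + t *\<^sub>R axis i 1 + t' *\<^sub>R axis j 1))"
      using smooth_on_differentiable[OF smooth_on_partial_deriv[OF U]] unfolding differentiable_def by blast
    show ?thesis unfolding \<psi>_def \<psi>'_def
      using bl[OF has_vector_derivative_along_line[OF D(1)]] by (simp add: partial_deriv_eq[OF D(1)])
  qed
  have "\<exists>t'\<in>{0<..<s}. \<psi> s - \<psi> 0 = (s - 0) *\<^sub>R \<psi>' t'"
    using mvt_simple[of 0 s \<psi> "\<lambda>t' h. h *\<^sub>R \<psi>' t'"] s d\<psi>
    unfolding has_vector_derivative_def by (auto intro: has_derivative_at_withinI)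
  then obtain t' where t': "0 < t'" "t' < s" "\<psi> s - \<psi> 0 = s * \<psi>' t'"
    by auto
  have "\<phi>' t = \<psi> s - \<psi> 0" by (simp add: \<phi>'_def \<psi>_def add_ac inner_diff_right)
  then have "\<phi> s - \<phi> 0 = s * s * \<psi>' t'" using t(3) t'(3) by simp
  moreover have "\<phi> s - \<phi> 0 = w \<bullet> (f (u + s *\<^sub>R axis i 1 + s *\<^sub>R axis j 1) - f (u + s *\<^sub>R axis i 1) - f (u + s *\<^sub>R axis j 1) + f u)"
    by (simp add: \<phi>_def add_ac inner_diff_right inner_add_right)
  ultimately show ?thesis using t t' unfolding \<psi>'_def by (metis less_imp_le)
qed

lemma partial_deriv_commute:
  fixes f :: "real^'n::finite \<Rightarrow> 'b::real_inner"
  assumes "open U" "smooth_on U f" "u \<in> U"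
  shows "partial_deriv i (partial_deriv j f) u = partial_deriv j (partial_deriv i f) u"
proof (rule ccontr)
  let ?a = "partial_deriv i (partial_deriv j f)" and ?b = "partial_deriv j (partial_deriv i f)"
  define w where "w = ?a u - ?b u"
  assume "?a u \<noteq> ?b u"
  then have ne: "w \<bullet> w > 0" by (simp add: w_def)
  define e where "e = (w \<bullet> w) / 2"
  have e: "e > 0" using ne by (simp add: e_def)
  have cont: "continuous_on U (\<lambda>v. w \<bullet> ?a v)" "continuous_on U (\<lambda>v. w \<bullet> ?b v)"
    by (intro continuous_intros smooth_on_continuous smooth_on_partial_deriv assms)+
  have "isCont (\<lambda>v. w \<bullet> ?a v) u" "isCont (\<lambda>v. w \<bullet> ?b v) u"
    using cont assms by (auto simp: continuous_on_eq_continuous_at)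
  then obtain d1 d2 where d: "d1 > 0" "\<And>v. dist v u < d1 \<Longrightarrow> dist (w \<bullet> ?a v) (w \<bullet> ?a u) < e"
      "d2 > 0" "\<And>v. dist v u < d2 \<Longrightarrow> dist (w \<bullet> ?b v) (w \<bullet> ?b u) < e"
    using e unfolding continuous_at_eps_delta by metis
  obtain d3 where d3: "d3 > 0" "ball u d3 \<subseteq> U" using assms by (meson open_contains_ball)
  define s where "s = min d1 (min d2 d3) / 3"
  have s: "s > 0" using d d3 by (simp add: s_def)
  have near: "dist (u + t *\<^sub>R axis k 1 + t' *\<^sub>R axis l 1) u < min d1 (min d2 d3)"
    if "0 \<le> t" "t \<le> s" "0 \<le> t'" "t' \<le> s" for t t' and k l :: 'n
  proof -
    have "norm (t *\<^sub>R axis k (1::real) + t' *\<^sub>R axis l 1) \<le> t + t'"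
      using norm_triangle_ineq[of "t *\<^sub>R axis k (1::real)" "t' *\<^sub>R axis l 1"] that by simp
    also have "\<dots> < min d1 (min d2 d3)" using that s unfolding s_def by linarith
    finally show ?thesis by (simp add: dist_norm algebra_simps)
  qed
  have inU: "u + t *\<^sub>R axis k 1 + t' *\<^sub>R axis l 1 \<in> U"
    if "0 \<le> t" "t \<le> s" "0 \<le> t'" "t' \<le> s" for t t' and k l :: 'n
    using near[OF that, of k l] d3(2) by (auto simp: dist_commute subset_iff)
  obtain t t' where 1: "0 \<le> t" "t \<le> s" "0 \<le> t'" "t' \<le> s"
     "w \<bullet> (f (u + s *\<^sub>R axis i 1 + s *\<^sub>R axis j 1) - f (u + s *\<^sub>R axis i 1) - f (u + s *\<^sub>R axis j 1) + f u)
       = s * s * (w \<bullet> ?b (u + t *\<^sub>R axis i 1 + t' *\<^sub>R axis j 1))"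
    using second_difference_mvt[OF s inU assms(2), where w = w and i = i and j = j] by blast
  obtain q q' where 2: "0 \<le> q" "q \<le> s" "0 \<le> q'" "q' \<le> s"
     "w \<bullet> (f (u + s *\<^sub>R axis j 1 + s *\<^sub>R axis i 1) - f (u + s *\<^sub>R axis j 1) - f (u + s *\<^sub>R axis i 1) + f u)
       = s * s * (w \<bullet> ?a (u + q *\<^sub>R axis j 1 + q' *\<^sub>R axis i 1))"
    using second_difference_mvt[OF s inU assms(2), where w = w and i = j and j = i] by blast
  have "f (u + s *\<^sub>R axis i 1 + s *\<^sub>R axis j 1) - f (u + s *\<^sub>R axis i 1) - f (u + s *\<^sub>R axis j 1) + f u
      = f (u + s *\<^sub>R axis j 1 + s *\<^sub>R axis i 1) - f (u + s *\<^sub>R axis j 1) - f (u + s *\<^sub>R axis i 1) + f u"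
    by (simp add: add_ac)
  then have "s * s * (w \<bullet> ?b (u + t *\<^sub>R axis i 1 + t' *\<^sub>R axis j 1)) = s * s * (w \<bullet> ?a (u + q *\<^sub>R axis j 1 + q' *\<^sub>R axis i 1))"
    using 1(5) 2(5) by metis
  then have "w \<bullet> ?b (u + t *\<^sub>R axis i 1 + t' *\<^sub>R axis j 1) = w \<bullet> ?a (u + q *\<^sub>R axis j 1 + q' *\<^sub>R axis i 1)"
    using s by simp
  moreover have "dist (w \<bullet> ?b (u + t *\<^sub>R axis i 1 + t' *\<^sub>R axis j 1)) (w \<bullet> ?b u) < e"
    using near[OF 1(1-4)] by (intro d(4)) simp
  moreover have "dist (w \<bullet> ?a (u + q *\<^sub>R axis j 1 + q' *\<^sub>R axis i 1)) (w \<bullet> ?a u) < e"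
    using near[OF 2(1-4)] by (intro d(2)) simp
  moreover have "w \<bullet> ?a u - w \<bullet> ?b u = 2 * e" by (simp add: e_def w_def flip: inner_diff_right)
  ultimately show False unfolding dist_real_def by linarith
qed

section \<open>The metric of a chart\<close>

text \<open>The projection onto the plane of \<open>a\<close> and \<open>b\<close>, written with the inverse of their Gram matrix.\<close>

lemma gram_identity:
  fixes a b x y :: "real^3"
  shows "(cross3 a b \<bullet> cross3 a b) * (x \<bullet> y) =
     (b \<bullet> b) * ((a \<bullet> x) * (a \<bullet> y)) - (a \<bullet> b) * ((a \<bullet> x) * (b \<bullet> y)) - (a \<bullet> b) * ((b \<bullet> x) * (a \<bullet> y))
     + (a \<bullet> a) * ((b \<bullet> x) * (b \<bullet> y)) + (cross3 a b \<bullet> x) * (cross3 a b \<bullet> y)"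
  by (simp add: cross3_simps)

lemma triple_product_coplanar:
  fixes a b c n :: "real^3"
  assumes "n \<noteq> 0" "a \<bullet> n = 0" "b \<bullet> n = 0" "c \<bullet> n = 0"
  shows "a \<bullet> cross3 b c = 0"
proof -
  have "(n \<bullet> n) * (a \<bullet> cross3 b c) = (a \<bullet> n) * (n \<bullet> cross3 b c) - (b \<bullet> n) * (n \<bullet> cross3 a c) + (c \<bullet> n) * (n \<bullet> cross3 a b)"
    by (simp add: cross3_simps)
  then show ?thesis using assms by simp
qed

lemma lagrange_cross: "(a \<bullet> a) * (b \<bullet> b) - (a \<bullet> b) * (a \<bullet> b) = cross3 a b \<bullet> cross3 a b"
  by (simp add: cross3_simps)

lemma parallel_cross:
  fixes a b n :: "real^3"
  assumes "cross3 a b \<noteq> 0" "n \<bullet> a = 0" "n \<bullet> b = 0"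
  shows "(cross3 a b \<bullet> cross3 a b) *\<^sub>R n = (n \<bullet> cross3 a b) *\<^sub>R cross3 a b"
proof -
  have "(cross3 a b \<bullet> cross3 a b) *\<^sub>R n = (n \<bullet> cross3 a b) *\<^sub>R cross3 a b
      + (n \<bullet> a) *\<^sub>R ((b \<bullet> b) *\<^sub>R a - (a \<bullet> b) *\<^sub>R b) + (n \<bullet> b) *\<^sub>R ((a \<bullet> a) *\<^sub>R b - (a \<bullet> b) *\<^sub>R a)"
    by (simp add: cross3_def inner_vec_def sum_3 vec_eq_iff vector_def forall_3) algebra
  then show ?thesis using assms by simp
qed

lemma matrix_inv_2:
  fixes A :: "real^2^2"
  assumes "det A \<noteq> 0"
  shows "matrix_inv A $ 1 $ 1 = A $ 2 $ 2 / det A" "matrix_inv A $ 1 $ 2 = - A $ 1 $ 2 / det A"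
    "matrix_inv A $ 2 $ 1 = - A $ 2 $ 1 / det A" "matrix_inv A $ 2 $ 2 = A $ 1 $ 1 / det A"
proof -
  define X :: "real^2^2" where "X = (\<chi> i j. (if i \<noteq> j then - A $ i $ j else if i = 1 then A $ 2 $ 2 else A $ 1 $ 1) / det A)"
  have X: "X $ 1 $ 1 = A $ 2 $ 2 / det A" "X $ 1 $ 2 = - A $ 1 $ 2 / det A"
    "X $ 2 $ 1 = - A $ 2 $ 1 / det A" "X $ 2 $ 2 = A $ 1 $ 1 / det A"
    by (simp_all add: X_def)
  have AX: "A ** X = mat 1"
    using assms det_2[of A]
    by (simp add: matrix_matrix_mult_def vec_eq_iff forall_2 sum_2 X mat_def field_simps)
  have inv: "invertible A" using assms by (simp add: invertible_det_nz)
  have "matrix_inv A ** A = mat 1" using inv someI_ex[of "\<lambda>A'. A ** A' = mat 1 \<and> A' ** A = mat 1"]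
    unfolding invertible_def matrix_inv_def by blast
  then have "matrix_inv A = X" using AX by (metis matrix_mul_assoc matrix_mul_lid matrix_mul_rid)
  then show "matrix_inv A $ 1 $ 1 = A $ 2 $ 2 / det A" "matrix_inv A $ 1 $ 2 = - A $ 1 $ 2 / det A"
    "matrix_inv A $ 2 $ 1 = - A $ 2 $ 1 / det A" "matrix_inv A $ 2 $ 2 = A $ 1 $ 1 / det A" using X by auto
qed

text \<open>The entries of \<open>sqrt (det g) * g\<^sup>-\<^sup>1\<close>, for the first fundamental form \<open>g\<close>, in terms of the tangent vectors; by Lagrange's identity
  \<open>sqrt (det g)\<close> is the length of the chart normal.\<close>

definition metric_coeff :: "(real^2 \<Rightarrow> real^3) \<Rightarrow> 2 \<Rightarrow> 2 \<Rightarrow> real^2 \<Rightarrow> real" where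
  "metric_coeff r i j v =
     (if i \<noteq> j then - (partial_deriv 1 r v \<bullet> partial_deriv 2 r v)
      else if i = 1 then partial_deriv 2 r v \<bullet> partial_deriv 2 r v
      else partial_deriv 1 r v \<bullet> partial_deriv 1 r v) / norm (chart_normal r v)"

text \<open>The unit normal of a parametrization, oriented by the order of the coordinates; where the chart
  normal vanishes its value is \<open>0\<close>.\<close>

definition unit_normal :: "(real^2 \<Rightarrow> real^3) \<Rightarrow> real^2 \<Rightarrow> real^3" where
  "unit_normal r v = chart_normal r v /\<^sub>R norm (chart_normal r v)"

text \<open>An orthonormal basis of \<open>\<real>\<^sup>n\<close>, indexed like the coordinates.\<close>

definition orthonormal_frame :: "('n::finite \<Rightarrow> real^'n) \<Rightarrow> bool" where
  "orthonormal_frame e \<longleftrightarrow> (\<forall>i j. e i \<bullet> e j = (if i = j then 1 else 0))"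

lemma orthonormal_frame_inner:
  fixes e :: "'n::finite \<Rightarrow> real^'n"
  assumes "orthonormal_frame e" shows "x \<bullet> y = (\<Sum>k\<in>UNIV. (x \<bullet> e k) * (y \<bullet> e k))"
proof -
  define E :: "real^'n^'n" where "E = (\<chi> k. e k)"
  have "orthogonal_matrix E"
    unfolding orthogonal_matrix_orthonormal_rows
    using assms by (auto simp: E_def row_def orthonormal_frame_def orthogonal_def norm_eq_1)
  then have "orthogonal_transformation ((*v) E)"
    by (simp add: orthogonal_transformation_matrix)
  then have "x \<bullet> y = (E *v x) \<bullet> (E *v y)" unfolding orthogonal_transformation_def by simp
  then show ?thesis by (simp add: inner_vec_def matrix_vector_mult_def E_def mult.commute)
qed

lemma orthonormal_frame_expand:
  assumes "orthonormal_frame e" shows "x = (\<Sum>k\<in>UNIV. (x \<bullet> e k) *\<^sub>R e k)"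
proof -
  have "y \<bullet> x = y \<bullet> (\<Sum>k\<in>UNIV. (x \<bullet> e k) *\<^sub>R e k)" for y
    using orthonormal_frame_inner[OF assms, of y x] by (simp add: inner_sum_right mult.commute)
  then show ?thesis using vector_eq_ldot by blast
qed

text \<open>A local parametrization \<open>r\<close> of the surface \<open>Q\<close> with open domain \<open>U\<close>.\<close>

locale chart =
  fixes Q :: "(real^3) set" and U :: "(real^2) set" and r :: "real^2 \<Rightarrow> real^3"
  assumes param: "local_param Q U r"
begin

abbreviation "tangent i \<equiv> partial_deriv i r"

lemma open_dom: "open U" and smooth: "smooth_on U r"
  using param unfolding local_param_def by auto

lemma normal_nonzero: "u \<in> U \<Longrightarrow> chart_normal r u \<noteq> 0"
  using param unfolding local_param_def by auto

lemma differentiable: "u \<in> U \<Longrightarrow> r differentiable (at u)"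
  and tangent_differentiable: "u \<in> U \<Longrightarrow> tangent i differentiable (at u)"
  by (simp_all add: smooth_on_differentiable[OF smooth] smooth_on_differentiable[OF smooth_on_partial_deriv[OF smooth]])

lemma mem_Q: "u \<in> U \<Longrightarrow> r u \<in> Q"
  using param unfolding local_param_def by (auto dest!: openin_imp_subset)

lemma eventually_dom: "u \<in> U \<Longrightarrow> \<forall>\<^sub>F v in nhds u. v \<in> U"
  using open_dom by (rule eventually_nhds_in_open)

lemma eventually_domI: "u \<in> U \<Longrightarrow> (\<And>v. v \<in> U \<Longrightarrow> P v) \<Longrightarrow> \<forall>\<^sub>F v in nhds u. P v"
  using eventually_dom eventually_mono by blast

lemma chart_normal_differentiable: "u \<in> U \<Longrightarrow> chart_normal r differentiable (at u)"
  unfolding chart_normal_def[abs_def]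
  by (intro differentiable_bilinear[OF bounded_bilinear_cross3] tangent_differentiable)

lemma norm_normal_differentiable: "u \<in> U \<Longrightarrow> (\<lambda>v. norm (chart_normal r v)) differentiable (at u)"
  using differentiable_compose[OF differentiable_norm_at chart_normal_differentiable] normal_nonzero
  by blast

lemma unit_normal_differentiable: "u \<in> U \<Longrightarrow> unit_normal r differentiable (at u)"
  unfolding unit_normal_def[abs_def]
  by (intro differentiable_scaleR differentiable_inverse norm_normal_differentiable chart_normal_differentiable)
     (simp_all add: normal_nonzero)

lemma metric_coeff_differentiable: "u \<in> U \<Longrightarrow> metric_coeff r i j differentiable (at u)"
proof -
  assume u: "u \<in> U"
  have 1: "(\<lambda>v. tangent k v \<bullet> tangent l v) differentiable (at u)" for k l
    by (intro differentiable_bilinear[OF bounded_bilinear_inner] tangent_differentiable u)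
  have "(\<lambda>v. if i \<noteq> j then - (tangent 1 v \<bullet> tangent 2 v)
          else if i = 1 then tangent 2 v \<bullet> tangent 2 v else tangent 1 v \<bullet> tangent 1 v) differentiable (at u)"
    using 1[of 1 2] 1[of 2 2] 1[of 1 1] by (cases "i = j"; cases "i = 1") simp_all
  then show ?thesis
    unfolding metric_coeff_def[abs_def]
    by (intro differentiable_divide norm_normal_differentiable u) (simp_all add: normal_nonzero u)
qed

lemma tangent_unit_normal: "u \<in> U \<Longrightarrow> tangent i u \<bullet> unit_normal r u = 0"
proof -
  have "i = 1 \<or> i = 2" using exhaust_2 by auto
  then show ?thesis by (auto simp: unit_normal_def chart_normal_def dot_cross_self)
qed

lemma norm_unit_normal: "u \<in> U \<Longrightarrow> norm (unit_normal r u) = 1"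
  using normal_nonzero by (simp add: unit_normal_def)

lemma parallel_unit_normal:
  assumes u: "u \<in> U" and x: "\<And>i. x \<bullet> tangent i u = 0"
  shows "x = (x \<bullet> unit_normal r u) *\<^sub>R unit_normal r u"
proof -
  define n where "n = chart_normal r u"
  have n: "n \<noteq> 0" using normal_nonzero[OF u] by (simp add: n_def)
  have eq: "(n \<bullet> n) *\<^sub>R x = (x \<bullet> n) *\<^sub>R n"
    using x n unfolding n_def chart_normal_def by (intro parallel_cross) auto
  have "x = inverse (n \<bullet> n) *\<^sub>R ((n \<bullet> n) *\<^sub>R x)" using n by simp
  also have "\<dots> = (x \<bullet> unit_normal r u) *\<^sub>R unit_normal r u"
    unfolding eq unfolding unit_normal_def n_def[symmetric] dot_square_norm power2_eq_square by (simp add: mult_ac)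
  finally show ?thesis .
qed

lemma det_first_form: "det (first_form r u) = chart_normal r u \<bullet> chart_normal r u"
  by (simp add: det_2 first_form_def chart_normal_def lagrange_cross[symmetric] inner_commute)

lemma metric_coeff_eq:
  assumes "u \<in> U"
  shows "sqrt (det (first_form r u)) * matrix_inv (first_form r u) $ i $ j = metric_coeff r i j u"
proof -
  have D: "det (first_form r u) \<noteq> 0" using normal_nonzero[OF assms] by (simp add: det_first_form)
  have n: "norm (chart_normal r u) \<noteq> 0" using normal_nonzero[OF assms] by simp
  have "sqrt (det (first_form r u)) = norm (chart_normal r u)"
    by (simp add: det_first_form norm_eq_sqrt_inner)
  moreover have "det (first_form r u) = norm (chart_normal r u) * norm (chart_normal r u)"
    by (simp add: det_first_form power2_norm_eq_inner flip: power2_eq_square)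
  moreover have "(i = 1 \<or> i = 2) \<and> (j = 1 \<or> j = 2)" using exhaust_2 by auto
  ultimately show ?thesis
    using n by (auto simp: matrix_inv_2[OF D] metric_coeff_def, simp_all add: first_form_def inner_commute)
qed

text \<open>The divergence form of the componentwise Laplacian as a single vector equation.\<close>

lemma laplace_beltrami_components:
  fixes h :: "real^2 \<Rightarrow> real^3"
  assumes u: "u \<in> U" and h: "\<forall>\<^sub>F v in nhds u. h differentiable (at v)"
    and dh: "\<And>j. partial_deriv j h differentiable (at u)"
  shows "(\<chi> k. laplace_beltrami r (\<lambda>v. h v $ k) u) = - (1 / norm (chart_normal r u)) *\<^sub>R
     (\<Sum>i\<in>UNIV. \<Sum>j\<in>UNIV. partial_deriv i (\<lambda>v. metric_coeff r i j v *\<^sub>R partial_deriv j h v) u)"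
proof -
  have bl: "bounded_linear (\<lambda>x::real^3. x $ k)" for k by (rule bounded_linear_vec_nth)
  have "partial_deriv i (\<lambda>v. sqrt (det (first_form r v)) * matrix_inv (first_form r v) $ i $ j * partial_deriv j (\<lambda>v. h v $ k) v) u
      = partial_deriv i (\<lambda>v. metric_coeff r i j v *\<^sub>R partial_deriv j h v) u $ k" for i j k
  proof -
    have "partial_deriv i (\<lambda>v. sqrt (det (first_form r v)) * matrix_inv (first_form r v) $ i $ j * partial_deriv j (\<lambda>v. h v $ k) v) u
        = partial_deriv i (\<lambda>v. (metric_coeff r i j v *\<^sub>R partial_deriv j h v) $ k) u"
      by (rule partial_deriv_cong, use h eventually_dom[OF u] in eventually_elim)
         (simp add: metric_coeff_eq partial_deriv_bounded_linear[OF bl])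
    also have "\<dots> = partial_deriv i (\<lambda>v. metric_coeff r i j v *\<^sub>R partial_deriv j h v) u $ k"
      by (intro partial_deriv_bounded_linear[OF bl] differentiable_scaleR metric_coeff_differentiable u dh)
    finally show ?thesis .
  qed
  then show ?thesis
    by (simp add: vec_eq_iff laplace_beltrami_def det_first_form norm_eq_sqrt_inner)
qed

text \<open>For a unit vector field \<open>h\<close> the normal part of the Laplacian is the energy density: apply the
  divergence to \<open>h \<bullet> \<partial>\<^sub>j h = 0\<close>.\<close>

lemma inner_laplace_unit_field:
  fixes h :: "real^2 \<Rightarrow> real^3"
  assumes u: "u \<in> U" and h: "\<forall>\<^sub>F v in nhds u. h differentiable (at v)"
    and dh: "\<And>j. partial_deriv j h differentiable (at u)"
    and unit: "\<forall>\<^sub>F v in nhds u. h v \<bullet> h v = 1"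
  shows "h u \<bullet> (\<chi> k. laplace_beltrami r (\<lambda>v. h v $ k) u) =
     (\<Sum>i\<in>UNIV. \<Sum>j\<in>UNIV. metric_coeff r i j u / norm (chart_normal r u) * (partial_deriv i h u \<bullet> partial_deriv j h u))"
proof -
  have hu: "h differentiable (at u)" using h by (rule eventually_nhds_x_imp_x)
  have ort: "\<forall>\<^sub>F v in nhds u. h v \<bullet> partial_deriv j h v = 0" for j
  proof -
    have "\<forall>\<^sub>F v in nhds u. partial_deriv j (\<lambda>v. h v \<bullet> h v) v = partial_deriv j (\<lambda>v. 1) v"
      using partial_deriv_cong_ev[OF unit] .
    with h show ?thesis
      by eventually_elim (simp add: partial_deriv_inner partial_deriv_const inner_commute)
  qed
  have "h u \<bullet> partial_deriv i (\<lambda>v. metric_coeff r i j v *\<^sub>R partial_deriv j h v) u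
      = - (metric_coeff r i j u * (partial_deriv i h u \<bullet> partial_deriv j h u))" for i j
  proof -
    have "partial_deriv i (\<lambda>v. h v \<bullet> (metric_coeff r i j v *\<^sub>R partial_deriv j h v)) u = partial_deriv i (\<lambda>v. 0) u"
      by (rule partial_deriv_cong, use ort[of j] in eventually_elim) simp
    moreover have "(\<lambda>v. metric_coeff r i j v *\<^sub>R partial_deriv j h v) differentiable (at u)"
      by (intro differentiable_scaleR metric_coeff_differentiable u dh)
    ultimately show ?thesis using partial_deriv_inner[OF hu, of "\<lambda>v. metric_coeff r i j v *\<^sub>R partial_deriv j h v"]
      by (simp add: partial_deriv_const)
  qed
  then show ?thesis
    unfolding laplace_beltrami_components[OF u h dh]
    by (simp add: inner_sum_right sum_divide_distrib sum_negf)
qed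

text \<open>If the components of \<open>dh\<close> in an orthonormal frame are the inner products with vectors \<open>t k\<close>, then
  the energy density is the sum of the squared lengths of the tangential parts of the \<open>t k\<close>.\<close>

lemma energy_density_frame:
  fixes h :: "real^2 \<Rightarrow> real^3"
  assumes u: "u \<in> U" and e: "orthonormal_frame e"
    and t: "\<And>i k. partial_deriv i h u \<bullet> e k = t k \<bullet> tangent i u"
  shows "(\<Sum>i\<in>UNIV. \<Sum>j\<in>UNIV. metric_coeff r i j u / norm (chart_normal r u) * (partial_deriv i h u \<bullet> partial_deriv j h u))
     = (\<Sum>k\<in>UNIV. t k \<bullet> t k - (unit_normal r u \<bullet> t k)\<^sup>2)"
proof -
  define a b where "a = tangent 1 u" and "b = tangent 2 u"
  define D where "D = norm (chart_normal r u)"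
  have n: "chart_normal r u = cross3 a b" by (simp add: chart_normal_def a_def b_def)
  have D: "D \<noteq> 0" using normal_nonzero[OF u] by (simp add: D_def)
  have DD: "cross3 a b \<bullet> cross3 a b = D\<^sup>2" by (simp add: D_def n power2_norm_eq_inner)
  have un: "unit_normal r u \<bullet> x = cross3 a b \<bullet> x / D" for x
    by (simp add: unit_normal_def n D_def divide_inverse mult.commute)
  have in_frame: "partial_deriv i h u \<bullet> partial_deriv j h u = (\<Sum>k\<in>UNIV. (t k \<bullet> tangent i u) * (t k \<bullet> tangent j u))" for i j
    using orthonormal_frame_inner[OF e, of "partial_deriv i h u" "partial_deriv j h u"] by (simp add: t)
  have summand: "t k \<bullet> t k - (unit_normal r u \<bullet> t k)\<^sup>2 =
     ((b \<bullet> b) * (t k \<bullet> a)\<^sup>2 - 2 * (a \<bullet> b) * (t k \<bullet> a) * (t k \<bullet> b) + (a \<bullet> a) * (t k \<bullet> b)\<^sup>2) / D\<^sup>2" for k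
  proof -
    have "D\<^sup>2 * (t k \<bullet> t k) - (cross3 a b \<bullet> t k)\<^sup>2 =
       (b \<bullet> b) * (t k \<bullet> a)\<^sup>2 - 2 * (a \<bullet> b) * (t k \<bullet> a) * (t k \<bullet> b) + (a \<bullet> a) * (t k \<bullet> b)\<^sup>2"
      using gram_identity[of a b "t k" "t k"] unfolding DD
      by (simp add: inner_commute power2_eq_square algebra_simps)
    then show ?thesis using D by (simp add: un field_simps)
  qed
  have c: "metric_coeff r 1 1 u = (b \<bullet> b) / D" "metric_coeff r 1 2 u = - (a \<bullet> b) / D"
     "metric_coeff r 2 1 u = - (a \<bullet> b) / D" "metric_coeff r 2 2 u = (a \<bullet> a) / D"
    by (simp_all add: metric_coeff_def a_def b_def D_def)
  show ?thesis
    unfolding summand unfolding in_frame sum_3 sum_2 c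
    unfolding a_def[symmetric] b_def[symmetric] D_def[symmetric]
    using D by (simp add: field_simps power2_eq_square)
qed

text \<open>The Laplacian of the position vector is normal. With the unit normal \<open>N\<close> it is, up to the
  factor \<open>- 1 / sqrt (det g)\<close>, the sum \<open>\<partial>\<^sub>1 (r\<^sub>2 \<times> N) + \<partial>\<^sub>2 (N \<times> r\<^sub>1)\<close>. The second derivatives of \<open>r\<close>
  cancel, as mixed derivatives commute, and the rest are cross products of tangent vectors.\<close>

lemma laplace_position_normal:
  assumes u: "u \<in> U"
  shows "(\<chi> k. laplace_beltrami r (\<lambda>v. r v $ k) u) \<bullet> tangent l u = 0"
proof -
  let ?N = "unit_normal r"
  have flux: "metric_coeff r 1 1 v *\<^sub>R tangent 1 v + metric_coeff r 1 2 v *\<^sub>R tangent 2 v = cross3 (tangent 2 v) (?N v)"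
     "metric_coeff r 2 1 v *\<^sub>R tangent 1 v + metric_coeff r 2 2 v *\<^sub>R tangent 2 v = cross3 (?N v) (tangent 1 v)" for v
  proof -
    have "cross3 b (cross3 a b) = (b \<bullet> b) *\<^sub>R a - (a \<bullet> b) *\<^sub>R b"
         "cross3 (cross3 a b) a = (a \<bullet> a) *\<^sub>R b - (a \<bullet> b) *\<^sub>R a" for a b :: "real^3"
      by (simp_all add: cross3_def inner_vec_def sum_3 vec_eq_iff vector_def forall_3 algebra_simps)
    then show "metric_coeff r 1 1 v *\<^sub>R tangent 1 v + metric_coeff r 1 2 v *\<^sub>R tangent 2 v = cross3 (tangent 2 v) (?N v)"
     "metric_coeff r 2 1 v *\<^sub>R tangent 1 v + metric_coeff r 2 2 v *\<^sub>R tangent 2 v = cross3 (?N v) (tangent 1 v)"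
      by (simp_all add: metric_coeff_def unit_normal_def chart_normal_def cross_mult_left cross_mult_right
          scaleR_right_diff_distrib divide_inverse mult.commute)
  qed
  have dc: "(\<lambda>v. metric_coeff r i j v *\<^sub>R tangent k v) differentiable (at u)" for i j k
    by (intro differentiable_scaleR metric_coeff_differentiable tangent_differentiable u)
  have "(\<Sum>i\<in>UNIV. \<Sum>j\<in>UNIV. partial_deriv i (\<lambda>v. metric_coeff r i j v *\<^sub>R tangent j v) u)
      = partial_deriv 1 (\<lambda>v. cross3 (tangent 2 v) (?N v)) u + partial_deriv 2 (\<lambda>v. cross3 (?N v) (tangent 1 v)) u"
    unfolding sum_2 flux[symmetric] by (simp add: partial_deriv_add dc)
  also have "\<dots> = (cross3 (partial_deriv 1 (tangent 2) u) (?N u) + cross3 (tangent 2 u) (partial_deriv 1 ?N u))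
       + (cross3 (partial_deriv 2 ?N u) (tangent 1 u) + cross3 (?N u) (partial_deriv 2 (tangent 1) u))"
    by (simp add: partial_deriv_cross tangent_differentiable unit_normal_differentiable u)
  also have "partial_deriv 1 (tangent 2) u = partial_deriv 2 (tangent 1) u"
    by (rule partial_deriv_commute[OF open_dom smooth u])
  also have "cross3 (partial_deriv 2 (tangent 1) u) (?N u) = - cross3 (?N u) (partial_deriv 2 (tangent 1) u)"
    by (rule cross_skew)
  finally have eq: "(\<Sum>i\<in>UNIV. \<Sum>j\<in>UNIV. partial_deriv i (\<lambda>v. metric_coeff r i j v *\<^sub>R tangent j v) u)
      = cross3 (tangent 2 u) (partial_deriv 1 ?N u) + cross3 (partial_deriv 2 ?N u) (tangent 1 u)" by simp
  have Nu: "?N u \<noteq> 0" using norm_unit_normal[OF u] by auto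
  have dN: "partial_deriv i ?N u \<bullet> ?N u = 0" for i
  proof -
    have "partial_deriv i (\<lambda>v. ?N v \<bullet> ?N v) u = partial_deriv i (\<lambda>v. 1) u"
      by (rule partial_deriv_cong, rule eventually_domI[OF u]) (simp add: norm_unit_normal dot_square_norm)
    then show ?thesis
      by (simp add: partial_deriv_inner unit_normal_differentiable u partial_deriv_const inner_commute)
  qed
  have "tangent l u \<bullet> cross3 (tangent 2 u) (partial_deriv 1 ?N u) = 0"
       "tangent l u \<bullet> cross3 (partial_deriv 2 ?N u) (tangent 1 u) = 0"
    by (rule triple_product_coplanar[OF Nu]; simp add: dN tangent_unit_normal u)+
  then have "(\<Sum>i\<in>UNIV. \<Sum>j\<in>UNIV. partial_deriv i (\<lambda>v. metric_coeff r i j v *\<^sub>R tangent j v) u) \<bullet> tangent l u = 0"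
    unfolding eq inner_commute[of _ "tangent l u"] by (simp add: inner_add_right)
  moreover have "\<forall>\<^sub>F v in nhds u. r differentiable (at v)"
    by (rule eventually_domI[OF u differentiable])
  ultimately show ?thesis
    by (subst laplace_beltrami_components) (simp_all add: u tangent_differentiable)
qed

text \<open>Near a point of the chart, \<open>G\<close> is a fixed sign times any given continuous unit normal field
  \<open>\<nu>\<close>: the continuous function \<open>G \<bullet> \<nu>\<close> has the values \<open>\<plusminus> 1\<close>.\<close>

lemma gauss_map_local_sign:
  assumes G: "gauss_map Q G" and U0: "open U0" "U0 \<subseteq> U" "u \<in> U0"
    and cont: "continuous_on U0 \<nu>" and unit: "\<And>v. v \<in> U0 \<Longrightarrow> norm (\<nu> v) = 1"
    and normal: "\<And>v i. v \<in> U0 \<Longrightarrow> \<nu> v \<bullet> tangent i v = 0"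
  obtains s :: real where "s = 1 \<or> s = -1" "\<forall>\<^sub>F v in nhds u. G (r v) = s *\<^sub>R \<nu> v"
proof -
  have pm: "G (r v) = \<nu> v \<or> G (r v) = - \<nu> v" if v: "v \<in> U0" for v
  proof -
    have vU: "v \<in> U" using v U0 by auto
    obtain c where c: "\<nu> v = c *\<^sub>R unit_normal r v" using parallel_unit_normal[OF vU normal[OF v]] by blast
    have "\<bar>c\<bar> = 1" using unit[OF v] norm_unit_normal[OF vU] unfolding c by simp
    then have "c = 1 \<or> c = - 1" by linarith
    moreover have "G (r v) = unit_normal r v \<or> G (r v) = - unit_normal r v"
      using G param vU unfolding gauss_map_def unit_normal_def by blast
    ultimately show ?thesis unfolding c by auto
  qed
  have contG: "continuous_on U0 (\<lambda>v. G (r v))"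
  proof (rule continuous_on_compose2[of Q G])
    show "continuous_on Q G" using G by (simp add: gauss_map_def)
    show "continuous_on U0 r" using smooth_on_continuous[OF smooth] U0 continuous_on_subset by blast
    show "r ` U0 \<subseteq> Q" using mem_Q U0 by auto
  qed
  define f where "f v = G (r v) \<bullet> \<nu> v" for v
  have "continuous_on U0 f" unfolding f_def by (intro continuous_intros contG cont)
  then have "isCont f u" using U0 by (simp add: continuous_on_eq_continuous_at)
  then have lim: "(f \<longlongrightarrow> f u) (nhds u)" by (simp add: isCont_def tendsto_at_iff_tendsto_nhds)
  have ev0: "\<forall>\<^sub>F v in nhds u. v \<in> U0" using U0 by (intro eventually_nhds_in_open)
  have sq: "\<nu> v \<bullet> \<nu> v = 1" if "v \<in> U0" for v using unit[OF that] by (simp add: dot_square_norm)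
  consider "f u = 1" | "f u = -1"
    using pm[OF U0(3)] sq[OF U0(3)] unfolding f_def by auto
  then show ?thesis
  proof cases
    case 1
    have "\<forall>\<^sub>F v in nhds u. f v > 0" using lim 1 by (intro order_tendstoD(1)[of f 1]) auto
    with ev0 have "\<forall>\<^sub>F v in nhds u. G (r v) = 1 *\<^sub>R \<nu> v"
      by eventually_elim (use pm sq in \<open>fastforce simp: f_def\<close>)
    then show ?thesis using that[of 1] by blast
  next
    case 2
    have "\<forall>\<^sub>F v in nhds u. f v < 0" using lim 2 by (intro order_tendstoD(2)[of f "-1"]) auto
    with ev0 have "\<forall>\<^sub>F v in nhds u. G (r v) = (-1) *\<^sub>R \<nu> v"
      by eventually_elim (use pm sq in \<open>fastforce simp: f_def\<close>)
    then show ?thesis using that[of "-1"] by blast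
  qed
qed

lemma laplace_beltrami_cong:
  assumes "\<forall>\<^sub>F v in nhds u. f v = g v"
  shows "laplace_beltrami r f u = laplace_beltrami r g u"
proof -
  have "partial_deriv i (\<lambda>v. sqrt (det (first_form r v)) * matrix_inv (first_form r v) $ i $ j * partial_deriv j f v) u
      = partial_deriv i (\<lambda>v. sqrt (det (first_form r v)) * matrix_inv (first_form r v) $ i $ j * partial_deriv j g v) u" for i j
    by (rule partial_deriv_cong, use partial_deriv_cong_ev[OF assms, of j] in eventually_elim) simp
  then show ?thesis by (simp add: laplace_beltrami_def)
qed

end

lemma orthonormal_frame_axis: "orthonormal_frame (\<lambda>k. axis k 1)"
  unfolding orthonormal_frame_def by (simp add: inner_axis_axis)

section \<open>Planes, spheres and circular cylinders\<close>

text \<open>On a plane \<open>G\<close> is locally constant.\<close>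

lemma (in chart) laplace_gauss_constant:
  assumes G: "gauss_map Q G" and u: "u \<in> U" and n: "n \<noteq> 0" and plane: "\<And>v. v \<in> U \<Longrightarrow> n \<bullet> r v = d"
  shows "(\<chi> k. laplace_beltrami r (\<lambda>v. G (r v) $ k) u) = 0"
proof -
  have normal: "n \<bullet> tangent i v = 0" if v: "v \<in> U" for v i
  proof -
    have "partial_deriv i (\<lambda>v. n \<bullet> r v) v = partial_deriv i (\<lambda>v. d) v"
      by (rule partial_deriv_cong, rule eventually_domI[OF v plane])
    then show ?thesis
      using partial_deriv_bounded_linear[OF bounded_linear_inner_right differentiable[OF v], of i n]
      by (simp add: partial_deriv_const)
  qed
  obtain s :: real where s: "\<forall>\<^sub>F v in nhds u. G (r v) = s *\<^sub>R (n /\<^sub>R norm n)"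
  proof (rule gauss_map_local_sign[OF G open_dom order_refl u, of "\<lambda>v. n /\<^sub>R norm n"])
    show "norm (n /\<^sub>R norm n) = 1" using n by simp
    show "(n /\<^sub>R norm n) \<bullet> tangent i v = 0" if "v \<in> U" for v i using normal[OF that] by simp
  qed auto
  have "laplace_beltrami r (\<lambda>v. G (r v) $ k) u = 0" for k
  proof -
    have "laplace_beltrami r (\<lambda>v. G (r v) $ k) u = laplace_beltrami r (\<lambda>v. (s *\<^sub>R (n /\<^sub>R norm n)) $ k) u"
      by (rule laplace_beltrami_cong, use s in eventually_elim) simp
    then show ?thesis by (simp add: laplace_beltrami_def partial_deriv_const)
  qed
  then show ?thesis by (simp add: vec_eq_iff)
qed

text \<open>Spheres and circular cylinders have the equation \<open>(x - a) \<bullet> L (x - a) = R\<^sup>2\<close> with an orthogonal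
  projection \<open>L\<close> that fixes the normal vectors, and their Gauss map is \<open>\<plusminus> L (x - a) / R\<close>. Hence its
  Laplacian is normal together with that of the position vector, and only the energy density has to be
  computed.\<close>

lemma (in chart) laplace_gauss_projection:
  fixes L :: "real^3 \<Rightarrow> real^3"
  assumes G: "gauss_map Q G" and u: "u \<in> U" and R: "R > 0"
    and L: "bounded_linear L" and sym: "\<And>x y. L x \<bullet> y = x \<bullet> L y" and idem: "\<And>x. L (L x) = L x"
    and eqn: "\<And>v. v \<in> U \<Longrightarrow> (r v - a) \<bullet> L (r v - a) = R\<^sup>2"
  shows "(\<chi> k. laplace_beltrami r (\<lambda>v. G (r v) $ k) u)
     = (((\<Sum>k\<in>UNIV. L (axis k 1) $ k) - 1) / R\<^sup>2) *\<^sub>R G (r u)"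
proof -
  interpret L: bounded_linear L by (rule L)
  define \<nu> where "\<nu> v = (1 / R) *\<^sub>R L (r v - a)" for v
  have dr: "(\<lambda>v. r v - a) differentiable (at v)" if "v \<in> U" for v
    by (intro differentiable_diff differentiable that differentiable_const)
  have d\<nu>: "\<nu> differentiable (at v)" if "v \<in> U" for v
    unfolding \<nu>_def by (intro differentiable_scaleR differentiable_const differentiable_bounded_linear[OF L] dr that)
  have pdr: "partial_deriv i (\<lambda>v. r v - a) v = tangent i v" if "v \<in> U" for i v
    using partial_deriv_add[OF differentiable[OF that] differentiable_const, of i "-a"] by (simp add: partial_deriv_const)
  have pd\<nu>: "partial_deriv i \<nu> v = (1 / R) *\<^sub>R L (tangent i v)" if "v \<in> U" for i v
    using partial_deriv_bounded_linear[OF bounded_linear_compose[OF bounded_linear_scaleR_right[of "1 / R"] L] dr[OF that], of i]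
    by (simp add: \<nu>_def[abs_def] pdr[OF that])
  have unit: "norm (\<nu> v) = 1" if "v \<in> U" for v
  proof -
    have "L (r v - a) \<bullet> L (r v - a) = R\<^sup>2" using eqn[OF that] by (simp add: sym idem)
    then have "norm (L (r v - a)) = R" using R by (simp add: norm_eq_sqrt_inner)
    then show ?thesis using R by (simp add: \<nu>_def)
  qed
  have normal: "\<nu> v \<bullet> tangent i v = 0" if v: "v \<in> U" for v i
  proof -
    have "partial_deriv i (\<lambda>v. (r v - a) \<bullet> L (r v - a)) v = partial_deriv i (\<lambda>v. R\<^sup>2) v"
      by (rule partial_deriv_cong, rule eventually_domI[OF v eqn])
    then have "tangent i v \<bullet> L (r v - a) + (r v - a) \<bullet> L (tangent i v) = 0"
      by (simp add: partial_deriv_inner[OF dr[OF v] differentiable_bounded_linear[OF L dr[OF v]]] pdr[OF v]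
          partial_deriv_const partial_deriv_bounded_linear[OF L dr[OF v]])
    moreover have "tangent i v \<bullet> L (r v - a) = L (r v - a) \<bullet> tangent i v" by (rule inner_commute)
    ultimately have "L (r v - a) \<bullet> tangent i v = 0" using sym[of "r v - a" "tangent i v"] by linarith
    then show ?thesis by (simp add: \<nu>_def)
  qed
  have "continuous_on U \<nu>"
    by (rule differentiable_imp_continuous_on) (use d\<nu> in \<open>auto simp: differentiable_on_def intro: differentiable_at_withinI\<close>)
  then obtain s where s: "s = 1 \<or> s = -1" "\<forall>\<^sub>F v in nhds u. G (r v) = s *\<^sub>R \<nu> v"
    by (rule gauss_map_local_sign[OF G open_dom order_refl u, of \<nu>]) (use unit normal in auto)
  define h where "h v = s *\<^sub>R \<nu> v" for v
  have dh: "h differentiable (at v)" if "v \<in> U" for v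
    unfolding h_def by (intro differentiable_scaleR differentiable_const d\<nu> that)
  have pdh: "partial_deriv i h v = (s / R) *\<^sub>R L (tangent i v)" if "v \<in> U" for i v
    using partial_deriv_bounded_linear[OF bounded_linear_scaleR_right[of s] d\<nu>[OF that], of i]
    by (simp add: h_def[abs_def] pd\<nu>[OF that])
  have ev_dh: "\<forall>\<^sub>F v in nhds u. h differentiable (at v)" by (rule eventually_domI[OF u dh])
  have pdh_ev: "\<forall>\<^sub>F v in nhds u. partial_deriv i h v = (s / R) *\<^sub>R L (tangent i v)" for i
    by (rule eventually_domI[OF u pdh])
  have dpdh: "partial_deriv i h differentiable (at u)" for i
    by (rule differentiable_cong_ev[OF pdh_ev])
       (intro differentiable_scaleR differentiable_const differentiable_bounded_linear[OF L] tangent_differentiable u)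
  define \<Delta>r where "\<Delta>r = (\<chi> k. laplace_beltrami r (\<lambda>v. r v $ k) u)"
  have lap: "(\<chi> k. laplace_beltrami r (\<lambda>v. h v $ k) u) = (s / R) *\<^sub>R L \<Delta>r"
  proof -
    have bl: "bounded_linear (\<lambda>x. (s / R) *\<^sub>R L x)"
      by (intro bounded_linear_compose[OF bounded_linear_scaleR_right L])
    have "partial_deriv i (\<lambda>v. metric_coeff r i j v *\<^sub>R partial_deriv j h v) u
        = (s / R) *\<^sub>R L (partial_deriv i (\<lambda>v. metric_coeff r i j v *\<^sub>R tangent j v) u)" for i j
    proof -
      have "partial_deriv i (\<lambda>v. metric_coeff r i j v *\<^sub>R partial_deriv j h v) u
          = partial_deriv i (\<lambda>v. (s / R) *\<^sub>R L (metric_coeff r i j v *\<^sub>R tangent j v)) u"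
        by (rule partial_deriv_cong, rule eventually_domI[OF u]) (simp add: pdh L.scaleR)
      also have "\<dots> = (s / R) *\<^sub>R L (partial_deriv i (\<lambda>v. metric_coeff r i j v *\<^sub>R tangent j v) u)"
        by (intro partial_deriv_bounded_linear[OF bl] differentiable_scaleR metric_coeff_differentiable tangent_differentiable u)
      finally show ?thesis .
    qed
    then show ?thesis
      unfolding \<Delta>r_def
      by (simp add: laplace_beltrami_components[OF u ev_dh dpdh] L.sum L.scaleR L.neg scaleR_sum_right
          laplace_beltrami_components[OF u eventually_domI[OF u differentiable] tangent_differentiable[OF u]] mult.commute)
  qed
  obtain c where c: "\<nu> u = c *\<^sub>R unit_normal r u" using parallel_unit_normal[OF u normal[OF u]] by blast
  have c0: "c \<noteq> 0" using unit[OF u] c by auto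
  have L\<nu>: "L (\<nu> v) = \<nu> v" for v by (simp add: \<nu>_def L.scaleR idem)
  then have Ln: "L (unit_normal r u) = unit_normal r u" using c c0 by (metis L.scaleR scaleR_cancel_left)
  have "\<Delta>r \<bullet> tangent i u = 0" for i unfolding \<Delta>r_def by (rule laplace_position_normal[OF u])
  then obtain d where d: "\<Delta>r = d *\<^sub>R unit_normal r u" using parallel_unit_normal[OF u] by blast
  have hu: "h u = (s * c) *\<^sub>R unit_normal r u" by (simp add: h_def c)
  have sc: "s * c \<noteq> 0" using s c0 by auto
  have lap2: "(\<chi> k. laplace_beltrami r (\<lambda>v. h v $ k) u) = (s / R * d / (s * c)) *\<^sub>R h u"
    unfolding lap d hu using sc by (simp add: L.scaleR Ln)
  have hh: "h v \<bullet> h v = 1" if "v \<in> U" for v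
    using unit[OF that] s by (auto simp: h_def dot_square_norm)
  have ev_hh: "\<forall>\<^sub>F v in nhds u. h v \<bullet> h v = 1" by (rule eventually_domI[OF u hh])
  have "s / R * d / (s * c) = h u \<bullet> (\<chi> k. laplace_beltrami r (\<lambda>v. h v $ k) u)"
    unfolding lap2 using hh[OF u] by simp
  also have "\<dots> = (\<Sum>k\<in>UNIV. ((s / R) *\<^sub>R L (axis k 1)) \<bullet> ((s / R) *\<^sub>R L (axis k 1))
        - (unit_normal r u \<bullet> ((s / R) *\<^sub>R L (axis k 1)))\<^sup>2)"
    unfolding inner_laplace_unit_field[OF u ev_dh dpdh ev_hh]
  proof (rule energy_density_frame[OF u orthonormal_frame_axis])
    fix i k
    have "L (tangent i u) \<bullet> axis k 1 = L (axis k 1) \<bullet> tangent i u"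
      using sym[of "tangent i u" "axis k 1"] inner_commute[of "tangent i u" "L (axis k 1)"] by simp
    then show "partial_deriv i h u \<bullet> axis k 1 = ((s / R) *\<^sub>R L (axis k 1)) \<bullet> tangent i u"
      by (simp add: pdh[OF u])
  qed
  also have "\<dots> = (\<Sum>k\<in>UNIV. L (axis k 1) $ k / R\<^sup>2 - (unit_normal r u $ k)\<^sup>2 / R\<^sup>2)"
  proof (rule sum.cong[OF refl])
    fix k :: 3
    have ss: "s * (s * x) = x" for x using s by auto
    have 1: "L (axis k 1) \<bullet> L (axis k 1) = L (axis k 1) $ k"       using sym[of "L (axis k 1)" "axis k 1"] by (simp add: idem inner_axis)
    have 2: "unit_normal r u \<bullet> L (axis k 1) = unit_normal r u $ k"       using sym[of "unit_normal r u" "axis k 1"] by (simp add: inner_axis Ln)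
    show "((s / R) *\<^sub>R L (axis k 1)) \<bullet> ((s / R) *\<^sub>R L (axis k 1)) - (unit_normal r u \<bullet> ((s / R) *\<^sub>R L (axis k 1)))\<^sup>2
        = L (axis k 1) $ k / R\<^sup>2 - (unit_normal r u $ k)\<^sup>2 / R\<^sup>2"
      by (simp add: 1 2 power2_eq_square) (simp add: field_simps ss)
  qed
  also have "\<dots> = ((\<Sum>k\<in>UNIV. L (axis k 1) $ k) - (\<Sum>k\<in>UNIV. (unit_normal r u $ k)\<^sup>2)) / R\<^sup>2"
    by (simp add: sum_subtractf diff_divide_distrib flip: sum_divide_distrib)
  also have "(\<Sum>k\<in>UNIV. (unit_normal r u $ k)\<^sup>2) = 1"
    using norm_unit_normal[OF u] dot_square_norm[of "unit_normal r u"] by (simp add: inner_vec_def power2_eq_square)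
  finally have coeff: "s / R * d / (s * c) = ((\<Sum>k\<in>UNIV. L (axis k 1) $ k) - 1) / R\<^sup>2" .
  have "laplace_beltrami r (\<lambda>v. G (r v) $ k) u = laplace_beltrami r (\<lambda>v. h v $ k) u" for k
    by (rule laplace_beltrami_cong, use s(2) in eventually_elim) (simp add: h_def)
  moreover have "G (r u) = h u" using eventually_nhds_x_imp_x[OF s(2)] by (simp add: h_def)
  ultimately show ?thesis using lap2 unfolding coeff by simp
qed

lemma infdist_line_unit:
  fixes w :: "'a::real_inner"
  assumes w: "norm w = 1"
  shows "infdist x (range (\<lambda>t. a + t *\<^sub>R w)) = sqrt ((x - a) \<bullet> (x - a) - (w \<bullet> (x - a))\<^sup>2)"
proof -
  define t0 where "t0 = w \<bullet> (x - a)"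
  have ww: "w \<bullet> w = 1" using w by (simp add: dot_square_norm)
  have dist_sq: "dist x (a + t *\<^sub>R w) = sqrt ((x - a) \<bullet> (x - a) - t0\<^sup>2 + (t - t0)\<^sup>2)" for t
  proof -
    have "(x - (a + t *\<^sub>R w)) \<bullet> (x - (a + t *\<^sub>R w)) = (x - a) \<bullet> (x - a) - 2 * t * (w \<bullet> (x - a)) + t\<^sup>2 * (w \<bullet> w)"
      by (simp add: inner_diff_left inner_diff_right inner_add_left inner_add_right inner_commute power2_eq_square algebra_simps)
    also have "\<dots> = (x - a) \<bullet> (x - a) - t0\<^sup>2 + (t - t0)\<^sup>2"
      by (simp add: ww t0_def power2_eq_square algebra_simps)
    finally show ?thesis unfolding dist_norm norm_eq_sqrt_inner by simp
  qed
  have "infdist x (range (\<lambda>t. a + t *\<^sub>R w)) \<le> dist x (a + t0 *\<^sub>R w)" by (intro infdist_le) auto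
  moreover have "dist x (a + t0 *\<^sub>R w) \<le> infdist x (range (\<lambda>t. a + t *\<^sub>R w))"
    by (subst infdist_notempty, simp, rule cINF_greatest) (auto simp: dist_sq)
  ultimately show ?thesis by (simp add: dist_sq t0_def)
qed

text \<open>The quadratic equation of a circular cylinder with axis direction \<open>w\<close> of unit length.\<close>

lemma is_circular_cylinder_iff:
  "is_circular_cylinder S \<longleftrightarrow>
     (\<exists>a w R. norm w = 1 \<and> R > 0 \<and> S = {x. (x - a) \<bullet> (x - a) - (w \<bullet> (x - a))\<^sup>2 = R\<^sup>2})"
proof -
  have eq: "{x. infdist x (range (\<lambda>t. a + t *\<^sub>R w)) = R} = {x. (x - a) \<bullet> (x - a) - (w \<bullet> (x - a))\<^sup>2 = R\<^sup>2}"
    if "norm w = 1" "R > 0" for a w :: "real^3" and R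
  proof -
    have "sqrt (R\<^sup>2) = R" using that(2) by simp
    then have "sqrt E = R \<longleftrightarrow> E = R\<^sup>2" for E by (metis real_sqrt_eq_iff)
    then show ?thesis by (simp add: infdist_line_unit[OF that(1)])
  qed
  have "range (\<lambda>t. a + t *\<^sub>R w) = range (\<lambda>t. a + t *\<^sub>R (w /\<^sub>R norm w))" if "w \<noteq> 0" for a w :: "real^3"
  proof -
    have "surj (\<lambda>t. t * inverse (norm w))" using that by (intro surjI[where f = "\<lambda>t. t * norm w"]) simp
    then have "range ((\<lambda>t. a + t *\<^sub>R w) \<circ> (\<lambda>t. t * inverse (norm w))) = range (\<lambda>t. a + t *\<^sub>R w)"
      by (simp only: image_comp[symmetric])
    then show ?thesis by (simp add: o_def)
  qed
  note rescale = this
  show ?thesis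
  proof
    assume "is_circular_cylinder S"
    then obtain a w R where *: "w \<noteq> 0" "R > 0" "S = {x. infdist x (range (\<lambda>t. a + t *\<^sub>R w)) = R}"
      unfolding is_circular_cylinder_def by auto
    have "norm (w /\<^sub>R norm w) = 1" using *(1) by simp
    then show "\<exists>a w R. norm w = 1 \<and> R > 0 \<and> S = {x. (x - a) \<bullet> (x - a) - (w \<bullet> (x - a))\<^sup>2 = R\<^sup>2}"
      using eq[OF _ *(2), of "w /\<^sub>R norm w" a] *(2,3) rescale[OF *(1), of a]
      by (intro exI[of _ a] exI[of _ "w /\<^sub>R norm w"] exI[of _ R]) simp
  next
    assume "\<exists>a w R. norm w = 1 \<and> R > 0 \<and> S = {x. (x - a) \<bullet> (x - a) - (w \<bullet> (x - a))\<^sup>2 = R\<^sup>2}"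
    then obtain a w R where *: "norm w = 1" "R > 0" "S = {x. (x - a) \<bullet> (x - a) - (w \<bullet> (x - a))\<^sup>2 = R\<^sup>2}" by blast
    have "w \<noteq> 0" using *(1) by auto
    then show "is_circular_cylinder S" unfolding is_circular_cylinder_def using eq[OF *(1,2), of a] *
      by (intro exI[of _ a] exI[of _ w] exI[of _ R]) simp
  qed
qed

lemma laplacian_of_plane_cylinder_sphere:
  assumes G: "gauss_map Q G" and S: "is_plane S \<or> is_circular_cylinder S \<or> is_sphere S" and Q: "open_part_of Q S"
  shows "\<exists>M::real^3^3. laplacian_on Q G (\<lambda>x. M *v G x)"
proof -
  have QS: "Q \<subseteq> S" using Q unfolding open_part_of_def by (rule openin_imp_subset)
  have scalar: "?thesis" if "\<And>U r u. chart Q U r \<Longrightarrow> u \<in> U \<Longrightarrow> (\<chi> k. laplace_beltrami r (\<lambda>v. G (r v) $ k) u) = c *\<^sub>R G (r u)" for c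
  proof -
    have "(c *\<^sub>R mat 1) *v x = c *\<^sub>R x" for x :: "real^3" by (simp add: scaleR_matrix_vector_assoc[symmetric])
    then have "laplacian_on Q G (\<lambda>x. (c *\<^sub>R mat 1) *v G x)"
      using that unfolding laplacian_on_def chart_def by simp
    then show ?thesis by blast
  qed
  from S show ?thesis
  proof (elim disjE)
    assume "is_plane S"
    then obtain n d where n: "n \<noteq> 0" "S = {x. n \<bullet> x = d}" unfolding is_plane_def by auto
    show ?thesis
    proof (rule scalar[of 0])
      fix U r u assume c: "chart Q U r" and u: "u \<in> U"
      show "(\<chi> k. laplace_beltrami r (\<lambda>v. G (r v) $ k) u) = 0 *\<^sub>R G (r u)"
        using chart.laplace_gauss_constant[OF c G u n(1), of d] chart.mem_Q[OF c] QS n(2) by auto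
    qed
  next
    assume "is_circular_cylinder S"
    then obtain a w R where c: "norm w = 1" "R > 0" "S = {x. (x - a) \<bullet> (x - a) - (w \<bullet> (x - a))\<^sup>2 = R\<^sup>2}"
      unfolding is_circular_cylinder_iff by auto
    define L where "L x = x - (w \<bullet> x) *\<^sub>R w" for x
    have L: "bounded_linear L" unfolding L_def
      by (intro bounded_linear_sub bounded_linear_ident bounded_linear_scaleR_const bounded_linear_inner_right)
    have sym: "L x \<bullet> y = x \<bullet> L y" for x y
      by (simp add: L_def inner_diff_left inner_diff_right inner_commute)
    have idem: "L (L x) = L x" for x
      using c(1) by (simp add: L_def inner_diff_right dot_square_norm)
    show ?thesis
    proof (rule scalar[of "((\<Sum>k\<in>UNIV. L (axis k 1) $ k) - 1) / R\<^sup>2"])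
      fix U r u assume ch: "chart Q U r" and u: "u \<in> U"
      have "(r v - a) \<bullet> L (r v - a) = R\<^sup>2" if "v \<in> U" for v
        using chart.mem_Q[OF ch that] QS c(3) by (auto simp: L_def inner_diff_right power2_eq_square inner_commute)
      then show "(\<chi> k. laplace_beltrami r (\<lambda>v. G (r v) $ k) u) = (((\<Sum>k\<in>UNIV. L (axis k 1) $ k) - 1) / R\<^sup>2) *\<^sub>R G (r u)"
        by (rule chart.laplace_gauss_projection[OF ch G u c(2) L sym idem])
    qed
  next
    assume "is_sphere S"
    then obtain a R where c: "R > 0" "S = sphere a R" unfolding is_sphere_def by auto
    show ?thesis
    proof (rule scalar[of "((\<Sum>k\<in>UNIV. axis k (1::real) $ (k::3)) - 1) / R\<^sup>2"])
      fix U r u assume ch: "chart Q U r" and u: "u \<in> U"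
      have "(r v - a) \<bullet> (r v - a) = R\<^sup>2" if "v \<in> U" for v
        using chart.mem_Q[OF ch that] QS c(2) by (auto simp: dot_square_norm dist_norm norm_minus_commute)
      then show "(\<chi> k. laplace_beltrami r (\<lambda>v. G (r v) $ k) u) = (((\<Sum>k\<in>UNIV. axis k (1::real) $ (k::3)) - 1) / R\<^sup>2) *\<^sub>R G (r u)"
        by (intro chart.laplace_gauss_projection[OF ch G u c(1) bounded_linear_ident refl refl])
    qed
  qed
qed

section \<open>The normal component on a quadric\<close>

text \<open>The polynomial of degree at most two with matrix \<open>A\<close>, linear part \<open>b\<close> and constant term \<open>c\<close>.\<close>

definition quadratic :: "real^3^3 \<Rightarrow> real^3 \<Rightarrow> real \<Rightarrow> real^3 \<Rightarrow> real" where
  "quadratic A b c x = x \<bullet> (A *v x) + b \<bullet> x + c"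

text \<open>The gradient of \<open>quadratic A b c\<close> for a symmetric matrix \<open>A\<close>.\<close>

definition gradient :: "real^3^3 \<Rightarrow> real^3 \<Rightarrow> real^3 \<Rightarrow> real^3" where
  "gradient A b x = 2 *\<^sub>R (A *v x) + b"

lemma symmetric_matrix_inner:
  fixes A :: "real^'n::finite^'n"
  assumes "transpose A = A" shows "x \<bullet> (A *v y) = (A *v x) \<bullet> y"
  using dot_lmul_matrix[of x A y] by (simp add: assms flip: transpose_matrix_vector)

lemma degree_two_polynomial_quadratic:
  assumes "degree_two_polynomial p"
  obtains A b c where "transpose A = A" "A \<noteq> 0" "p = quadratic A b c"
proof -
  obtain A :: "real^3^3" and b :: "real^3" and c where *: "transpose A = A" "A \<noteq> 0"
    "p = (\<lambda>x. (\<Sum>i\<in>UNIV. \<Sum>j\<in>UNIV. A $ i $ j * x $ i * x $ j) + (\<Sum>i\<in>UNIV. b $ i * x $ i) + c)"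
    using assms unfolding degree_two_polynomial_def by blast
  have "p = quadratic A b c"
    unfolding *(3) quadratic_def inner_vec_def matrix_vector_mult_def
    by (simp add: sum_distrib_left mult_ac)
  then show ?thesis using that * by blast
qed

lemma partial_deriv_inverse_norm:
  fixes f :: "real^'n::finite \<Rightarrow> 'b::real_inner"
  assumes "f differentiable (at u)" "f u \<noteq> 0"
  shows "partial_deriv i (\<lambda>v. inverse (norm (f v))) u = - (inverse (norm (f u)) ^ 3 * (f u \<bullet> partial_deriv i f u))"
    and "(\<lambda>v. inverse (norm (f v))) differentiable (at u)"
proof -
  obtain f' where f': "(f has_derivative f') (at u)" using assms unfolding differentiable_def by auto
  have "((\<lambda>v. norm (f v)) has_derivative (\<lambda>h. (f' h \<bullet> sgn (f u)))) (at u)"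
    using has_derivative_compose[OF f' has_derivative_norm[OF assms(2)]] .
  from Deriv.has_derivative_inverse[OF _ this]
  have D: "((\<lambda>v. inverse (norm (f v))) has_derivative (\<lambda>h. - (inverse (norm (f u)) * (f' h \<bullet> sgn (f u)) * inverse (norm (f u))))) (at u)"
    using assms(2) by simp
  then show "partial_deriv i (\<lambda>v. inverse (norm (f v))) u = - (inverse (norm (f u)) ^ 3 * (f u \<bullet> partial_deriv i f u))"
    by (simp add: partial_deriv_eq[OF D] partial_deriv_eq[OF f'] sgn_div_norm inner_commute power3_eq_cube mult_ac)
  show "(\<lambda>v. inverse (norm (f v))) differentiable (at u)" using D unfolding differentiable_def by blast
qed

text \<open>The normal component of \<open>\<Delta> G = M G\<close>. In an eigenbasis \<open>e\<close> of \<open>A\<close> with eigenvalues \<open>l\<close>, the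
  right-hand side is \<open>4 |g|\<^sup>4\<close> times the squared norm of the compression of \<open>A\<close> to the tangent plane,
  where \<open>g\<close> is the gradient.\<close>

lemma (in chart) quadric_normal_component:
  assumes G: "gauss_map Q G" and u: "u \<in> U" and A: "transpose A = A"
    and eqn: "\<And>v. v \<in> U \<Longrightarrow> quadratic A b c (r v) = 0"
    and regular: "gradient A b (r u) \<noteq> 0"
    and lapG: "(\<chi> k. laplace_beltrami r (\<lambda>v. G (r v) $ k) u) = M *v G (r u)"
    and e: "orthonormal_frame e" and eig: "\<And>k. A *v e k = l k *\<^sub>R e k"
  defines "g \<equiv> gradient A b (r u)"
  shows "(g \<bullet> (M *v g)) * (g \<bullet> g)\<^sup>2 =
     4 * ((\<Sum>k\<in>UNIV. (l k)\<^sup>2) * (g \<bullet> g)\<^sup>2 - 2 * (g \<bullet> g) * (\<Sum>k\<in>UNIV. (l k * (g \<bullet> e k))\<^sup>2)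
        + (\<Sum>k\<in>UNIV. l k * (g \<bullet> e k)\<^sup>2)\<^sup>2)"
proof -
  define \<gamma> where "\<gamma> v = gradient A b (r v)" for v
  define B where "B x = 2 *\<^sub>R (A *v x)" for x
  have B: "bounded_linear B" unfolding B_def
    by (intro bounded_linear_compose[OF bounded_linear_scaleR_right matrix_vector_mul_bounded_linear])
  interpret B: bounded_linear B by (rule B)
  have symB: "x \<bullet> B y = B x \<bullet> y" for x y by (simp add: B_def symmetric_matrix_inner[OF A])
  have d\<gamma>: "\<gamma> differentiable (at v)" and pd\<gamma>: "partial_deriv i \<gamma> v = B (tangent i v)" if v: "v \<in> U" for v i
  proof -
    have \<gamma>: "\<gamma> = (\<lambda>v. B (r v) + b)" by (simp add: \<gamma>_def gradient_def B_def fun_eq_iff)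
    show "\<gamma> differentiable (at v)" unfolding \<gamma>
      by (intro differentiable_add differentiable_const differentiable_bounded_linear[OF B] differentiable v)
    show "partial_deriv i \<gamma> v = B (tangent i v)" unfolding \<gamma>
      by (simp add: partial_deriv_add differentiable_bounded_linear[OF B] differentiable v partial_deriv_const
          partial_deriv_bounded_linear[OF B])
  qed
  have \<gamma>_normal: "\<gamma> v \<bullet> tangent i v = 0" if v: "v \<in> U" for v i
  proof -
    have A': "(\<lambda>v. A *v r v) differentiable (at v)" "partial_deriv i (\<lambda>v. A *v r v) v = A *v tangent i v"
      using differentiable_bounded_linear[OF matrix_vector_mul_bounded_linear[of A] differentiable[OF v]]
        partial_deriv_bounded_linear[OF matrix_vector_mul_bounded_linear[of A] differentiable[OF v]] by auto
    have 1: "partial_deriv i (\<lambda>v. r v \<bullet> (A *v r v)) v = tangent i v \<bullet> (A *v r v) + r v \<bullet> (A *v tangent i v)"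
         "(\<lambda>v. r v \<bullet> (A *v r v)) differentiable (at v)"
      using partial_deriv_inner[OF differentiable[OF v] A'(1)] A'(2)
        differentiable_bilinear[OF bounded_bilinear_inner differentiable[OF v] A'(1)] by auto
    have 2: "partial_deriv i (\<lambda>v. b \<bullet> r v + c) v = b \<bullet> tangent i v" "(\<lambda>v. b \<bullet> r v + c) differentiable (at v)"
      using partial_deriv_add[OF differentiable_bounded_linear[OF bounded_linear_inner_right[of b] differentiable[OF v]] differentiable_const, of i c]
        partial_deriv_bounded_linear[OF bounded_linear_inner_right[of b] differentiable[OF v]]
      by (auto simp: partial_deriv_const intro!: differentiable_add differentiable_bounded_linear[OF bounded_linear_inner_right] differentiable v)
    have "partial_deriv i (\<lambda>v. r v \<bullet> (A *v r v) + (b \<bullet> r v + c)) v = partial_deriv i (\<lambda>v. 0) v"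
      by (rule partial_deriv_cong, rule eventually_domI[OF v]) (use eqn in \<open>simp add: quadratic_def add.assoc\<close>)
    then have "tangent i v \<bullet> (A *v r v) + r v \<bullet> (A *v tangent i v) + b \<bullet> tangent i v = 0"
      by (simp add: partial_deriv_add[OF 1(2) 2(2)] 1(1) 2(1) partial_deriv_const)
    moreover have "r v \<bullet> (A *v tangent i v) = tangent i v \<bullet> (A *v r v)"
      by (metis symmetric_matrix_inner[OF A] inner_commute)
    ultimately show ?thesis
      by (simp add: \<gamma>_def gradient_def inner_add_left inner_commute[of _ "tangent i v"] inner_add_right)
  qed
  define U0 where "U0 = {v \<in> U. \<gamma> v \<noteq> 0}"
  have cont\<gamma>: "continuous_on U \<gamma>"
    by (rule differentiable_imp_continuous_on) (use d\<gamma> in \<open>auto simp: differentiable_on_def intro: differentiable_at_withinI\<close>)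
  have "U0 = U \<inter> \<gamma> -` (- {0})" by (auto simp: U0_def)
  then have openU0: "open U0" using continuous_open_preimage[OF cont\<gamma> open_dom, of "- {0}"] by auto
  have uU0: "u \<in> U0" using u regular by (simp add: U0_def \<gamma>_def)
  have ev0: "\<forall>\<^sub>F v in nhds u. v \<in> U0" using openU0 uU0 by (rule eventually_nhds_in_open)
  define q where "q v = inverse (norm (\<gamma> v))" for v
  define \<nu> where "\<nu> v = q v *\<^sub>R \<gamma> v" for v
  have dq: "q differentiable (at v)" and pdq: "partial_deriv i q v = - (q v ^ 3 * (\<gamma> v \<bullet> B (tangent i v)))"
    if "v \<in> U0" for v i
    using partial_deriv_inverse_norm[of \<gamma> v] d\<gamma> pd\<gamma> that unfolding q_def[abs_def] by (auto simp: U0_def)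
  have d\<nu>: "\<nu> differentiable (at v)" if "v \<in> U0" for v
    unfolding \<nu>_def using that by (intro differentiable_scaleR dq d\<gamma>) (auto simp: U0_def)
  have cont\<nu>: "continuous_on U0 \<nu>"
    by (rule differentiable_imp_continuous_on) (use d\<nu> in \<open>auto simp: differentiable_on_def intro: differentiable_at_withinI\<close>)
  have unit: "norm (\<nu> v) = 1" if "v \<in> U0" for v
    using that by (simp add: \<nu>_def q_def U0_def)
  have normal: "\<nu> v \<bullet> tangent i v = 0" if "v \<in> U0" for v i
    using that \<gamma>_normal by (simp add: \<nu>_def U0_def)
  obtain s where s: "s = 1 \<or> s = -1" "\<forall>\<^sub>F v in nhds u. G (r v) = s *\<^sub>R \<nu> v"
    by (rule gauss_map_local_sign[OF G openU0 _ uU0 cont\<nu> unit normal]) (auto simp: U0_def)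
  define h where "h v = s *\<^sub>R \<nu> v" for v
  define E where "E i v = s *\<^sub>R (q v *\<^sub>R B (tangent i v) - (q v ^ 3 * (\<gamma> v \<bullet> B (tangent i v))) *\<^sub>R \<gamma> v)" for i v
  have ev_dh: "\<forall>\<^sub>F v in nhds u. h differentiable (at v)"
    using ev0 unfolding h_def by eventually_elim (intro differentiable_scaleR differentiable_const d\<nu>)
  have pdh: "partial_deriv i h v = E i v" if "v \<in> U0" for i v
  proof -
    have vU: "v \<in> U" using that by (simp add: U0_def)
    have "partial_deriv i h v = s *\<^sub>R partial_deriv i \<nu> v"
      using partial_deriv_bounded_linear[OF bounded_linear_scaleR_right[of s] d\<nu>[OF that]] by (simp add: h_def[abs_def])
    also have "partial_deriv i \<nu> v = partial_deriv i q v *\<^sub>R \<gamma> v + q v *\<^sub>R partial_deriv i \<gamma> v"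
      using partial_deriv_scaleR[OF dq[OF that] d\<gamma>[OF vU]] by (simp add: \<nu>_def[abs_def])
    finally show ?thesis by (simp add: E_def pdq[OF that] pd\<gamma>[OF vU] algebra_simps)
  qed
  have pdh_ev: "\<forall>\<^sub>F v in nhds u. partial_deriv i h v = E i v" for i
    using ev0 by eventually_elim (rule pdh)
  have dpdh: "partial_deriv i h differentiable (at u)" for i
  proof (rule differentiable_cong_ev[OF pdh_ev])
    have dBt: "(\<lambda>v. B (tangent i v)) differentiable (at u)"
      by (intro differentiable_bounded_linear[OF B] tangent_differentiable u)
    show "E i differentiable (at u)" unfolding E_def
      by (intro differentiable_scaleR differentiable_const differentiable_diff differentiable_mult differentiable_power
          dq[OF uU0] dBt d\<gamma>[OF u] differentiable_bilinear[OF bounded_bilinear_inner])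
  qed
  have ev_hh: "\<forall>\<^sub>F v in nhds u. h v \<bullet> h v = 1"
    using ev0 by eventually_elim (use s(1) unit in \<open>auto simp: h_def dot_square_norm\<close>)
  \<comment> \<open>the adjoint of the differential of \<open>\<plusminus> g / |g|\<close>, applied to \<open>e k\<close>\<close>
  define t where "t k = s *\<^sub>R (q u *\<^sub>R B (e k) - (q u ^ 3 * (g \<bullet> e k)) *\<^sub>R B g)" for k
  have g: "\<gamma> u = g" by (simp add: \<gamma>_def g_def)
  have Gh: "G (r u) = h u" using eventually_nhds_x_imp_x[OF s(2)] by (simp add: h_def)
  have "laplace_beltrami r (\<lambda>v. G (r v) $ k) u = laplace_beltrami r (\<lambda>v. h v $ k) u" for k
    by (rule laplace_beltrami_cong, use s(2) in eventually_elim) (simp add: h_def)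
  then have "h u \<bullet> (M *v h u) = h u \<bullet> (\<chi> k. laplace_beltrami r (\<lambda>v. h v $ k) u)"
    using lapG by (simp add: Gh)
  also have "\<dots> = (\<Sum>k\<in>UNIV. t k \<bullet> t k - (unit_normal r u \<bullet> t k)\<^sup>2)"
    unfolding inner_laplace_unit_field[OF u ev_dh dpdh ev_hh]
  proof (rule energy_density_frame[OF u e])
    fix i k
    show "partial_deriv i h u \<bullet> e k = t k \<bullet> tangent i u"
    proof -
      have 1: "B (tangent i u) \<bullet> e k = B (e k) \<bullet> tangent i u"
        using symB[of "tangent i u" "e k"] by (simp add: inner_commute)
      show ?thesis unfolding pdh[OF uU0] E_def t_def g by (simp add: inner_diff_left symB[of g] 1)
    qed
  qed
  finally have main: "h u \<bullet> (M *v h u) = (\<Sum>k\<in>UNIV. t k \<bullet> t k - (unit_normal r u \<bullet> t k)\<^sup>2)" .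
  have q0: "q u > 0" using regular by (simp add: q_def \<gamma>_def)
  have qW: "q u ^ 2 * (g \<bullet> g) = 1" using regular by (simp add: q_def g power_inverse power2_norm_eq_inner g_def)
  have un: "(unit_normal r u \<bullet> x)\<^sup>2 = (q u)\<^sup>2 * (g \<bullet> x)\<^sup>2" for x
  proof -
    obtain m where m: "\<nu> u = m *\<^sub>R unit_normal r u"
      using parallel_unit_normal[OF u normal[OF uU0]] by blast
    then have "\<bar>m\<bar> = 1" using unit[OF uU0] norm_unit_normal[OF u] by simp
    then have "m\<^sup>2 = 1" by (metis abs_1 one_power2 power2_abs)
    then have "(unit_normal r u \<bullet> x)\<^sup>2 = (\<nu> u \<bullet> x)\<^sup>2" by (simp add: m power_mult_distrib)
    then show ?thesis by (simp add: \<nu>_def g power_mult_distrib)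
  qed
  define y where "y k = g \<bullet> e k" for k
  define W where "W = g \<bullet> g"
  define S1 where "S1 = (\<Sum>k\<in>UNIV. (l k)\<^sup>2)"
  define S2 where "S2 = (\<Sum>k\<in>UNIV. (l k * y k)\<^sup>2)"
  define S3 where "S3 = (\<Sum>k\<in>UNIV. l k * (y k)\<^sup>2)"
  have ek: "e k \<bullet> e k = 1" for k
    using e by (simp add: orthonormal_frame_def)
  have Be: "B (e k) = (2 * l k) *\<^sub>R e k" for k by (simp add: B_def eig)
  have Bgk: "B g \<bullet> e k = 2 * l k * y k" for k by (simp add: symB[symmetric] Be y_def)
  have BgBg: "B g \<bullet> B g = 4 * S2"
    using orthonormal_frame_inner[OF e, of "B g" "B g"] unfolding Bgk S2_def
    by (simp add: sum_distrib_left power2_eq_square mult_ac)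
  have gBg: "g \<bullet> B g = 2 * S3"
    using orthonormal_frame_inner[OF e, of g "B g"] unfolding Bgk y_def[symmetric] S3_def
    by (simp add: sum_distrib_left power2_eq_square mult_ac)
  have ss: "s * s = 1" using s by auto
  have tt: "t k \<bullet> t k = 4 * (q u)\<^sup>2 * (l k)\<^sup>2 - 8 * q u ^ 4 * (l k * y k)\<^sup>2 + 4 * q u ^ 6 * (y k)\<^sup>2 * S2" for k
  proof -
    have "t k \<bullet> t k = (s * s) * ((q u)\<^sup>2 * (B (e k) \<bullet> B (e k)) - 2 * q u ^ 4 * y k * (B g \<bullet> B (e k)) + q u ^ 6 * (y k)\<^sup>2 * (B g \<bullet> B g))"
      unfolding t_def y_def[symmetric] by (simp add: inner_diff_left inner_diff_right inner_commute algebra_simps power2_eq_square eval_nat_numeral)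
    also have "\<dots> = 4 * (q u)\<^sup>2 * (l k)\<^sup>2 - 8 * q u ^ 4 * (l k * y k)\<^sup>2 + 4 * q u ^ 6 * (y k)\<^sup>2 * S2"
      unfolding ss BgBg by (simp add: Be Bgk ek power2_eq_square)
    finally show ?thesis .
  qed
  have nt: "(unit_normal r u \<bullet> t k)\<^sup>2 = 4 * q u ^ 4 * (l k * y k)\<^sup>2 - 8 * q u ^ 6 * S3 * (l k * (y k)\<^sup>2) + 4 * q u ^ 8 * S3\<^sup>2 * (y k)\<^sup>2" for k
  proof -
    have "g \<bullet> t k = s * (q u * (2 * l k * y k) - q u ^ 3 * y k * (2 * S3))"
      unfolding t_def y_def[symmetric] by (simp add: inner_diff_right gBg Be) (simp add: y_def)
    then have "(unit_normal r u \<bullet> t k)\<^sup>2 = (q u)\<^sup>2 * (s * (q u * (2 * l k * y k) - q u ^ 3 * y k * (2 * S3)))\<^sup>2"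
      by (simp only: un)
    also have "\<dots> = (s * s) * ((q u)\<^sup>2 * (q u * (2 * l k * y k) - q u ^ 3 * y k * (2 * S3))\<^sup>2)"
      by (simp only: power2_eq_square mult_ac)
    finally show ?thesis unfolding ss by (simp add: power2_eq_square eval_nat_numeral algebra_simps)
  qed
  have WW: "(\<Sum>k\<in>UNIV. (y k)\<^sup>2) = W"
    using orthonormal_frame_inner[OF e, of g g] by (simp add: y_def W_def power2_eq_square)
  have hM: "h u \<bullet> (M *v h u) = (q u)\<^sup>2 * (g \<bullet> (M *v g))"
  proof -
    have "h u \<bullet> (M *v h u) = (s * s) * ((q u)\<^sup>2 * (g \<bullet> (M *v g)))"
      by (simp add: h_def \<nu>_def g matrix_vector_mult_scaleR power2_eq_square mult_ac)
    then show ?thesis by (simp add: ss)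
  qed
  have "(q u)\<^sup>2 * (g \<bullet> (M *v g)) = (4 * (q u)\<^sup>2 * S1 - 8 * q u ^ 4 * S2 + 4 * q u ^ 6 * W * S2)
      - (4 * q u ^ 4 * S2 - 8 * q u ^ 6 * S3 * S3 + 4 * q u ^ 8 * S3\<^sup>2 * W)"
    unfolding hM[symmetric] main tt nt S1_def
    unfolding S2_def WW[symmetric] sum_3 by (simp add: S3_def sum_3 algebra_simps)
  then have fin: "(q u)\<^sup>2 * (g \<bullet> (M *v g)) = (4 * (q u)\<^sup>2 * S1 - 8 * q u ^ 4 * S2 + 4 * q u ^ 6 * W * S2)
      - (4 * q u ^ 4 * S2 - 8 * q u ^ 6 * S3 * S3 + 4 * q u ^ 8 * S3\<^sup>2 * W)" .
  define z where "z = (q u)\<^sup>2"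
  have z: "z * W = 1" using qW by (simp add: z_def W_def)
  have "z * (g \<bullet> (M *v g)) = (4 * z * S1 - 8 * z\<^sup>2 * S2 + 4 * z^3 * W * S2)
      - (4 * z\<^sup>2 * S2 - 8 * z^3 * S3 * S3 + 4 * z^4 * S3\<^sup>2 * W)"
    using fin by (simp add: z_def flip: power_mult)
  then have "(z * W) * ((g \<bullet> (M *v g)) * W\<^sup>2) = 4 * (z * W) * (S1 * W\<^sup>2) - 8 * (z * W)\<^sup>2 * (W * S2) + 4 * (z * W)^3 * (W * S2)
      - (4 * (z * W)\<^sup>2 * (W * S2) - 8 * (z * W)^3 * S3\<^sup>2 + 4 * (z * W)^4 * S3\<^sup>2)"
    by algebra
  then have "(g \<bullet> (M *v g)) * W\<^sup>2 = 4 * (S1 * W\<^sup>2 - 2 * W * S2 + S3\<^sup>2)"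
    unfolding z by (simp add: algebra_simps)
  then show ?thesis unfolding S1_def S2_def S3_def W_def y_def .
qed

section \<open>Principal axes\<close>

text \<open>On the unit sphere of an invariant subspace, the quadratic form of \<open>A\<close> attains its maximum at an
  eigenvector.\<close>

lemma symmetric_matrix_eigenvector:
  fixes A :: "real^'n::finite^'n"
  assumes A: "transpose A = A" and V: "subspace V" "\<And>x. x \<in> V \<Longrightarrow> A *v x \<in> V"
    and x0: "x0 \<in> V" "x0 \<noteq> 0"
  obtains v l where "v \<in> V" "v \<bullet> v = 1" "A *v v = l *\<^sub>R v"
proof -
  define K where "K = sphere 0 1 \<inter> V"
  have "compact K" unfolding K_def by (intro compact_Int_closed compact_sphere closed_subspace V)
  moreover have "x0 /\<^sub>R norm x0 \<in> K" using x0 V by (simp add: K_def subspace_mul)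
  moreover have "continuous_on K (\<lambda>x. x \<bullet> (A *v x))"
    by (intro continuous_intros linear_continuous_on matrix_vector_mul_bounded_linear)
  ultimately obtain v where v: "v \<in> K" "\<And>x. x \<in> K \<Longrightarrow> x \<bullet> (A *v x) \<le> v \<bullet> (A *v v)"
    using continuous_attains_sup[of K "\<lambda>x. x \<bullet> (A *v x)"] by blast
  define l where "l = v \<bullet> (A *v v)"
  have vV: "v \<in> V" and vv: "v \<bullet> v = 1" using v by (auto simp: K_def norm_eq_1)
  have max: "x \<bullet> (A *v x) \<le> l * (x \<bullet> x)" if "x \<in> V" for x
  proof (cases "x = 0")
    case False
    then have "x /\<^sub>R norm x \<in> K" using that V by (simp add: K_def subspace_mul)
    from v(2)[OF this] have "(x /\<^sub>R norm x) \<bullet> (A *v (x /\<^sub>R norm x)) \<le> l" unfolding l_def .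
    then have "x \<bullet> (A *v x) / (norm x)\<^sup>2 \<le> l"
      by (simp add: matrix_vector_mult_scaleR power2_eq_square divide_inverse mult_ac)
    then show ?thesis using False by (simp add: pos_divide_le_eq dot_square_norm)
  qed simp
  define w where "w = A *v v - l *\<^sub>R v"
  have wV: "w \<in> V" unfolding w_def by (intro subspace_diff subspace_mul V vV)
  have "w \<bullet> w = 0"
  proof (rule ccontr)
    assume ww: "w \<bullet> w \<noteq> 0"
    define \<alpha> \<beta> where "\<alpha> = w \<bullet> w" and "\<beta> = w \<bullet> (A *v w) - l * (w \<bullet> w)"
    have \<alpha>: "\<alpha> > 0" using ww by (simp add: \<alpha>_def)
    have quad: "2 * t * \<alpha> + t\<^sup>2 * \<beta> \<le> 0" for t
    proof -
      have "(v + t *\<^sub>R w) \<bullet> (A *v (v + t *\<^sub>R w)) \<le> l * ((v + t *\<^sub>R w) \<bullet> (v + t *\<^sub>R w))"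
        by (intro max subspace_add subspace_mul V vV wV)
      moreover have "v \<bullet> (A *v w) = w \<bullet> (A *v v)" by (metis symmetric_matrix_inner[OF A] inner_commute)
      ultimately have "2 * t * (w \<bullet> (A *v v) - l * (w \<bullet> v)) + t\<^sup>2 * \<beta> \<le> 0"
        unfolding \<beta>_def using vv
        by (simp add: matrix_vector_right_distrib matrix_vector_mult_scaleR inner_add_left inner_add_right
            inner_commute[of v w] power2_eq_square l_def algebra_simps)
      moreover have "w \<bullet> (A *v v) - l * (w \<bullet> v) = \<alpha>" by (simp add: \<alpha>_def w_def inner_diff_right)
      ultimately show ?thesis by simp
    qed
    \<comment> \<open>at \<open>t = \<alpha> / d\<close> the linear term outweighs the quadratic one\<close>
    define d where "d = \<bar>\<beta>\<bar> + 1"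
    have d: "d > 0" "\<beta> \<ge> - d" by (auto simp: d_def)

    have "2 * (\<alpha> / d) * \<alpha> + (\<alpha> / d)\<^sup>2 * \<beta> \<ge> 2 * (\<alpha> / d) * \<alpha> + (\<alpha> / d)\<^sup>2 * (- d)"
      using d(2) by (intro add_left_mono mult_left_mono) auto
    also have "2 * (\<alpha> / d) * \<alpha> + (\<alpha> / d)\<^sup>2 * (- d) = \<alpha>\<^sup>2 / d"
      using d by (simp add: power2_eq_square field_simps)
    finally show False using quad[of "\<alpha> / d"] \<alpha> d by (smt (verit) divide_pos_pos zero_less_power)
  qed
  then have "A *v v = l *\<^sub>R v" by (simp add: w_def)
  then show ?thesis using that vV vv by blast
qed

text \<open>The family indexed by the type \<open>3\<close> with the three given members.\<close>

definition frame3 :: "'a \<Rightarrow> 'a \<Rightarrow> 'a \<Rightarrow> 3 \<Rightarrow> 'a" where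
  "frame3 a b c k = (if k = 1 then a else if k = 2 then b else c)"

lemma frame3_simps [simp]: "frame3 a b c 1 = a" "frame3 a b c 2 = b" "frame3 a b c 3 = c"
  by (simp_all add: frame3_def)

lemma orthonormal_frame3:
  "orthonormal_frame (frame3 a b c) \<longleftrightarrow>
     a \<bullet> a = 1 \<and> b \<bullet> b = 1 \<and> c \<bullet> c = 1 \<and> a \<bullet> b = 0 \<and> a \<bullet> c = 0 \<and> b \<bullet> c = 0"
  unfolding orthonormal_frame_def forall_3 by (auto simp: inner_commute)

lemma symmetric_matrix_eigenframe:
  fixes A :: "real^3^3"
  assumes A: "transpose A = A"
  obtains a b c la lb lc where "orthonormal_frame (frame3 a b c)"
    "A *v a = la *\<^sub>R a" "A *v b = lb *\<^sub>R b" "A *v c = lc *\<^sub>R c"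
proof -
  obtain a la where a: "a \<bullet> a = 1" "A *v a = la *\<^sub>R a"
    using symmetric_matrix_eigenvector[OF A subspace_UNIV, of "axis 1 1"] by auto
  have inv: "(A *v x) \<bullet> y = 0" if "A *v y = m *\<^sub>R y" "x \<bullet> y = 0" for x y m
    using symmetric_matrix_inner[OF A, of x y] that by simp
  obtain y :: "real^3" where y: "y \<noteq> 0" "orthogonal a y"
    using orthogonal_to_vector_exists[of a] by auto
  obtain b lb where b: "b \<in> {x. x \<bullet> a = 0}" "b \<bullet> b = 1" "A *v b = lb *\<^sub>R b"
  proof (rule symmetric_matrix_eigenvector[OF A])
    show "subspace {x. x \<bullet> a = 0}" by (simp add: subspace_def inner_add_left)
    show "A *v x \<in> {x. x \<bullet> a = 0}" if "x \<in> {x. x \<bullet> a = 0}" for x using that inv[OF a(2)] by simp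
    show "y \<in> {x. x \<bullet> a = 0}" using y by (simp add: orthogonal_def inner_commute)
  qed (use y in auto)
  have "norm (cross3 a b)^2 = 1" using norm_cross_dot[of a b] a b by (simp add: inner_commute norm_eq_1[symmetric])
  then have ab: "cross3 a b \<noteq> 0" by auto
  obtain c lc where c: "c \<in> {x. x \<bullet> a = 0 \<and> x \<bullet> b = 0}" "c \<bullet> c = 1" "A *v c = lc *\<^sub>R c"
  proof (rule symmetric_matrix_eigenvector[OF A])
    show "subspace {x. x \<bullet> a = 0 \<and> x \<bullet> b = 0}" by (simp add: subspace_def inner_add_left)
    show "A *v x \<in> {x. x \<bullet> a = 0 \<and> x \<bullet> b = 0}" if "x \<in> {x. x \<bullet> a = 0 \<and> x \<bullet> b = 0}" for x
      using that inv[OF a(2)] inv[OF b(3)] by simp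
    show "cross3 a b \<in> {x. x \<bullet> a = 0 \<and> x \<bullet> b = 0}" by (simp add: dot_cross_self)
  qed (use ab in auto)
  have "orthonormal_frame (frame3 a b c)"
    using a b c by (simp add: orthonormal_frame3 inner_commute)
  then show ?thesis using that a(2) b(3) c(3) by blast
qed

text \<open>Principal axes of a quadric, with the nonzero eigenvalues first; for a single nonzero
  eigenvalue the axes in the kernel are turned so that the linear part has no third component.\<close>

lemma principal_axes:
  fixes A :: "real^3^3" and d :: "real^3"
  assumes A: "transpose A = A" and nz: "A \<noteq> 0"
  obtains e l where "orthonormal_frame e" "\<forall>k. A *v e k = l k *\<^sub>R e k"
    "l 1 \<noteq> 0" "l 3 \<noteq> 0 \<longrightarrow> l 2 \<noteq> 0" "l 2 = 0 \<longrightarrow> d \<bullet> e 3 = 0"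
proof -
  obtain a b c la lb lc where abc: "orthonormal_frame (frame3 a b c)"
    "A *v a = la *\<^sub>R a" "A *v b = lb *\<^sub>R b" "A *v c = lc *\<^sub>R c"
    using symmetric_matrix_eigenframe[OF A] by metis
  have Ax: "A *v x = (la * (x \<bullet> a)) *\<^sub>R a + (lb * (x \<bullet> b)) *\<^sub>R b + (lc * (x \<bullet> c)) *\<^sub>R c" for x
  proof -
    have "A *v x = A *v ((x \<bullet> a) *\<^sub>R a + (x \<bullet> b) *\<^sub>R b + (x \<bullet> c) *\<^sub>R c)"
      using orthonormal_frame_expand[OF abc(1), of x] by (simp add: sum_3)
    then show ?thesis
      by (simp add: matrix_vector_right_distrib matrix_vector_mult_scaleR abc mult.commute)
  qed
  have "\<not> (la = 0 \<and> lb = 0 \<and> lc = 0)"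
  proof
    assume "la = 0 \<and> lb = 0 \<and> lc = 0"
    then have "A *v x = 0 *v x" for x using Ax by simp
    then show False using nz by (metis matrix_eq)
  qed
  then obtain a b c la lb lc where abc: "orthonormal_frame (frame3 a b c)"
    "A *v a = la *\<^sub>R a" "A *v b = lb *\<^sub>R b" "A *v c = lc *\<^sub>R c"
    and ord: "la \<noteq> 0" "lc \<noteq> 0 \<longrightarrow> lb \<noteq> 0"
  proof -
    note o = abc(1)[unfolded orthonormal_frame3]
    have perm: "orthonormal_frame (frame3 a b c)" "orthonormal_frame (frame3 a c b)"
      "orthonormal_frame (frame3 b c a)" "orthonormal_frame (frame3 c a b)"
      using o unfolding orthonormal_frame3 by (auto simp: inner_commute)
    assume "\<not> (la = 0 \<and> lb = 0 \<and> lc = 0)"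
    then consider "la \<noteq> 0" "lb \<noteq> 0 \<or> lc = 0" | "la \<noteq> 0" "lb = 0" "lc \<noteq> 0"
      | "la = 0" "lb \<noteq> 0" | "la = 0" "lb = 0" "lc \<noteq> 0" by blast
    then show ?thesis
    proof cases
      case 1 then show ?thesis using that[OF perm(1) abc(2,3,4)] by blast
    next
      case 2 then show ?thesis using that[OF perm(2) abc(2,4,3)] by blast
    next
      case 3 then show ?thesis using that[OF perm(3) abc(3,4,2)] by blast
    next
      case 4 then show ?thesis using that[OF perm(4) abc(4,2,3)] by blast
    qed
  qed
  have Ax: "A *v x = (la * (x \<bullet> a)) *\<^sub>R a + (lb * (x \<bullet> b)) *\<^sub>R b + (lc * (x \<bullet> c)) *\<^sub>R c" for x
  proof -
    have "A *v x = A *v ((x \<bullet> a) *\<^sub>R a + (x \<bullet> b) *\<^sub>R b + (x \<bullet> c) *\<^sub>R c)"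
      using orthonormal_frame_expand[OF abc(1), of x] by (simp add: sum_3)
    then show ?thesis
      by (simp add: matrix_vector_right_distrib matrix_vector_mult_scaleR abc mult.commute)
  qed
  show ?thesis
  proof (cases "lb = 0 \<and> cross3 a d \<noteq> 0")
    case False
    have dc: "d \<bullet> c = 0" if "lb = 0"
    proof -
      have "cross3 a d = 0" using False that by simp
      moreover have "cross3 a d \<bullet> cross3 a c = (a \<bullet> a) * (d \<bullet> c) - (a \<bullet> c) * (d \<bullet> a)"
        by (simp add: cross3_simps)
      ultimately show ?thesis using abc(1) by (simp add: orthonormal_frame3)
    qed
    have "A *v frame3 a b c k = frame3 la lb lc k *\<^sub>R frame3 a b c k" for k
      using abc(2-4) by (simp add: frame3_def)
    then show ?thesis using that[OF abc(1), of "frame3 la lb lc"] ord dc by simp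
  next
    case True
    define c' where "c' = cross3 a d /\<^sub>R norm (cross3 a d)"
    define b' where "b' = cross3 c' a"
    have aa: "a \<bullet> a = 1" using abc(1) by (simp add: orthonormal_frame3)
    have c': "c' \<bullet> c' = 1" "a \<bullet> c' = 0" "d \<bullet> c' = 0"
      using True by (simp_all add: c'_def dot_cross_self dot_square_norm power2_eq_square)
    have "b' \<bullet> b' = 1" using lagrange_cross[of c' a] c' aa by (simp add: b'_def inner_commute)
    then have fr: "orthonormal_frame (frame3 a b' c')"
      using c' aa by (simp add: orthonormal_frame3 b'_def dot_cross_self)
    have ker: "A *v x = 0" if "a \<bullet> x = 0" for x
      unfolding Ax using True ord that by (simp add: inner_commute)
    have "A *v frame3 a b' c' k = frame3 la 0 0 k *\<^sub>R frame3 a b' c' k" for k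
      using abc(2) ker[of b'] ker[of c'] c' by (simp add: frame3_def b'_def dot_cross_self)
    then show ?thesis using that[OF fr, of "frame3 la 0 0"] ord c' by simp
  qed
qed

section \<open>A polynomial identity\<close>

text \<open>A polynomial function that vanishes near a point vanishes everywhere, by restriction to lines.\<close>

lemma real_polynomial_function_zero_extension:
  fixes f :: "'a::real_normed_vector \<Rightarrow> real"
  assumes f: "real_polynomial_function f" and z: "\<forall>\<^sub>F x in nhds x0. f x = 0"
  shows "f y = 0"
proof -
  have line: "real_polynomial_function (\<lambda>t::real. f (x0 + t *\<^sub>R (y - x0)))"
    using f
  proof induction
    case (linear f)
    interpret bounded_linear f by fact
    have "real_polynomial_function (\<lambda>t. f x0 + t * f (y - x0))"
      by (intro real_polynomial_function.intros bounded_linear_ident)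
    then show ?case by (simp add: add scaleR)
  qed auto
  then obtain a n where an: "\<And>t. f (x0 + t *\<^sub>R (y - x0)) = (\<Sum>i\<le>n. a i * t ^ i)"
    unfolding real_polynomial_function_iff_sum by (meson fun_cong)
  have "\<forall>\<^sub>F t in nhds (0::real). f (x0 + t *\<^sub>R (y - x0)) = 0"
    using z tendsto_line_at_0[of x0 "y - x0"] by (auto simp: filterlim_iff)
  then obtain d where d: "d > 0" "\<And>t. dist t 0 < d \<Longrightarrow> f (x0 + t *\<^sub>R (y - x0)) = 0"
    unfolding eventually_nhds_metric by auto
  have "{0<..<d} \<subseteq> {t. (\<Sum>i\<le>n. a i * t ^ i) = 0}" using d(2) an by auto
  moreover have "infinite {0<..<d}" using d(1) by simp
  ultimately have "infinite {t. (\<Sum>i\<le>n. a i * t ^ i) = 0}" using finite_subset by blast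
  then have "\<forall>k\<le>n. a k = 0" using polyfun_finite_roots[where n = n and c = a] by blast
  then have "(\<Sum>i\<le>n. a i * 1 ^ i) = 0" by simp
  then show ?thesis using an[of 1] by simp
qed

text \<open>In terms of \<open>X = t\<^sup>2\<close>, the assumption (averaged over \<open>t\<close> and \<open>-t\<close>, with \<open>s = 1\<close>) is an identity of
  cubic polynomials whose left-hand side vanishes at \<open>X = -1\<close>. The values at \<open>X = 0, 1, 4, 9\<close>
  determine the one at \<open>-1\<close>.\<close>

lemma two_variable_identity:
  fixes a b S \<alpha> \<beta> \<gamma> \<kappa> \<mu> :: real
  assumes "\<And>s t. (\<alpha> * s\<^sup>2 + \<beta> * s * t + \<gamma> * t\<^sup>2) * (s\<^sup>2 + t\<^sup>2)\<^sup>2 =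
     4 * (S * (s\<^sup>2 + t\<^sup>2)\<^sup>2 - 2 * (s\<^sup>2 + t\<^sup>2) * ((a * s)\<^sup>2 + (b * t)\<^sup>2) + (a * s\<^sup>2 + b * t\<^sup>2)\<^sup>2) * (\<kappa> * s\<^sup>2 + \<mu> * t\<^sup>2)"
  shows "\<kappa> = \<mu> \<or> a = b"
proof -
  have avg: "(\<alpha> + \<gamma> * t\<^sup>2) * (1 + t\<^sup>2)\<^sup>2 =
     4 * (S * (1 + t\<^sup>2)\<^sup>2 - 2 * (1 + t\<^sup>2) * (a\<^sup>2 + b\<^sup>2 * t\<^sup>2) + (a + b * t\<^sup>2)\<^sup>2) * (\<kappa> + \<mu> * t\<^sup>2)"
    (is "_ = ?R") for t
  proof -
    have 1: "(\<alpha> + \<beta> * t + \<gamma> * t\<^sup>2) * (1 + t\<^sup>2)\<^sup>2 = ?R" "(\<alpha> - \<beta> * t + \<gamma> * t\<^sup>2) * (1 + t\<^sup>2)\<^sup>2 = ?R"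
      using assms[of 1 t] assms[of 1 "-t"] by (simp_all add: power_mult_distrib)
    have "(\<alpha> + \<gamma> * t\<^sup>2) * (1 + t\<^sup>2)\<^sup>2
        = ((\<alpha> + \<beta> * t + \<gamma> * t\<^sup>2) * (1 + t\<^sup>2)\<^sup>2 + (\<alpha> - \<beta> * t + \<gamma> * t\<^sup>2) * (1 + t\<^sup>2)\<^sup>2) / 2"
      by algebra
    then show ?thesis using 1 by simp
  qed
  have "(\<kappa> - \<mu>) * (a - b)\<^sup>2 = 0"
    using avg[of 0] avg[of 1] avg[of 2] avg[of 3]
    by (simp add: power2_eq_square algebra_simps)
  then show ?thesis by simp
qed

section \<open>Classification in principal coordinates\<close>

text \<open>The normal component of \<open>\<Delta> G = M G\<close> in the coordinates \<open>y\<close> of the gradient along the principal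
  axes: its left-hand side is a quadratic form, with matrix \<open>\<mu>\<close>, times \<open>(y \<bullet> y)\<^sup>2\<close>.\<close>

definition matrix_form :: "(3 \<Rightarrow> 3 \<Rightarrow> real) \<Rightarrow> real^3 \<Rightarrow> real" where
  "matrix_form \<mu> y = (\<Sum>i\<in>UNIV. \<Sum>j\<in>UNIV. \<mu> i j * y $ i * y $ j)"

text \<open>Its right-hand side is a quartic form in \<open>y\<close>. It is nonnegative, and positive
  for \<open>y \<noteq> 0\<close> if no eigenvalue vanishes.\<close>

definition curvature_form :: "(3 \<Rightarrow> real) \<Rightarrow> real^3 \<Rightarrow> real" where
  "curvature_form l y = 4 * ((\<Sum>k\<in>UNIV. (l k)\<^sup>2) * (y \<bullet> y)\<^sup>2 - 2 * (y \<bullet> y) * (\<Sum>k\<in>UNIV. (l k * y $ k)\<^sup>2)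
     + (\<Sum>k\<in>UNIV. l k * (y $ k)\<^sup>2)\<^sup>2)"

lemma matrix_form_scaleR: "matrix_form \<mu> (s *\<^sub>R y) = s\<^sup>2 * matrix_form \<mu> y"
  by (simp add: matrix_form_def sum_distrib_left power2_eq_square mult_ac)

lemma curvature_form_scaleR: "curvature_form l (s *\<^sub>R y) = s ^ 4 * curvature_form l y"
proof -
  have "(\<Sum>k\<in>UNIV. (l k * (s *\<^sub>R y) $ k)\<^sup>2) = s\<^sup>2 * (\<Sum>k\<in>UNIV. (l k * y $ k)\<^sup>2)"
    "(\<Sum>k\<in>UNIV. l k * ((s *\<^sub>R y) $ k)\<^sup>2) = s\<^sup>2 * (\<Sum>k\<in>UNIV. l k * (y $ k)\<^sup>2)"
    by (simp_all add: sum_distrib_left power2_eq_square mult_ac)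
  moreover have "(s *\<^sub>R y) \<bullet> (s *\<^sub>R y) = s\<^sup>2 * (y \<bullet> y)" by (simp add: power2_eq_square)
  ultimately show ?thesis
    unfolding curvature_form_def by (simp add: power_mult_distrib algebra_simps power2_eq_square power4_eq_xxxx)
qed

text \<open>Up to the factor \<open>4\<close>, these are the squared entries of \<open>Y D Y\<^sup>T\<close>, where \<open>D\<close> is diagonal with entries
  \<open>l\<close> and \<open>Y\<close> is the matrix of the cross product with \<open>y\<close>.\<close>

lemma curvature_form_sum_squares:
  "curvature_form l y = 4 * ((l 1 * (y $ 2)\<^sup>2 + l 2 * (y $ 1)\<^sup>2)\<^sup>2 + (l 1 * (y $ 3)\<^sup>2 + l 3 * (y $ 1)\<^sup>2)\<^sup>2
     + (l 2 * (y $ 3)\<^sup>2 + l 3 * (y $ 2)\<^sup>2)\<^sup>2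
     + 2 * (l 1 * y $ 2 * y $ 3)\<^sup>2 + 2 * (l 2 * y $ 1 * y $ 3)\<^sup>2 + 2 * (l 3 * y $ 1 * y $ 2)\<^sup>2)"
  unfolding curvature_form_def inner_vec_def sum_3 inner_real_def by algebra

lemma curvature_form_zero:
  assumes "curvature_form l y = 0" "l 1 \<noteq> 0" "l 2 \<noteq> 0" "l 3 \<noteq> 0"
  shows "y = 0"
proof -
  have "a = 0 \<and> b = 0 \<and> c = 0 \<and> d = 0 \<and> e = 0 \<and> f = 0"
    if "0 \<le> a" "0 \<le> b" "0 \<le> c" "0 \<le> d" "0 \<le> e" "0 \<le> f" "4 * (a + b + c + 2 * d + 2 * e + 2 * f) = 0"
    for a b c d e f :: real
  proof -
    have "a + b + c + 2 * d + 2 * e + 2 * f = 0" using that(7) by simp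
    with that(1-6) show ?thesis by linarith
  qed
  from this[OF zero_le_power2 zero_le_power2 zero_le_power2 zero_le_power2 zero_le_power2 zero_le_power2
      assms(1)[unfolded curvature_form_sum_squares]]
  have "(l 1 * (y $ 2)\<^sup>2 + l 2 * (y $ 1)\<^sup>2)\<^sup>2 = 0 \<and> (l 1 * (y $ 3)\<^sup>2 + l 3 * (y $ 1)\<^sup>2)\<^sup>2 = 0 \<and>
     (l 1 * y $ 2 * y $ 3)\<^sup>2 = 0 \<and> (l 2 * y $ 1 * y $ 3)\<^sup>2 = 0 \<and> (l 3 * y $ 1 * y $ 2)\<^sup>2 = 0" by blast
  then have "y $ 1 = 0" "y $ 2 = 0" "y $ 3 = 0" using assms(2-4) by auto
  then show ?thesis by (simp add: vec_eq_iff forall_3)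
qed

lemma sum_two_indices:
  fixes F :: "'n::finite \<Rightarrow> real"
  assumes "i \<noteq> j" "\<And>k. k \<noteq> i \<Longrightarrow> k \<noteq> j \<Longrightarrow> F k = 0"
  shows "sum F UNIV = F i + F j"
proof -
  have "sum F UNIV = sum F {i, j}" by (rule sum.mono_neutral_right) (use assms in auto)
  then show ?thesis using assms(1) by simp
qed

text \<open>Suppose that the equation holds for the vectors \<open>y\<close> near \<open>y0\<close> with \<open>\<kappa>(y) = 1\<close> in a coordinate
  subspace, where \<open>\<kappa>\<close> is a diagonal quadratic form. After multiplying the right-hand side by \<open>\<kappa>\<close> both
  sides are homogeneous of degree six. The equation then holds on an open set of the subspace, hence
  on all of it.\<close>

lemma homogenized_equation:
  fixes y0 :: "real^3"
  assumes \<kappa>0: "(\<Sum>k\<in>UNIV. \<kappa> k * (y0 $ k)\<^sup>2) = 1" and V: "\<And>k. k \<notin> V \<Longrightarrow> y0 $ k = 0"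
    and ev: "\<forall>\<^sub>F y in nhds y0. (\<forall>k. k \<notin> V \<longrightarrow> y $ k = 0) \<longrightarrow> (\<Sum>k\<in>UNIV. \<kappa> k * (y $ k)\<^sup>2) = 1
       \<longrightarrow> matrix_form \<mu> y * (y \<bullet> y)\<^sup>2 = curvature_form l y"
    and ij: "i \<in> V" "j \<in> V" "i \<noteq> j"
  shows "\<kappa> i = \<kappa> j \<or> l i = l j"
proof -
  \<comment> \<open>\<open>T\<close> projects to the coordinate subspace and rescales to \<open>\<kappa> = 1\<close>; it fixes \<open>y0\<close>\<close>
  define \<pi> :: "real^3 \<Rightarrow> real^3" where "\<pi> y = (\<chi> k. if k \<in> V then y $ k else 0)" for y
  define K where "K y = (\<Sum>k\<in>UNIV. \<kappa> k * (\<pi> y $ k)\<^sup>2)" for y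
  define T where "T y = (1 / sqrt (K y)) *\<^sub>R \<pi> y" for y
  have \<pi>0: "\<pi> y0 = y0" using V by (auto simp: \<pi>_def vec_eq_iff)
  have K0: "K y0 = 1" using \<kappa>0 by (simp add: K_def \<pi>0)
  have nth: "isCont (\<lambda>y. \<pi> y $ k) y" for k y
    by (cases "k \<in> V") (simp_all add: \<pi>_def)
  have cont\<pi>: "isCont \<pi> y" for y
    using nth unfolding isCont_def by (intro vec_tendstoI) auto
  have contK: "isCont K y" for y unfolding K_def by (intro continuous_intros nth)
  have contT: "isCont T y0" unfolding T_def by (intro continuous_intros contK cont\<pi>) (simp add: K0)
  have T0: "T y0 = y0" by (simp add: T_def K0 \<pi>0)
  have "(T \<longlongrightarrow> y0) (nhds y0)" using contT T0 tendsto_at_iff_tendsto_nhds[of T y0] by (simp add: isCont_def)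
  then have evT: "\<forall>\<^sub>F y in nhds y0. (\<forall>k. k \<notin> V \<longrightarrow> T y $ k = 0) \<longrightarrow> (\<Sum>k\<in>UNIV. \<kappa> k * (T y $ k)\<^sup>2) = 1
       \<longrightarrow> matrix_form \<mu> (T y) * (T y \<bullet> T y)\<^sup>2 = curvature_form l (T y)"
    using ev by (auto simp: filterlim_iff)
  have "(K \<longlongrightarrow> 1) (nhds y0)" using contK[of y0] K0 tendsto_at_iff_tendsto_nhds[of K y0] by (simp add: isCont_def)
  then have evK: "\<forall>\<^sub>F y in nhds y0. K y > 0" by (rule order_tendstoD(1)) simp
  define f where "f y = matrix_form \<mu> (\<pi> y) * (\<pi> y \<bullet> \<pi> y)\<^sup>2 - curvature_form l (\<pi> y) * K y" for y
  have "\<forall>\<^sub>F y in nhds y0. f y = 0"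
    using evT evK
  proof eventually_elim
    case (elim y)
    define s where "s = 1 / sqrt (K y)"
    have s: "s\<^sup>2 * K y = 1" "s \<noteq> 0" using elim(2) by (simp_all add: s_def power_divide)
    have Ty: "T y = s *\<^sub>R \<pi> y" by (simp add: T_def s_def)
    have "(\<Sum>k\<in>UNIV. \<kappa> k * (T y $ k)\<^sup>2) = s\<^sup>2 * K y"
      by (simp add: Ty K_def sum_distrib_left power_mult_distrib mult_ac)
    moreover have "\<forall>k. k \<notin> V \<longrightarrow> T y $ k = 0" by (simp add: T_def \<pi>_def)
    ultimately have "matrix_form \<mu> (T y) * (T y \<bullet> T y)\<^sup>2 = curvature_form l (T y)" using elim(1) s(1) by simp
    moreover have "T y \<bullet> T y = s\<^sup>2 * (\<pi> y \<bullet> \<pi> y)" by (simp add: Ty power2_eq_square)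
    ultimately have "s\<^sup>2 * matrix_form \<mu> (\<pi> y) * (s\<^sup>2 * (\<pi> y \<bullet> \<pi> y))\<^sup>2 = s ^ 4 * curvature_form l (\<pi> y)"
      by (metis Ty matrix_form_scaleR curvature_form_scaleR)
    then have "s ^ 4 * (s\<^sup>2 * (matrix_form \<mu> (\<pi> y) * (\<pi> y \<bullet> \<pi> y)\<^sup>2) - curvature_form l (\<pi> y)) = 0" by algebra
    then have eq: "curvature_form l (\<pi> y) = s\<^sup>2 * (matrix_form \<mu> (\<pi> y) * (\<pi> y \<bullet> \<pi> y)\<^sup>2)" using s(2) by simp
    have "curvature_form l (\<pi> y) * K y = (s\<^sup>2 * K y) * (matrix_form \<mu> (\<pi> y) * (\<pi> y \<bullet> \<pi> y)\<^sup>2)"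
      unfolding eq by (simp only: mult_ac)
    then show "f y = 0" unfolding f_def s(1) by simp
  qed
  moreover have "real_polynomial_function f"
  proof -
    have 1: "real_polynomial_function (\<lambda>y. \<pi> y $ k)" for k
      by (cases "k \<in> V") (auto simp: \<pi>_def intro: bounded_linear_vec_nth)
    show ?thesis
      unfolding f_def K_def matrix_form_def curvature_form_def inner_vec_def inner_real_def
      by (intro real_polynomial_function_diff real_polynomial_function.intros(2-4) real_polynomial_function_power
          real_polynomial_function_sum 1 finite)
  qed
  ultimately have f0: "f y = 0" for y by (rule real_polynomial_function_zero_extension[rotated])
  define \<alpha> \<beta> \<gamma> S where "\<alpha> = \<mu> i i" and "\<beta> = \<mu> i j + \<mu> j i" and "\<gamma> = \<mu> j j" and "S = (\<Sum>k\<in>UNIV. (l k)\<^sup>2)"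
  have "(\<alpha> * s\<^sup>2 + \<beta> * s * t + \<gamma> * t\<^sup>2) * (s\<^sup>2 + t\<^sup>2)\<^sup>2 =
     4 * (S * (s\<^sup>2 + t\<^sup>2)\<^sup>2 - 2 * (s\<^sup>2 + t\<^sup>2) * ((l i * s)\<^sup>2 + (l j * t)\<^sup>2) + (l i * s\<^sup>2 + l j * t\<^sup>2)\<^sup>2) * (\<kappa> i * s\<^sup>2 + \<kappa> j * t\<^sup>2)" for s t
  proof -
    define y :: "real^3" where "y = (\<chi> k. if k = i then s else if k = j then t else 0)"
    have y: "y $ i = s" "y $ j = t" "\<And>k. k \<noteq> i \<Longrightarrow> k \<noteq> j \<Longrightarrow> y $ k = 0" using ij by (auto simp: y_def)
    have \<pi>y: "\<pi> y = y" using ij by (auto simp: \<pi>_def y_def vec_eq_iff)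
    note two = sum_two_indices[OF ij(3)]
    have "matrix_form \<mu> y = \<alpha> * s\<^sup>2 + \<beta> * s * t + \<gamma> * t\<^sup>2"
    proof -
      have "(\<Sum>m\<in>UNIV. \<mu> k m * y $ k * y $ m) = \<mu> k i * y $ k * s + \<mu> k j * y $ k * t" for k
        by (subst two) (auto simp: y)
      then show ?thesis unfolding matrix_form_def
        by simp (subst two, auto simp: y \<alpha>_def \<beta>_def \<gamma>_def power2_eq_square algebra_simps)
    qed
    moreover have "y \<bullet> y = s\<^sup>2 + t\<^sup>2" unfolding inner_vec_def by (subst two) (auto simp: y power2_eq_square)
    moreover have "(\<Sum>k\<in>UNIV. (l k * y $ k)\<^sup>2) = (l i * s)\<^sup>2 + (l j * t)\<^sup>2" by (subst two) (auto simp: y)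
    moreover have "(\<Sum>k\<in>UNIV. l k * (y $ k)\<^sup>2) = l i * s\<^sup>2 + l j * t\<^sup>2" by (subst two) (auto simp: y)
    moreover have "K y = \<kappa> i * s\<^sup>2 + \<kappa> j * t\<^sup>2" unfolding K_def \<pi>y by (subst two) (auto simp: y)
    ultimately show ?thesis using f0[of y] unfolding f_def \<pi>y curvature_form_def S_def by simp
  qed
  from two_variable_identity[OF this] show ?thesis .
qed

lemma isCont_frame3:
  fixes a b c :: "'a::t2_space \<Rightarrow> real"
  assumes "isCont a y" "isCont b y" "isCont c y"
  shows "isCont (\<lambda>y. \<chi> k. frame3 (a y) (b y) (c y) k) y"
  using assms unfolding isCont_def by (intro vec_tendstoI) (simp add: frame3_def)

text \<open>The quadratic polynomial in the coordinates \<open>z\<close> along the principal axes.\<close>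

definition diagonal_quadric :: "(3 \<Rightarrow> real) \<Rightarrow> (3 \<Rightarrow> real) \<Rightarrow> real \<Rightarrow> real^3 \<Rightarrow> real" where
  "diagonal_quadric l \<beta> c z = (\<Sum>k\<in>UNIV. l k * (z $ k)\<^sup>2 + \<beta> k * z $ k) + c"

text \<open>The gradient of \<open>diagonal_quadric l \<beta> c\<close>.\<close>

definition diagonal_gradient :: "(3 \<Rightarrow> real) \<Rightarrow> (3 \<Rightarrow> real) \<Rightarrow> real^3 \<Rightarrow> real^3" where
  "diagonal_gradient l \<beta> z = (\<chi> k. 2 * l k * z $ k + \<beta> k)"

text \<open>A local inverse \<open>\<zeta>\<close> of the gradient on the quadric transports the equation to gradient space.\<close>

lemma equation_in_gradient_space:
  assumes ev: "\<forall>\<^sub>F z in nhds z0. diagonal_quadric l \<beta> c z = 0 \<longrightarrow> diagonal_gradient l \<beta> z \<noteq> 0 \<longrightarrow>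
       matrix_form \<mu> (diagonal_gradient l \<beta> z) * (diagonal_gradient l \<beta> z \<bullet> diagonal_gradient l \<beta> z)\<^sup>2
         = curvature_form l (diagonal_gradient l \<beta> z)"
    and y0: "y0 = diagonal_gradient l \<beta> z0" "y0 \<noteq> 0"
    and \<zeta>: "isCont \<zeta> y0" "\<zeta> y0 = z0"
    and inv: "\<forall>\<^sub>F y in nhds y0. (\<forall>k. k \<notin> V \<longrightarrow> y $ k = 0) \<longrightarrow> (\<Sum>k\<in>UNIV. \<kappa> k * (y $ k)\<^sup>2) = 1
       \<longrightarrow> diagonal_quadric l \<beta> c (\<zeta> y) = 0 \<and> diagonal_gradient l \<beta> (\<zeta> y) = y"
    and \<kappa>0: "(\<Sum>k\<in>UNIV. \<kappa> k * (y0 $ k)\<^sup>2) = 1" and V: "\<And>k. k \<notin> V \<Longrightarrow> y0 $ k = 0"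
    and ij: "i \<in> V" "j \<in> V" "i \<noteq> j"
  shows "\<kappa> i = \<kappa> j \<or> l i = l j"
proof (rule homogenized_equation[OF \<kappa>0 V _ ij])
  have "(\<zeta> \<longlongrightarrow> z0) (nhds y0)" using \<zeta> tendsto_at_iff_tendsto_nhds[of \<zeta> y0] by (simp add: isCont_def)
  then have "\<forall>\<^sub>F y in nhds y0. diagonal_quadric l \<beta> c (\<zeta> y) = 0 \<longrightarrow> diagonal_gradient l \<beta> (\<zeta> y) \<noteq> 0 \<longrightarrow>
       matrix_form \<mu> (diagonal_gradient l \<beta> (\<zeta> y)) * (diagonal_gradient l \<beta> (\<zeta> y) \<bullet> diagonal_gradient l \<beta> (\<zeta> y))\<^sup>2
         = curvature_form l (diagonal_gradient l \<beta> (\<zeta> y))"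
    using ev by (auto simp: filterlim_iff)
  moreover have "\<forall>\<^sub>F y in nhds y0. y \<in> - {0}" using y0(2) by (intro eventually_nhds_in_open) auto
  ultimately show "\<forall>\<^sub>F y in nhds y0. (\<forall>k. k \<notin> V \<longrightarrow> y $ k = 0) \<longrightarrow> (\<Sum>k\<in>UNIV. \<kappa> k * (y $ k)\<^sup>2) = 1
       \<longrightarrow> matrix_form \<mu> y * (y \<bullet> y)\<^sup>2 = curvature_form l y"
    using inv by eventually_elim auto
qed

text \<open>The conclusion lists the sphere, the circular cylinder, the pairs of crossing planes, and the pairs
  of parallel planes. Except on these pairs and on the cone, \<open>\<zeta>\<close> recovers a point of the quadric near
  \<open>z0\<close> from its gradient, and the form \<open>\<kappa>\<close> describes which gradients occur.\<close>

lemma diagonal_quadric_classification: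
  assumes ev: "\<forall>\<^sub>F z in nhds z0. diagonal_quadric l \<beta> c z = 0 \<longrightarrow> diagonal_gradient l \<beta> z \<noteq> 0 \<longrightarrow>
       matrix_form \<mu> (diagonal_gradient l \<beta> z) * (diagonal_gradient l \<beta> z \<bullet> diagonal_gradient l \<beta> z)\<^sup>2
         = curvature_form l (diagonal_gradient l \<beta> z)"
    and z0: "diagonal_quadric l \<beta> c z0 = 0" and regular: "diagonal_gradient l \<beta> z0 \<noteq> 0"
    and l1: "l 1 \<noteq> 0" and l32: "l 3 \<noteq> 0 \<Longrightarrow> l 2 \<noteq> 0" and \<beta>3: "l 2 = 0 \<Longrightarrow> \<beta> 3 = 0"
  shows "(l 2 = l 1 \<and> l 3 = l 1) \<or> (l 2 = l 1 \<and> l 3 = 0 \<and> \<beta> 3 = 0)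
     \<or> (l 2 \<noteq> 0 \<and> l 3 = 0 \<and> \<beta> 3 = 0 \<and> (\<beta> 1)\<^sup>2 / (4 * l 1) + (\<beta> 2)\<^sup>2 / (4 * l 2) = c)
     \<or> (l 2 = 0 \<and> l 3 = 0 \<and> \<beta> 2 = 0 \<and> \<beta> 3 = 0)"
proof -
  define y0 where "y0 = diagonal_gradient l \<beta> z0"
  have y0k: "y0 $ k = 2 * l k * z0 $ k + \<beta> k" for k by (simp add: y0_def diagonal_gradient_def)
  have y0: "y0 \<noteq> 0" using regular by (simp add: y0_def)
  note key = equation_in_gradient_space[OF ev y0_def y0]
  \<comment> \<open>completing the square\<close>
  have sq: "l k * x\<^sup>2 + \<beta> k * x = (2 * l k * x + \<beta> k)\<^sup>2 / (4 * l k) - (\<beta> k)\<^sup>2 / (4 * l k)" if "l k \<noteq> 0" for k x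
    using that by (simp add: power2_eq_square field_simps)
  have inv: "2 * l k * ((y - \<beta> k) / (2 * l k)) + \<beta> k = y" if "l k \<noteq> 0" for k y using that by simp
  have z0k: "(y0 $ k - \<beta> k) / (2 * l k) = z0 $ k" if "l k \<noteq> 0" for k using that by (simp add: y0k)
  have cont: "isCont (\<lambda>y. (y $ k - \<beta> k) / (2 * l k)) y" for k and y :: "real^3"
    by (cases "l k = 0") (auto intro!: continuous_intros)
  show ?thesis
  proof (cases "l 2 = 0")
    case True
    then have l3: "l 3 = 0" and \<beta>3: "\<beta> 3 = 0" using l32 \<beta>3 by auto
    have "\<beta> 2 = 0"
    proof (rule ccontr)
      assume \<beta>2: "\<beta> 2 \<noteq> 0"
      define x where "x y = (y $ 1 - \<beta> 1) / (2 * l 1)" for y :: "real^3"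
      define \<zeta> :: "real^3 \<Rightarrow> real^3" where "\<zeta> y = (\<chi> k. frame3 (x y) (- (l 1 * (x y)\<^sup>2 + \<beta> 1 * x y + c) / \<beta> 2) (z0 $ 3) k)" for y
      have x: "2 * l 1 * x y + \<beta> 1 = y $ 1" for y using inv l1 by (simp add: x_def)
      have "l 1 * (z0 $ 1)\<^sup>2 + \<beta> 1 * z0 $ 1 + c = - \<beta> 2 * z0 $ 2"
        using z0 by (simp add: diagonal_quadric_def sum_3 True l3 \<beta>3)
      then have 2: "\<zeta> y0 = z0"
        using z0k[OF l1] \<beta>2 by (simp add: \<zeta>_def vec_eq_iff forall_3 x_def)
      have contx: "isCont x y" for y unfolding x_def by (rule cont)
      have 1: "isCont \<zeta> y0" unfolding \<zeta>_def using \<beta>2 by (intro isCont_frame3 continuous_intros contx) auto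
      have "y0 $ 2 * \<beta> 2 > 0" using \<beta>2 by (simp add: y0k True flip: power2_eq_square)
      moreover have "isCont (\<lambda>y::real^3. y $ 2 * \<beta> 2) y0" by (intro continuous_intros)
      then have "((\<lambda>y::real^3. y $ 2 * \<beta> 2) \<longlongrightarrow> y0 $ 2 * \<beta> 2) (nhds y0)"
        using tendsto_at_iff_tendsto_nhds[of "\<lambda>y::real^3. y $ 2 * \<beta> 2" y0] by (simp add: isCont_def)
      ultimately have "\<forall>\<^sub>F y in nhds y0. y $ 2 * \<beta> 2 > 0" by (auto dest: order_tendstoD)
      then have 3: "\<forall>\<^sub>F y in nhds y0. (\<forall>k. k \<notin> {1, 2} \<longrightarrow> y $ k = 0) \<longrightarrow> (\<Sum>k\<in>UNIV. frame3 0 (1 / (\<beta> 2)\<^sup>2) 0 k * (y $ k)\<^sup>2) = 1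
         \<longrightarrow> diagonal_quadric l \<beta> c (\<zeta> y) = 0 \<and> diagonal_gradient l \<beta> (\<zeta> y) = y"
      proof eventually_elim
        case (elim y)
        have "y $ 2 = \<beta> 2" if "(y $ 2)\<^sup>2 / (\<beta> 2)\<^sup>2 = 1"
        proof -
          have "(y $ 2)\<^sup>2 = (\<beta> 2)\<^sup>2" using that \<beta>2 by simp
          then have "y $ 2 = \<beta> 2 \<or> y $ 2 = - \<beta> 2" by (simp add: power2_eq_iff)
          then show ?thesis using elim by (auto simp: mult_less_0_iff not_less)
        qed
        then show ?case using x[of y] \<beta>2
          by (auto simp: sum_3 diagonal_quadric_def diagonal_gradient_def \<zeta>_def True l3 \<beta>3 vec_eq_iff forall_3)
      qed
      have "frame3 0 (1 / (\<beta> 2)\<^sup>2) 0 (1::3) = frame3 0 (1 / (\<beta> 2)\<^sup>2) 0 2 \<or> l 1 = l 2"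
      proof (rule key[OF 1 2 3])
        show "(\<Sum>k\<in>UNIV. frame3 0 (1 / (\<beta> 2)\<^sup>2) 0 k * (y0 $ k)\<^sup>2) = 1" using \<beta>2 by (simp add: sum_3 y0k True)
        show "y0 $ k = 0" if "k \<notin> {1, 2}" for k using that exhaust_3[of k] by (auto simp: y0k l3 \<beta>3)
      qed auto
      then show False using \<beta>2 l1 True by simp
    qed
    then show ?thesis using True l3 \<beta>3 by simp
  next
    case l2: False
    show ?thesis
    proof (cases "l 3 = 0")
      case l3: True
      show ?thesis
      proof (cases "\<beta> 3 = 0")
        case \<beta>3: True
        define C where "C = (\<beta> 1)\<^sup>2 / (4 * l 1) + (\<beta> 2)\<^sup>2 / (4 * l 2) - c"
        show ?thesis
        proof (cases "C = 0")
          case True then show ?thesis using l2 l3 \<beta>3 by (simp add: C_def)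
        next
          case C: False
          define \<kappa> where "\<kappa> = frame3 (1 / (4 * l 1 * C)) (1 / (4 * l 2 * C)) 0"
          define \<zeta> :: "real^3 \<Rightarrow> real^3" where "\<zeta> y = (\<chi> k. frame3 ((y $ 1 - \<beta> 1) / (2 * l 1)) ((y $ 2 - \<beta> 2) / (2 * l 2)) (z0 $ 3) k)" for y
          have eq: "diagonal_quadric l \<beta> c z = ((\<Sum>k\<in>UNIV. \<kappa> k * (diagonal_gradient l \<beta> z $ k)\<^sup>2) - 1) * C" for z
            unfolding diagonal_quadric_def sum_3 sq[OF l1] sq[OF l2] using C
            by (simp add: l3 \<beta>3 \<kappa>_def diagonal_gradient_def C_def[symmetric] algebra_simps)
               (simp add: C_def)
          have 1: "isCont \<zeta> y0" unfolding \<zeta>_def by (intro isCont_frame3 cont continuous_const)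
          have 2: "\<zeta> y0 = z0" using z0k[OF l1] z0k[OF l2] by (simp add: \<zeta>_def vec_eq_iff forall_3)
          have 3: "\<forall>\<^sub>F y in nhds y0. (\<forall>k. k \<notin> {1, 2} \<longrightarrow> y $ k = 0) \<longrightarrow> (\<Sum>k\<in>UNIV. \<kappa> k * (y $ k)\<^sup>2) = 1
             \<longrightarrow> diagonal_quadric l \<beta> c (\<zeta> y) = 0 \<and> diagonal_gradient l \<beta> (\<zeta> y) = y"
          proof (rule always_eventually, intro allI impI)
            fix y :: "real^3" assume y: "\<forall>k. k \<notin> {1, 2} \<longrightarrow> y $ k = 0" "(\<Sum>k\<in>UNIV. \<kappa> k * (y $ k)\<^sup>2) = 1"
            have "diagonal_gradient l \<beta> (\<zeta> y) = y"
              using y(1) l1 l2 by (simp add: diagonal_gradient_def \<zeta>_def vec_eq_iff forall_3 l3 \<beta>3)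
            then show "diagonal_quadric l \<beta> c (\<zeta> y) = 0 \<and> diagonal_gradient l \<beta> (\<zeta> y) = y"
              using y(2) by (simp add: eq)
          qed
          have "\<kappa> 1 = \<kappa> 2 \<or> l 1 = l 2"
          proof (rule key[OF 1 2 3])
            show "(\<Sum>k\<in>UNIV. \<kappa> k * (y0 $ k)\<^sup>2) = 1" using eq[of z0] z0 C by (simp add: y0_def)
            show "y0 $ k = 0" if "k \<notin> {1, 2}" for k using that exhaust_3[of k] by (auto simp: y0k l3 \<beta>3)
          qed auto
          then have "l 1 = l 2" using C l1 l2 by (auto simp: \<kappa>_def)
          then show ?thesis using l3 \<beta>3 by simp
        qed
      next
        case \<beta>3: False
        define x1 where "x1 y = (y $ 1 - \<beta> 1) / (2 * l 1)" for y :: "real^3"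
        define x2 where "x2 y = (y $ 2 - \<beta> 2) / (2 * l 2)" for y :: "real^3"
        define \<zeta> :: "real^3 \<Rightarrow> real^3" where "\<zeta> y = (\<chi> k. frame3 (x1 y) (x2 y)
           (- (l 1 * (x1 y)\<^sup>2 + \<beta> 1 * x1 y + l 2 * (x2 y)\<^sup>2 + \<beta> 2 * x2 y + c) / \<beta> 3) k)" for y
        have x: "2 * l 1 * x1 y + \<beta> 1 = y $ 1" "2 * l 2 * x2 y + \<beta> 2 = y $ 2" for y
          using inv l1 l2 by (simp_all add: x1_def x2_def)
        have "l 1 * (z0 $ 1)\<^sup>2 + \<beta> 1 * z0 $ 1 + l 2 * (z0 $ 2)\<^sup>2 + \<beta> 2 * z0 $ 2 + c = - \<beta> 3 * z0 $ 3"
          using z0 by (simp add: diagonal_quadric_def sum_3 l3)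
        then have 2: "\<zeta> y0 = z0"
          using z0k[OF l1] z0k[OF l2] \<beta>3 by (simp add: \<zeta>_def vec_eq_iff forall_3 x1_def x2_def)
        have contx: "isCont x1 y" "isCont x2 y" for y unfolding x1_def x2_def by (rule cont)+
        have 1: "isCont \<zeta> y0" unfolding \<zeta>_def using \<beta>3 by (intro isCont_frame3 continuous_intros contx) auto
        have "y0 $ 3 * \<beta> 3 > 0" using \<beta>3 by (simp add: y0k l3 flip: power2_eq_square)
        moreover have "isCont (\<lambda>y::real^3. y $ 3 * \<beta> 3) y0" by (intro continuous_intros)
        then have "((\<lambda>y::real^3. y $ 3 * \<beta> 3) \<longlongrightarrow> y0 $ 3 * \<beta> 3) (nhds y0)"
          using tendsto_at_iff_tendsto_nhds[of "\<lambda>y::real^3. y $ 3 * \<beta> 3" y0] by (simp add: isCont_def)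
        ultimately have "\<forall>\<^sub>F y in nhds y0. y $ 3 * \<beta> 3 > 0" by (auto dest: order_tendstoD)
        then have 3: "\<forall>\<^sub>F y in nhds y0. (\<forall>k. k \<notin> UNIV \<longrightarrow> y $ k = 0) \<longrightarrow> (\<Sum>k\<in>UNIV. frame3 0 0 (1 / (\<beta> 3)\<^sup>2) k * (y $ k)\<^sup>2) = 1
           \<longrightarrow> diagonal_quadric l \<beta> c (\<zeta> y) = 0 \<and> diagonal_gradient l \<beta> (\<zeta> y) = y"
        proof eventually_elim
          case (elim y)
          have "y $ 3 = \<beta> 3" if "(y $ 3)\<^sup>2 / (\<beta> 3)\<^sup>2 = 1"
          proof -
            have "(y $ 3)\<^sup>2 = (\<beta> 3)\<^sup>2" using that \<beta>3 by simp
            then have "y $ 3 = \<beta> 3 \<or> y $ 3 = - \<beta> 3" by (simp add: power2_eq_iff)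
            then show ?thesis using elim by (auto simp: mult_less_0_iff not_less)
          qed
          then show ?case using x[of y] \<beta>3
            by (auto simp: sum_3 diagonal_quadric_def diagonal_gradient_def \<zeta>_def l3 vec_eq_iff forall_3)
        qed
        have "frame3 0 0 (1 / (\<beta> 3)\<^sup>2) (1::3) = frame3 0 0 (1 / (\<beta> 3)\<^sup>2) 3 \<or> l 1 = l 3"
          by (rule key[OF 1 2 3]) (use \<beta>3 in \<open>simp_all add: sum_3 y0k l3\<close>)
        then show ?thesis using \<beta>3 l1 l3 by simp
      qed
    next
      case l3: False
      have lk: "l k \<noteq> 0" for k using exhaust_3[of k] l1 l2 l3 by auto
      define C where "C = (\<Sum>k\<in>UNIV. (\<beta> k)\<^sup>2 / (4 * l k)) - c"
      define \<zeta> :: "real^3 \<Rightarrow> real^3" where "\<zeta> y = (\<chi> k. (y $ k - \<beta> k) / (2 * l k))" for y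
      have grad\<zeta>: "diagonal_gradient l \<beta> (\<zeta> y) = y" for y
        using lk by (simp add: diagonal_gradient_def \<zeta>_def vec_eq_iff)
      have eq: "diagonal_quadric l \<beta> c z = (\<Sum>k\<in>UNIV. (diagonal_gradient l \<beta> z $ k)\<^sup>2 / (4 * l k)) - C" for z
        unfolding diagonal_quadric_def sq[OF lk] C_def
        by (simp add: diagonal_gradient_def sum_subtractf)
      have 1: "isCont \<zeta> y" for y using cont unfolding \<zeta>_def isCont_def by (intro vec_tendstoI) simp
      have 2: "\<zeta> y0 = z0" using z0k[OF lk] by (simp add: \<zeta>_def vec_eq_iff)
      have C0: "(\<Sum>k\<in>UNIV. (y0 $ k)\<^sup>2 / (4 * l k)) = C" using eq[of z0] z0 by (simp add: y0_def)
      have "C \<noteq> 0"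
      proof
        \<comment> \<open>on a cone the two sides scale with different degrees, so both vanish\<close>
        assume C: "C = 0"
        define F where "F = matrix_form \<mu> y0 * (y0 \<bullet> y0)\<^sup>2"
        define R where "R = curvature_form l y0"
        have "isCont (\<lambda>s. \<zeta> (s *\<^sub>R y0)) 1"
          by (rule isCont_o2[where g = \<zeta>]) (auto intro: continuous_intros 1)
        then have "((\<lambda>s. \<zeta> (s *\<^sub>R y0)) \<longlongrightarrow> z0) (nhds 1)"
          using tendsto_at_iff_tendsto_nhds[of "\<lambda>s. \<zeta> (s *\<^sub>R y0)" 1] 2 by (simp add: isCont_def)
        then have "\<forall>\<^sub>F s in nhds (1::real). diagonal_quadric l \<beta> c (\<zeta> (s *\<^sub>R y0)) = 0 \<longrightarrow> diagonal_gradient l \<beta> (\<zeta> (s *\<^sub>R y0)) \<noteq> 0 \<longrightarrow>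
          matrix_form \<mu> (diagonal_gradient l \<beta> (\<zeta> (s *\<^sub>R y0))) * (diagonal_gradient l \<beta> (\<zeta> (s *\<^sub>R y0)) \<bullet> diagonal_gradient l \<beta> (\<zeta> (s *\<^sub>R y0)))\<^sup>2
           = curvature_form l (diagonal_gradient l \<beta> (\<zeta> (s *\<^sub>R y0)))"
          using ev by (auto simp: filterlim_iff)
        then obtain d where d: "d > 0" and ds: "\<And>s. dist s 1 < d \<Longrightarrow> diagonal_quadric l \<beta> c (\<zeta> (s *\<^sub>R y0)) = 0 \<longrightarrow> s *\<^sub>R y0 \<noteq> 0 \<longrightarrow>
          matrix_form \<mu> (s *\<^sub>R y0) * ((s *\<^sub>R y0) \<bullet> (s *\<^sub>R y0))\<^sup>2 = curvature_form l (s *\<^sub>R y0)"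
          unfolding eventually_nhds_metric grad\<zeta> by blast
        have FR: "s\<^sup>2 * F = R" if "dist s 1 < d" "s > 0" for s
        proof -
          have "(\<Sum>k\<in>UNIV. (s * y0 $ k)\<^sup>2 / (4 * l k)) = s\<^sup>2 * (\<Sum>k\<in>UNIV. (y0 $ k)\<^sup>2 / (4 * l k))"
            by (simp add: sum_distrib_left power_mult_distrib)
          then have "diagonal_quadric l \<beta> c (\<zeta> (s *\<^sub>R y0)) = 0" by (simp add: eq grad\<zeta> C C0)
          then have "matrix_form \<mu> (s *\<^sub>R y0) * ((s *\<^sub>R y0) \<bullet> (s *\<^sub>R y0))\<^sup>2 = curvature_form l (s *\<^sub>R y0)"
            using ds[OF that(1)] that(2) y0 by simp
          moreover have "(s *\<^sub>R y0) \<bullet> (s *\<^sub>R y0) = s\<^sup>2 * (y0 \<bullet> y0)" by (simp add: power2_eq_square)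
          ultimately have "s ^ 4 * (s\<^sup>2 * F - R) = 0"
            unfolding F_def R_def matrix_form_scaleR curvature_form_scaleR by algebra
          then show ?thesis using that(2) by simp
        qed
        have "F = R" using FR[of 1] d by simp
        moreover have "(1 + d / 2)\<^sup>2 * F = R" using d by (intro FR) (auto simp: dist_real_def)
        ultimately have "((1 + d / 2)\<^sup>2 - 1) * F = 0" by (simp add: algebra_simps)
        moreover have "(1 + d / 2)\<^sup>2 > 1" using d by simp
        ultimately have "R = 0" using \<open>F = R\<close> by simp
        then show False using curvature_form_zero[of l y0] l1 l2 l3 y0 by (simp add: R_def)
      qed
      define \<kappa> where "\<kappa> k = 1 / (4 * l k * C)" for k
      have \<kappa>: "(\<Sum>k\<in>UNIV. \<kappa> k * (y $ k)\<^sup>2) = (\<Sum>k\<in>UNIV. (y $ k)\<^sup>2 / (4 * l k)) / C" for y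
        by (simp add: \<kappa>_def sum_divide_distrib)
      have 3: "\<forall>\<^sub>F y in nhds y0. (\<forall>k. k \<notin> UNIV \<longrightarrow> y $ k = 0) \<longrightarrow> (\<Sum>k\<in>UNIV. \<kappa> k * (y $ k)\<^sup>2) = 1
             \<longrightarrow> diagonal_quadric l \<beta> c (\<zeta> y) = 0 \<and> diagonal_gradient l \<beta> (\<zeta> y) = y"
        using \<open>C \<noteq> 0\<close> by (intro always_eventually) (simp add: grad\<zeta> eq \<kappa>)
      have "\<kappa> i = \<kappa> j \<or> l i = l j" if "i \<noteq> j" for i j
        by (rule key[OF 1 2 3]) (use that \<open>C \<noteq> 0\<close> in \<open>simp_all add: \<kappa> C0\<close>)
      then have "l i = l j" if "i \<noteq> j" for i j using that \<open>C \<noteq> 0\<close> lk by (fastforce simp: \<kappa>_def)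
      from this[of 1 2] this[of 1 3] show ?thesis by simp
    qed
  qed
qed

section \<open>Pairs of planes\<close>

text \<open>A regular surface that is open in the union of two crossing planes avoids the crossing line. If a
  chart is transversal to the second plane at a crossing point, the surface lies in the first plane
  near that point, although every neighbourhood of it in the union contains points off that plane.\<close>

lemma (in chart) crossing_point_absurd:
  assumes Z: "openin (top_of_set {x. (n1 \<bullet> x - d1) * (n2 \<bullet> x - d2) = 0}) Q"
    and u: "u \<in> U" and q: "n1 \<bullet> r u = d1" "n2 \<bullet> r u = d2"
    and n2: "n2 \<bullet> tangent i u \<noteq> 0" and indep: "cross3 n1 n2 \<noteq> 0"
  shows False
proof -
  let ?Z = "{x. (n1 \<bullet> x - d1) * (n2 \<bullet> x - d2) = 0}"
  have QZ: "Q \<subseteq> ?Z" using Z by (rule openin_imp_subset)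
  define O1 where "O1 = {v \<in> U. n2 \<bullet> tangent i v \<noteq> 0}"
  have "continuous_on U (\<lambda>v. n2 \<bullet> tangent i v)"
    by (intro continuous_intros smooth_on_continuous smooth_on_partial_deriv smooth)
  moreover have "O1 = U \<inter> (\<lambda>v. n2 \<bullet> tangent i v) -` (- {0})" by (auto simp: O1_def)
  ultimately have O1: "open O1" using continuous_open_preimage[OF _ open_dom, of "\<lambda>v. n2 \<bullet> tangent i v" "- {0}"] by auto
  have uO1: "u \<in> O1" using u n2 by (simp add: O1_def)
  have in_plane: "n1 \<bullet> r v = d1" if v: "v \<in> O1" for v
  proof (rule ccontr)
    assume ne: "n1 \<bullet> r v \<noteq> d1"
    have vU: "v \<in> U" using v by (simp add: O1_def)
    define O2 where "O2 = {w \<in> U. n1 \<bullet> r w \<noteq> d1}"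
    have "continuous_on U (\<lambda>w. n1 \<bullet> r w)" by (intro continuous_intros smooth_on_continuous smooth)
    moreover have "O2 = U \<inter> (\<lambda>w. n1 \<bullet> r w) -` (- {d1})" by (auto simp: O2_def)
    ultimately have O2: "open O2" using continuous_open_preimage[OF _ open_dom, of "\<lambda>w. n1 \<bullet> r w" "- {d1}"] by auto
    have "\<forall>\<^sub>F w in nhds v. w \<in> O2" using O2 ne vU by (intro eventually_nhds_in_open) (auto simp: O2_def)
    then have "\<forall>\<^sub>F w in nhds v. n2 \<bullet> r w = d2"
      by eventually_elim (use QZ mem_Q in \<open>force simp: O2_def\<close>)
    then have "partial_deriv i (\<lambda>w. n2 \<bullet> r w) v = partial_deriv i (\<lambda>w. d2) v" by (rule partial_deriv_cong)
    then have "n2 \<bullet> tangent i v = 0"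
      using partial_deriv_bounded_linear[OF bounded_linear_inner_right differentiable[OF vU], of i n2]
      by (simp add: partial_deriv_const)
    then show False using v by (simp add: O1_def)
  qed
  obtain s where s: "homeomorphism U (r ` U) r s" using param unfolding local_param_def by blast
  have "openin (top_of_set U) O1" using O1 by (auto simp: O1_def intro: open_subset)
  then have "openin (top_of_set (r ` U)) (r ` O1)" using homeomorphism_imp_open_map[OF s] by blast
  moreover have "openin (top_of_set Q) (r ` U)" using param unfolding local_param_def by blast
  ultimately have "openin (top_of_set ?Z) (r ` O1)" using Z openin_trans by blast
  then obtain V where V: "open V" "r ` O1 = ?Z \<inter> V" unfolding openin_open by blast
  \<comment> \<open>a direction in the second plane that leaves the first\<close>
  define d where "d = n1 - ((n1 \<bullet> n2) / (n2 \<bullet> n2)) *\<^sub>R n2"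
  have n20: "n2 \<bullet> n2 \<noteq> 0" using indep by auto
  have d2: "n2 \<bullet> d = 0" using n20 by (simp add: d_def inner_diff_right inner_commute)
  have "(n2 \<bullet> n2) * (n1 \<bullet> d) = cross3 n1 n2 \<bullet> cross3 n1 n2"
    using n20 lagrange_cross[of n1 n2] by (simp add: d_def inner_diff_right algebra_simps)
  then have d1: "n1 \<bullet> d \<noteq> 0" using indep by auto
  have "r u \<in> V" using V(2) uO1 by auto
  then have "\<forall>\<^sub>F x in nhds (r u). x \<in> V" using V(1) by (intro eventually_nhds_in_open)
  then have "\<forall>\<^sub>F t in nhds (0::real). r u + t *\<^sub>R d \<in> V"
    using tendsto_line_at_0[of "r u" d] by (auto simp: filterlim_iff)
  then obtain \<epsilon> where \<epsilon>: "\<epsilon> > 0" "\<And>t. dist t 0 < \<epsilon> \<Longrightarrow> r u + t *\<^sub>R d \<in> V"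
    unfolding eventually_nhds_metric by auto
  have "r u + (\<epsilon> / 2) *\<^sub>R d \<in> ?Z \<inter> V" using \<epsilon> q d2 by (auto simp: inner_add_right)
  then have "n1 \<bullet> (r u + (\<epsilon> / 2) *\<^sub>R d) = d1" using V(2) in_plane by auto
  then show False using q d1 \<epsilon>(1) by (simp add: inner_add_right)
qed

lemma open_part_of_first_plane:
  fixes n m :: "real^3"
  assumes Z: "openin (top_of_set {x. (n \<bullet> x - d) * (m \<bullet> x - d') = 0}) Q"
    and off: "\<And>x. x \<in> Q \<Longrightarrow> m \<bullet> x \<noteq> d'"
  shows "open_part_of Q {x. n \<bullet> x = d}"
proof -
  obtain V where V: "open V" "Q = {x. (n \<bullet> x - d) * (m \<bullet> x - d') = 0} \<inter> V"
    using Z unfolding openin_open by (elim exE conjE) (rule that)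
  have "Q = {x. n \<bullet> x = d} \<inter> (V \<inter> {x. m \<bullet> x \<noteq> d'})" using V(2) off by auto
  moreover have "open (V \<inter> {x. m \<bullet> x \<noteq> d'})" by (intro open_Int V(1) open_Collect_neq continuous_intros)
  ultimately show ?thesis unfolding open_part_of_def openin_open by blast
qed

lemma surface_in_two_planes:
  assumes conn: "connected Q" and reg: "regular_surface Q"
    and Z: "openin (top_of_set {x. (n1 \<bullet> x - d1) * (n2 \<bullet> x - d2) = 0}) Q"
    and n: "n1 \<noteq> 0" "n2 \<noteq> 0"
    and cross: "cross3 n1 n2 \<noteq> 0 \<or> (\<forall>x. \<not> (n1 \<bullet> x = d1 \<and> n2 \<bullet> x = d2))"
  obtains S where "is_plane S" "open_part_of Q S"
proof -
  have QZ: "Q \<subseteq> {x. (n1 \<bullet> x - d1) * (n2 \<bullet> x - d2) = 0}" using Z by (rule openin_imp_subset)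
  have no_common: "\<not> (n1 \<bullet> q = d1 \<and> n2 \<bullet> q = d2)" if qQ: "q \<in> Q" for q
  proof
    assume q: "n1 \<bullet> q = d1 \<and> n2 \<bullet> q = d2"
    then have indep: "cross3 n1 n2 \<noteq> 0" using cross by blast
    obtain U r u where r: "local_param Q U r" "u \<in> U" "q = r u"
      using reg qQ unfolding regular_surface_def by blast
    interpret chart Q U r by standard (rule r)
    have Z': "openin (top_of_set {x. (n2 \<bullet> x - d2) * (n1 \<bullet> x - d1) = 0}) Q" using Z by (simp add: mult.commute)
    have "cross3 n2 n1 \<noteq> 0" using indep cross_skew[of n2 n1] by auto
    then have "n1 \<bullet> tangent i u = 0" "n2 \<bullet> tangent i u = 0" for i
      using crossing_point_absurd[OF Z r(2)] crossing_point_absurd[OF Z' r(2)] q r(3) indep by blast+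
    then obtain x y where "n1 = x *\<^sub>R unit_normal r u" "n2 = y *\<^sub>R unit_normal r u"
      using parallel_unit_normal[OF r(2), of n1] parallel_unit_normal[OF r(2), of n2] by blast
    then have "cross3 n1 n2 = 0" by (simp add: cross_mult_left cross_mult_right)
    then show False using indep by blast
  qed

  have "closed {x. n1 \<bullet> x = d1}" "closed {x. n2 \<bullet> x = d2}" by (intro closed_Collect_eq continuous_intros)+
  moreover have "Q \<subseteq> {x. n1 \<bullet> x = d1} \<union> {x. n2 \<bullet> x = d2}" using QZ by auto
  moreover have "{x. n1 \<bullet> x = d1} \<inter> {x. n2 \<bullet> x = d2} \<inter> Q = {}" using no_common by blast
  ultimately have "{x. n1 \<bullet> x = d1} \<inter> Q = {} \<or> {x. n2 \<bullet> x = d2} \<inter> Q = {}"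
    using conn unfolding connected_closed by metis
  then show thesis
  proof
    assume e: "{x. n1 \<bullet> x = d1} \<inter> Q = {}"
    have "open_part_of Q {x. n2 \<bullet> x = d2}"
    proof (rule open_part_of_first_plane)
      show "openin (top_of_set {x. (n2 \<bullet> x - d2) * (n1 \<bullet> x - d1) = 0}) Q" using Z by (simp add: mult.commute)
    qed (use e in auto)
    moreover have "is_plane {x. n2 \<bullet> x = d2}" using n(2) unfolding is_plane_def by blast
    ultimately show thesis by (rule that[rotated])
  next
    assume e: "{x. n2 \<bullet> x = d2} \<inter> Q = {}"
    have "open_part_of Q {x. n1 \<bullet> x = d1}" by (rule open_part_of_first_plane[OF Z]) (use e in auto)
    moreover have "is_plane {x. n1 \<bullet> x = d1}" using n(1) unfolding is_plane_def by blast
    ultimately show thesis by (rule that[rotated])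
  qed
qed

section \<open>The classification\<close>

lemma orthonormal_frame_combination:
  assumes "orthonormal_frame e" shows "(\<Sum>k\<in>UNIV. z $ k *\<^sub>R e k) \<bullet> e j = z $ j"
proof -
  have "(\<Sum>k\<in>UNIV. z $ k *\<^sub>R e k) \<bullet> e j = (\<Sum>k\<in>UNIV. if k = j then z $ k else 0)"
    unfolding inner_sum_left using assms by (intro sum.cong) (auto simp: orthonormal_frame_def)
  then show ?thesis by simp
qed

text \<open>In the following, \<open>e\<close> is an orthonormal eigenbasis of \<open>A\<close> with eigenvalues \<open>l\<close>, and \<open>\<beta>\<close> are the
  coordinates of the linear part.\<close>

context
  fixes A :: "real^3^3" and b :: "real^3" and c :: real and e :: "3 \<Rightarrow> real^3" and l \<beta> :: "3 \<Rightarrow> real"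
  assumes A: "transpose A = A" and e: "orthonormal_frame e" and eig: "\<And>k. A *v e k = l k *\<^sub>R e k"
  defines "\<beta> \<equiv> \<lambda>k. b \<bullet> e k"
begin

lemma quadratic_principal: "quadratic A b c x = (\<Sum>k\<in>UNIV. l k * (x \<bullet> e k)\<^sup>2 + \<beta> k * (x \<bullet> e k)) + c"
proof -
  have "(A *v x) \<bullet> e k = l k * (x \<bullet> e k)" for k
    using symmetric_matrix_inner[OF A, of x "e k"] by (simp add: eig)
  then have "x \<bullet> (A *v x) = (\<Sum>k\<in>UNIV. l k * (x \<bullet> e k)\<^sup>2)"
    using orthonormal_frame_inner[OF e, of x "A *v x"] by (simp add: power2_eq_square mult_ac)
  moreover have "b \<bullet> x = (\<Sum>k\<in>UNIV. \<beta> k * (x \<bullet> e k))" unfolding \<beta>_def by (rule orthonormal_frame_inner[OF e])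
  ultimately show ?thesis by (simp add: quadratic_def sum.distrib)
qed

lemma gradient_principal: "gradient A b x \<bullet> e k = 2 * l k * (x \<bullet> e k) + \<beta> k"
  using symmetric_matrix_inner[OF A, of x "e k"] by (simp add: gradient_def inner_add_left eig \<beta>_def)

lemma gradient_zero_iff: "gradient A b x = 0 \<longleftrightarrow> (\<forall>k. 2 * l k * (x \<bullet> e k) + \<beta> k = 0)"
  using orthonormal_frame_expand[OF e, of "gradient A b x"] by (auto simp: gradient_principal[symmetric])

text \<open>If the gradient does not vanish at some point of \<open>Q\<close>, the classification in principal coordinates
  applies, because \<open>Q\<close> contains all zeros of the polynomial near that point.\<close>

lemma principal_cases:
  assumes G: "gauss_map Q G" and lap: "laplacian_on Q G (\<lambda>x. M *v G x)"
    and reg: "regular_surface Q" and Q: "openin (top_of_set {x. quadratic A b c x = 0}) Q"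
    and q: "q \<in> Q" "gradient A b q \<noteq> 0"
    and ord: "l 1 \<noteq> 0" "l 3 \<noteq> 0 \<Longrightarrow> l 2 \<noteq> 0" "l 2 = 0 \<Longrightarrow> \<beta> 3 = 0"
  shows "(l 2 = l 1 \<and> l 3 = l 1) \<or> (l 2 = l 1 \<and> l 3 = 0 \<and> \<beta> 3 = 0)
     \<or> (l 2 \<noteq> 0 \<and> l 3 = 0 \<and> \<beta> 3 = 0 \<and> (\<beta> 1)\<^sup>2 / (4 * l 1) + (\<beta> 2)\<^sup>2 / (4 * l 2) = c)
     \<or> (l 2 = 0 \<and> l 3 = 0 \<and> \<beta> 2 = 0 \<and> \<beta> 3 = 0)"
proof -
  define \<psi> :: "real^3 \<Rightarrow> real^3" where "\<psi> z = (\<Sum>k\<in>UNIV. z $ k *\<^sub>R e k)" for z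
  have \<psi>e: "\<psi> z \<bullet> e k = z $ k" for z k unfolding \<psi>_def by (rule orthonormal_frame_combination[OF e])
  have quad\<psi>: "quadratic A b c (\<psi> z) = diagonal_quadric l \<beta> c z" for z
    by (simp add: quadratic_principal diagonal_quadric_def \<psi>e)
  have grad\<psi>: "gradient A b (\<psi> z) = \<psi> (diagonal_gradient l \<beta> z)" for z
  proof -
    have "gradient A b (\<psi> z) = (\<Sum>k\<in>UNIV. (2 * l k * z $ k + \<beta> k) *\<^sub>R e k)"
      using orthonormal_frame_expand[OF e, of "gradient A b (\<psi> z)"] unfolding gradient_principal \<psi>e .
    then show ?thesis by (simp add: \<psi>_def diagonal_gradient_def)
  qed
  have \<psi>0: "\<psi> y = 0 \<longleftrightarrow> y = 0" for y
  proof
    assume "\<psi> y = 0"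
    then have "y $ k = 0" for k using \<psi>e[of y k] by simp
    then show "y = 0" by (simp add: vec_eq_iff)
  qed (simp add: \<psi>_def)
  define z0 :: "real^3" where "z0 = (\<chi> k. q \<bullet> e k)"
  have z0: "\<psi> z0 = q" using orthonormal_frame_expand[OF e, of q] by (simp add: \<psi>_def z0_def)
  define \<mu> where "\<mu> i j = e i \<bullet> (M *v e j)" for i j
  have form: "\<psi> y \<bullet> (M *v \<psi> y) = matrix_form \<mu> y" for y
    unfolding \<psi>_def matrix_form_def \<mu>_def
    by (simp add: linear_sum[OF matrix_vector_mul_linear] matrix_vector_mult_scaleR inner_sum_left inner_sum_right sum_distrib_left)
       (subst sum.swap, simp add: mult_ac)
  have sqr: "\<psi> y \<bullet> \<psi> y = y \<bullet> y" for y
    using orthonormal_frame_inner[OF e, of "\<psi> y" "\<psi> y"] unfolding \<psi>e by (simp add: inner_vec_def[of y])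
  obtain V where V: "open V" "Q = {x. quadratic A b c x = 0} \<inter> V" using Q unfolding openin_open by blast
  have "isCont \<psi> z0" unfolding \<psi>_def by (intro continuous_intros)
  then have "(\<psi> \<longlongrightarrow> q) (nhds z0)" using z0 tendsto_at_iff_tendsto_nhds[of \<psi> z0] by (simp add: isCont_def)
  moreover have "\<forall>\<^sub>F x in nhds q. x \<in> V" using V q by (intro eventually_nhds_in_open) auto
  ultimately have "\<forall>\<^sub>F z in nhds z0. \<psi> z \<in> V" by (auto simp: filterlim_iff)
  then have "\<forall>\<^sub>F z in nhds z0. diagonal_quadric l \<beta> c z = 0 \<longrightarrow> diagonal_gradient l \<beta> z \<noteq> 0 \<longrightarrow>
       matrix_form \<mu> (diagonal_gradient l \<beta> z) * (diagonal_gradient l \<beta> z \<bullet> diagonal_gradient l \<beta> z)\<^sup>2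
         = curvature_form l (diagonal_gradient l \<beta> z)"
  proof (eventually_elim, intro impI)
    fix z assume z: "\<psi> z \<in> V" "diagonal_quadric l \<beta> c z = 0" "diagonal_gradient l \<beta> z \<noteq> 0"
    have "\<psi> z \<in> Q" using z V(2) by (simp add: quad\<psi>)
    then obtain U r u where r: "local_param Q U r" "u \<in> U" "\<psi> z = r u"
      using reg unfolding regular_surface_def by blast
    interpret chart Q U r by standard (rule r)
    have eqn: "quadratic A b c (r v) = 0" if "v \<in> U" for v using mem_Q[OF that] V(2) by blast
    have "gradient A b (r u) \<noteq> 0" using z(3) by (simp add: r(3)[symmetric] grad\<psi> \<psi>0)
    moreover have "(\<chi> k. laplace_beltrami r (\<lambda>v. G (r v) $ k) u) = M *v G (r u)"
      using lap r unfolding laplacian_on_def by blast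
    ultimately show "matrix_form \<mu> (diagonal_gradient l \<beta> z) * (diagonal_gradient l \<beta> z \<bullet> diagonal_gradient l \<beta> z)\<^sup>2
         = curvature_form l (diagonal_gradient l \<beta> z)"
      using quadric_normal_component[OF G r(2) A eqn _ _ e eig, of M]
      unfolding r(3)[symmetric] grad\<psi> form sqr \<psi>e curvature_form_def by blast
  qed
  moreover have "diagonal_quadric l \<beta> c z0 = 0" using q(1) V(2) by (simp add: quad\<psi>[symmetric] z0)
  moreover have "diagonal_gradient l \<beta> z0 \<noteq> 0" using q(2) grad\<psi>[of z0] by (auto simp: z0 \<psi>0)
  ultimately show ?thesis using ord by (rule diagonal_quadric_classification)
qed

text \<open>If the gradient vanishes along \<open>Q\<close>, its derivative \<open>2 A\<close> annihilates the tangent planes; so \<open>A\<close> has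
  rank one.\<close>

lemma plane_of_singular_surface:
  assumes reg: "regular_surface Q" and Q: "openin (top_of_set {x. quadratic A b c x = 0}) Q"
    and q: "q \<in> Q" and sing: "\<And>x. x \<in> Q \<Longrightarrow> gradient A b x = 0"
    and ord: "l 1 \<noteq> 0" "l 3 \<noteq> 0 \<Longrightarrow> l 2 \<noteq> 0"
  shows "is_plane {x. quadratic A b c x = 0}"
proof -
  obtain U r u where r: "local_param Q U r" "u \<in> U" "q = r u"
    using reg q unfolding regular_surface_def by blast
  interpret chart Q U r by standard (rule r)
  have ort: "e k \<bullet> tangent i u = 0" if "l k \<noteq> 0" for k i
  proof -
    have "partial_deriv i (\<lambda>v. e k \<bullet> r v) u = partial_deriv i (\<lambda>v. - \<beta> k / (2 * l k)) u"
    proof (rule partial_deriv_cong, rule eventually_domI[OF r(2)])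
      fix v assume "v \<in> U"
      then have "2 * l k * (r v \<bullet> e k) + \<beta> k = 0" using sing[OF mem_Q] by (simp add: gradient_zero_iff)
      then show "e k \<bullet> r v = - \<beta> k / (2 * l k)" using that by (simp add: field_simps inner_commute)
    qed
    then show ?thesis
      using partial_deriv_bounded_linear[OF bounded_linear_inner_right differentiable[OF r(2)], of i "e k"]
      by (simp add: partial_deriv_const)
  qed
  have "l 2 = 0"
  proof (rule ccontr)
    assume l2: "l 2 \<noteq> 0"
    obtain x y where xy: "e 1 = x *\<^sub>R unit_normal r u" "e 2 = y *\<^sub>R unit_normal r u"
      using parallel_unit_normal[OF r(2) ort[OF ord(1)]] parallel_unit_normal[OF r(2) ort[OF l2]] by blast
    have "e 1 \<bullet> e 2 = 0" "e 1 \<bullet> e 1 = 1" "e 2 \<bullet> e 2 = 1" using e by (simp_all add: orthonormal_frame_def)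
    then show False unfolding xy by auto
  qed
  then have l: "l 2 = 0" "l 3 = 0" using ord(2) by auto
  have g: "2 * l k * (q \<bullet> e k) + \<beta> k = 0" for k using sing[OF q] by (simp add: gradient_zero_iff)
  have \<beta>: "\<beta> 2 = 0" "\<beta> 3 = 0" "\<beta> 1 = - 2 * l 1 * (q \<bullet> e 1)" using g[of 2] g[of 3] g[of 1] l by auto
  have "quadratic A b c q = 0" using openin_imp_subset[OF Q] q by auto
  then have c: "c = l 1 * (q \<bullet> e 1)\<^sup>2" by (simp add: quadratic_principal sum_3 l \<beta> power2_eq_square)
  have "quadratic A b c x = l 1 * (x \<bullet> e 1 - q \<bullet> e 1)\<^sup>2" for x
  proof -
    have "quadratic A b c x = l 1 * (x \<bullet> e 1)\<^sup>2 + \<beta> 1 * (x \<bullet> e 1) + c"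
      by (simp add: quadratic_principal sum_3 l \<beta>(1,2))
    also have "\<dots> = l 1 * (x \<bullet> e 1 - q \<bullet> e 1)\<^sup>2"
      unfolding \<beta>(3) c by (simp add: power2_eq_square algebra_simps)
    finally show ?thesis .
  qed
  then have "{x. quadratic A b c x = 0} = {x. e 1 \<bullet> x = q \<bullet> e 1}" using ord(1) by (auto simp: inner_commute)
  moreover have "e 1 \<bullet> e 1 = 1" using e by (simp add: orthonormal_frame_def)
  then have "e 1 \<noteq> 0" by auto
  ultimately show ?thesis unfolding is_plane_def by blast
qed

text \<open>The point \<open>q\<close> with nonzero gradient makes the radii positive, and for \<open>l 3 = 0\<close> with crossing
  planes it forces \<open>l 1\<close> and \<open>l 2\<close> to have opposite signs, so that the polynomial splits over the
  reals.\<close>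

lemma shape_from_principal_cases:
  assumes conn: "connected Q" and reg: "regular_surface Q" and Q: "openin (top_of_set {x. quadratic A b c x = 0}) Q"
    and q: "q \<in> Q" "gradient A b q \<noteq> 0" and l1: "l 1 \<noteq> 0"
    and cases: "(l 2 = l 1 \<and> l 3 = l 1) \<or> (l 2 = l 1 \<and> l 3 = 0 \<and> \<beta> 3 = 0)
     \<or> (l 2 \<noteq> 0 \<and> l 3 = 0 \<and> \<beta> 3 = 0 \<and> (\<beta> 1)\<^sup>2 / (4 * l 1) + (\<beta> 2)\<^sup>2 / (4 * l 2) = c)
     \<or> (l 2 = 0 \<and> l 3 = 0 \<and> \<beta> 2 = 0 \<and> \<beta> 3 = 0)"
  shows "\<exists>S. (is_plane S \<or> is_circular_cylinder S \<or> is_sphere S) \<and> open_part_of Q S"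
proof -
  have q0: "quadratic A b c q = 0" using openin_imp_subset[OF Q] q by auto
  have gq: "\<exists>k. 2 * l k * (q \<bullet> e k) + \<beta> k \<noteq> 0" using q(2) by (simp add: gradient_zero_iff)
  have ee: "e 1 \<bullet> e 1 = 1" "e 2 \<bullet> e 2 = 1" "e 3 \<bullet> e 3 = 1" "e 1 \<bullet> e 2 = 0" "e 2 \<bullet> e 1 = 0"
    using e by (simp_all add: orthonormal_frame_def)
  define a where "a = (- 1 / (2 * l 1)) *\<^sub>R b"
  have ak: "a \<bullet> e k = - \<beta> k / (2 * l 1)" for k by (simp add: a_def \<beta>_def)
  define s where "s k x = (x - a) \<bullet> e k" for k x
  have s: "x \<bullet> e k = s k x - \<beta> k / (2 * l 1)" for k x by (simp add: s_def inner_diff_left ak)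
  have norm_s: "(x - a) \<bullet> (x - a) = (s 1 x)\<^sup>2 + (s 2 x)\<^sup>2 + (s 3 x)\<^sup>2" for x
    using orthonormal_frame_inner[OF e, of "x - a" "x - a"] by (simp add: s_def sum_3 power2_eq_square)
  have cs: "l 1 * (S - B / (2 * l 1))\<^sup>2 + B * (S - B / (2 * l 1)) = l 1 * S\<^sup>2 - B\<^sup>2 / (4 * l 1)" for S B
    using l1 by (simp add: field_simps power2_eq_square)
  from cases consider (sphere) "l 2 = l 1" "l 3 = l 1" | (cylinder) "l 2 = l 1" "l 3 = 0" "\<beta> 3 = 0"
    | (crossing) "l 2 \<noteq> 0" "l 3 = 0" "\<beta> 3 = 0" "c = (\<beta> 1)\<^sup>2 / (4 * l 1) + (\<beta> 2)\<^sup>2 / (4 * l 2)"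
    | (parallel) "l 2 = 0" "l 3 = 0" "\<beta> 2 = 0" "\<beta> 3 = 0" by blast
  then show ?thesis
  proof cases
    case sphere
    define K where "K = c - ((\<beta> 1)\<^sup>2 + (\<beta> 2)\<^sup>2 + (\<beta> 3)\<^sup>2) / (4 * l 1)"
    have p: "quadratic A b c x = l 1 * ((x - a) \<bullet> (x - a)) + K" for x
      unfolding quadratic_principal sum_3 sphere s cs unfolding norm_s K_def
      by (simp add: algebra_simps add_divide_distrib)
    have "quadratic A b c x = 0 \<longleftrightarrow> norm (x - a) = norm (q - a)" for x
    proof -
      have "quadratic A b c x = l 1 * ((x - a) \<bullet> (x - a) - (q - a) \<bullet> (q - a))"
        using q0 unfolding p right_diff_distrib by linarith
      then have "quadratic A b c x = 0 \<longleftrightarrow> (x - a) \<bullet> (x - a) = (q - a) \<bullet> (q - a)" using l1 by simp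
      then show ?thesis by (simp add: norm_eq)
    qed
    then have "{x. quadratic A b c x = 0} = sphere a (norm (q - a))"
      unfolding sphere_def dist_norm norm_minus_commute[of a] by simp
    moreover have "q \<noteq> a"
    proof
      assume "q = a"
      then have "2 * l 1 * (q \<bullet> e k) + \<beta> k = 0" for k using l1 by (simp add: ak)
      moreover have "l k = l 1" for k using sphere exhaust_3[of k] by auto
      ultimately have "2 * l k * (q \<bullet> e k) + \<beta> k = 0" for k by metis
      then show False using gq by blast
    qed
    then have "norm (q - a) > 0" by simp
    ultimately have "is_sphere {x. quadratic A b c x = 0}" unfolding is_sphere_def by blast
    then show ?thesis using Q unfolding open_part_of_def by blast
  next
    case cylinder
    define F where "F x = (x - a) \<bullet> (x - a) - (e 3 \<bullet> (x - a))\<^sup>2" for x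
    have F: "F x = (s 1 x)\<^sup>2 + (s 2 x)\<^sup>2" for x unfolding F_def norm_s by (simp add: s_def inner_commute)
    define K where "K = c - ((\<beta> 1)\<^sup>2 + (\<beta> 2)\<^sup>2) / (4 * l 1)"
    have p: "quadratic A b c x = l 1 * F x + K" for x
      unfolding quadratic_principal sum_3 cylinder s cs unfolding F K_def
      by (simp add: algebra_simps add_divide_distrib)
    have "F q \<noteq> 0"
    proof
      assume "F q = 0"
      then have "s 1 q = 0" "s 2 q = 0" unfolding F by (simp_all add: sum_power2_eq_zero_iff)
      moreover have "2 * l 1 * (q \<bullet> e k) + \<beta> k = 0" if "s k q = 0" for k using that l1 by (simp add: s)
      ultimately have "2 * l k * (q \<bullet> e k) + \<beta> k = 0" for k using cylinder exhaust_3[of k] by auto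
      then show False using gq by blast
    qed
    moreover have "F q \<ge> 0" unfolding F by simp
    ultimately have Fq: "F q > 0" by simp
    have "quadratic A b c x = l 1 * (F x - F q)" for x using q0 unfolding p right_diff_distrib by linarith
    then have "{x. quadratic A b c x = 0} = {x. (x - a) \<bullet> (x - a) - (e 3 \<bullet> (x - a))\<^sup>2 = (sqrt (F q))\<^sup>2}"
      using l1 Fq by (auto simp: F_def)
    moreover have "sqrt (F q) > 0" "norm (e 3) = 1" using Fq ee by (simp_all add: norm_eq_1)
    ultimately have "is_circular_cylinder {x. quadratic A b c x = 0}" unfolding is_circular_cylinder_iff by blast
    then show ?thesis using Q unfolding open_part_of_def by blast
  next
    case crossing
    define h1 h2 where "h1 x = x \<bullet> e 1 + \<beta> 1 / (2 * l 1)" and "h2 x = x \<bullet> e 2 + \<beta> 2 / (2 * l 2)" for x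
    have p: "quadratic A b c x = l 1 * (h1 x)\<^sup>2 + l 2 * (h2 x)\<^sup>2" for x
    proof -
      have sq: "m * X\<^sup>2 + \<gamma> * X = m * (X + \<gamma> / (2 * m))\<^sup>2 - \<gamma>\<^sup>2 / (4 * m)" if "m \<noteq> 0" for m \<gamma> X :: real
        using that by (simp add: field_simps power2_eq_square)
      have "quadratic A b c x = (l 1 * (x \<bullet> e 1)\<^sup>2 + \<beta> 1 * (x \<bullet> e 1)) + (l 2 * (x \<bullet> e 2)\<^sup>2 + \<beta> 2 * (x \<bullet> e 2)) + c"
        by (simp add: quadratic_principal sum_3 crossing(2,3))
      then show ?thesis
        unfolding sq[OF l1] sq[OF crossing(1)] using crossing(4) by (simp add: h1_def h2_def)
    qed
    have nz: "h1 q \<noteq> 0 \<or> h2 q \<noteq> 0"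
    proof (rule ccontr)
      assume "\<not> (h1 q \<noteq> 0 \<or> h2 q \<noteq> 0)"
      then have "q \<bullet> e 1 = - \<beta> 1 / (2 * l 1)" "q \<bullet> e 2 = - \<beta> 2 / (2 * l 2)" by (simp_all add: h1_def h2_def)
      then have "2 * l k * (q \<bullet> e k) + \<beta> k = 0" for k using l1 crossing exhaust_3[of k] by auto
      then show False using gq by blast
    qed
    have rel: "l 1 * (h1 q)\<^sup>2 + l 2 * (h2 q)\<^sup>2 = 0" using q0 by (simp add: p)
    then have h: "h1 q \<noteq> 0" "h2 q \<noteq> 0" using nz l1 crossing(1) by auto
    \<comment> \<open>the slope of the planes, read off at \<open>q\<close>\<close>
    define \<theta> where "\<theta> = h1 q / h2 q"
    have \<theta>: "\<theta> \<noteq> 0" "l 2 = - l 1 * \<theta>\<^sup>2"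
      using h rel by (simp_all add: \<theta>_def power_divide field_simps)
    define n1 n2 d1 d2 where "n1 = e 1 - \<theta> *\<^sub>R e 2" and "n2 = e 1 + \<theta> *\<^sub>R e 2"
      and "d1 = - \<beta> 1 / (2 * l 1) + \<theta> * (\<beta> 2 / (2 * l 2))" and "d2 = - \<beta> 1 / (2 * l 1) - \<theta> * (\<beta> 2 / (2 * l 2))"
    have n12: "n1 \<bullet> x - d1 = h1 x - \<theta> * h2 x" "n2 \<bullet> x - d2 = h1 x + \<theta> * h2 x" for x
      by (simp_all add: n1_def n2_def d1_def d2_def h1_def h2_def inner_add_left inner_diff_left
          inner_commute[of x] algebra_simps)
    have "quadratic A b c x = l 1 * ((n1 \<bullet> x - d1) * (n2 \<bullet> x - d2))" for x
      unfolding p n12 \<theta>(2) by (simp add: power2_eq_square algebra_simps)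
    then have "{x. quadratic A b c x = 0} = {x. (n1 \<bullet> x - d1) * (n2 \<bullet> x - d2) = 0}" using l1 by simp
    then have Z: "openin (top_of_set {x. (n1 \<bullet> x - d1) * (n2 \<bullet> x - d2) = 0}) Q" using Q by simp
    have "cross3 n1 n2 \<bullet> cross3 n1 n2 = 4 * \<theta>\<^sup>2"
      unfolding lagrange_cross[symmetric]
      by (simp add: n1_def n2_def inner_add_left inner_diff_left inner_add_right inner_diff_right ee power2_eq_square algebra_simps)
    then have cr: "cross3 n1 n2 \<noteq> 0" using \<theta>(1) by auto
    then have "n1 \<noteq> 0" "n2 \<noteq> 0" by auto
    then obtain S where "is_plane S" "open_part_of Q S" using surface_in_two_planes[OF conn reg Z] cr by blast
    then show ?thesis by blast
  next
    case parallel
    \<comment> \<open>the roots of the quadratic polynomial in \<open>x \<bullet> e 1\<close>: one is \<open>q \<bullet> e 1\<close>, and they add up to \<open>- \<beta> 1 / l 1\<close>\<close>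
    define d1 d2 where "d1 = q \<bullet> e 1" and "d2 = - \<beta> 1 / l 1 - q \<bullet> e 1"
    have g1: "2 * l 1 * d1 + \<beta> 1 \<noteq> 0"
    proof
      assume "2 * l 1 * d1 + \<beta> 1 = 0"
      then have "2 * l k * (q \<bullet> e k) + \<beta> k = 0" for k using exhaust_3[of k] parallel by (auto simp: d1_def)
      then show False using gq by blast
    qed
    have "l 1 * d1\<^sup>2 + \<beta> 1 * d1 + c = 0" using q0 by (simp add: quadratic_principal sum_3 parallel d1_def)
    then have c: "c = - l 1 * d1\<^sup>2 - \<beta> 1 * d1" by simp
    have "quadratic A b c x = l 1 * ((e 1 \<bullet> x - d1) * (e 1 \<bullet> x - d2))" for x
    proof -
      have "quadratic A b c x = l 1 * (x \<bullet> e 1)\<^sup>2 + \<beta> 1 * (x \<bullet> e 1) + c"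
        by (simp add: quadratic_principal sum_3 parallel)
      also have "\<dots> = l 1 * ((x \<bullet> e 1 - d1) * (x \<bullet> e 1 - d2))"
        unfolding c d2_def d1_def[symmetric] using l1 by (simp add: field_simps power2_eq_square)
      finally show ?thesis by (simp add: inner_commute)
    qed
    then have "{x. quadratic A b c x = 0} = {x. (e 1 \<bullet> x - d1) * (e 1 \<bullet> x - d2) = 0}" using l1 by simp
    then have Z: "openin (top_of_set {x. (e 1 \<bullet> x - d1) * (e 1 \<bullet> x - d2) = 0}) Q" using Q by simp
    have "d1 \<noteq> d2" using g1 l1 by (auto simp: d2_def d1_def[symmetric] field_simps)
    then have disj: "cross3 (e 1) (e 1) \<noteq> 0 \<or> (\<forall>x. \<not> (e 1 \<bullet> x = d1 \<and> e 1 \<bullet> x = d2))" by auto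
    have "e 1 \<noteq> 0" using ee by auto
    then obtain S where "is_plane S" "open_part_of Q S" using surface_in_two_planes[OF conn reg Z _ _ disj] by blast
    then show ?thesis by blast
  qed
qed

end

theorem theorem1:
  fixes Q :: "(real^3) set" and G :: "real^3 \<Rightarrow> real^3"
  assumes "quadric_surface Q" and "gauss_map Q G"
  shows "(\<exists>M::real^3^3. laplacian_on Q G (\<lambda>x. M *v G x)) \<longleftrightarrow>
         (\<exists>S. (is_plane S \<or> is_circular_cylinder S \<or> is_sphere S) \<and> open_part_of Q S)"
proof
  assume "\<exists>S. (is_plane S \<or> is_circular_cylinder S \<or> is_sphere S) \<and> open_part_of Q S"
  then show "\<exists>M::real^3^3. laplacian_on Q G (\<lambda>x. M *v G x)"
    using laplacian_of_plane_cylinder_sphere[OF assms(2)] by blast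
next
  assume "\<exists>M::real^3^3. laplacian_on Q G (\<lambda>x. M *v G x)"
  then obtain M :: "real^3^3" where M: "laplacian_on Q G (\<lambda>x. M *v G x)" by blast
  obtain p where conn: "connected Q" and reg: "regular_surface Q" and ne: "Q \<noteq> {}"
    and p: "degree_two_polynomial p" "open_part_of Q {x. p x = 0}"
    using assms(1) unfolding quadric_surface_def by blast
  obtain A b c where A: "transpose A = A" "A \<noteq> 0" "p = quadratic A b c"
    using degree_two_polynomial_quadratic[OF p(1)] .
  have Q: "openin (top_of_set {x. quadratic A b c x = 0}) Q" using p(2) by (simp add: open_part_of_def A(3))
  obtain e l where "orthonormal_frame e" "\<forall>k. A *v e k = l k *\<^sub>R e k"
    and "l 1 \<noteq> 0" "l 3 \<noteq> 0 \<longrightarrow> l 2 \<noteq> 0" "l 2 = 0 \<longrightarrow> b \<bullet> e 3 = 0"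
    by (rule principal_axes[OF A(1,2), of b])
  then have e: "orthonormal_frame e" "\<And>k. A *v e k = l k *\<^sub>R e k"
    and ord: "l 1 \<noteq> 0" "l 3 \<noteq> 0 \<Longrightarrow> l 2 \<noteq> 0" "l 2 = 0 \<Longrightarrow> b \<bullet> e 3 = 0" by auto
  show "\<exists>S. (is_plane S \<or> is_circular_cylinder S \<or> is_sphere S) \<and> open_part_of Q S"
  proof (cases "\<exists>q\<in>Q. gradient A b q \<noteq> 0")
    case True
    then obtain q where q: "q \<in> Q" "gradient A b q \<noteq> 0" by blast
    note cases = principal_cases[where e = e and l = l, OF A(1) e assms(2) M reg Q q ord]
    show ?thesis
      by (rule shape_from_principal_cases[where e = e and l = l, OF A(1) e conn reg Q q ord(1) cases])
  next
    case False
    obtain q where q: "q \<in> Q" using ne by blast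
    have sing: "gradient A b x = 0" if "x \<in> Q" for x using False that by blast
    have "is_plane {x. quadratic A b c x = 0}"
      by (rule plane_of_singular_surface[where e = e and l = l, OF A(1) e reg Q q sing ord(1,2)])
    moreover have "open_part_of Q {x. quadratic A b c x = 0}" using Q unfolding open_part_of_def .
    ultimately show ?thesis by blast
  qed
qed

end
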